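(* Let $J=[0,T]\ni t\mapsto X_t\in\Gamma(TM)$ and $J\ni t\mapsto Y_t\in\Gamma(TM)$ be two smooth complete time dependent vector fields on $M$ with corresponding flows $\mu^X$ and $\mu^Y$. Then for every $m\in M$ and $t\in(0,T]$, $$d\big(\mu^X_{t,0}(m),\mu^Y_{t,0}(m)\big)\le\int_0^t e^{\int_s^t|\nabla X_\sigma|_{\mu^X_{\sigma,s}(m)}\,d\sigma}\cdot|Y_s-X_s|_{\mu^Y_{s,0}(m)}\,ds\le e^{|\nabla X_\cdot|^*_t}\,|Y_\cdot-X_\cdot|^*_t,$$ $$d\big(\mu^Y_{t,0}(m),m\big)\le\int_0^t|Y_s|_{\mu^Y_{s,0}(m)}\,ds\le|Y|^*_t,$$ and $$d\big(\mu^Y_{t,0}(m),m\big)\le\int_0^t e^{\int_s^t|\nabla Y_\sigma|_{\mu^Y_{\sigma,s}(m)}\,d\sigma}\cdot|Y_s|_m\,ds\le e^{|\nabla Y|^*_t}\int_0^t|Y_s(m)|\,ds .$$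
   Context: $M$ is a connected smooth manifold without boundary with Riemannian metric $g$; $d$ is the induced length metric, $\nabla$ the Levi-Civita covariant derivative, $\Gamma(TM)$ the space of smooth vector fields. A smoothly varying time dependent vector field $[0,T]\ni t\mapsto Y_t$ is complete if for every $s\in[0,T]$ and $m\in M$ there is a solution $\sigma:[0,T]\to M$ of $\dot\sigma(t)=Y_t(\sigma(t))$, $\sigma(s)=m$ (one-sided derivatives at the end points); then $\mu^Y_{t,s}(m):=\sigma(t)$, so $\frac{d}{dt}\mu^Y_{t,s}=Y_t\circ\mu^Y_{t,s}$ and $\mu^Y_{s,s}=Id_M$. For $X\in\Gamma(TM)$ and $m\in M$: $|X|_m=|X(m)|_g$ and $|\nabla X|_m=\sup_{v\in T_mM,|v|=1}|\nabla_vX|_g$. For a family $\rho_m(t)\ge0$ put $|\rho|^*_t:=\int_0^t\sup_{m\in M}\rho_m(s)\,ds$; thus $|Y|^*_t=\int_0^t\sup_m|Y_s|_m\,ds$ and $|\nabla Y|^*_t=\int_0^t\sup_m|\nabla Y_s|_m\,ds$.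
   Formalization: In the first chain $|\nabla X_\sigma|$ is evaluated at $\mu^X_{\sigma,s}(\mu^Y_{s,0}(m))$ instead of $\mu^X_{\sigma,s}(m)$, since the estimate is false with the latter; $M$ has positive dimension. *)

theory Defs
  imports "HOL-Analysis.Analysis"
begin

section \<open>Differentiability of class C^k on a subset of a normed space\<close>

(* All derivatives are taken within S, hence one-sided at boundary points of S.  S will be an
   open set, a relatively open subset of a compact interval, or a product of a compact interval
   with an open set, so derivatives within S are unique.  In finite dimensions the requirement
   that every directional derivative x -> f' x v is C^k says that x -> f' x is C^k. *)
primrec cont_diff_on ::
  "nat \<Rightarrow> ('a::real_normed_vector \<Rightarrow> 'b::real_normed_vector) \<Rightarrow> 'a set \<Rightarrow> bool" where
  "cont_diff_on 0 f S \<longleftrightarrow> continuous_on S f"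
| "cont_diff_on (Suc k) f S \<longleftrightarrow>
     (\<exists>f'. (\<forall>x\<in>S. (f has_derivative f' x) (at x within S)) \<and>
           (\<forall>v. cont_diff_on k (\<lambda>x. f' x v) S))"

definition smooth_on :: "('a::real_normed_vector \<Rightarrow> 'b::real_normed_vector) \<Rightarrow> 'a set \<Rightarrow> bool" where
  "smooth_on f S \<longleftrightarrow> (\<forall>k. cont_diff_on k f S)"


section \<open>Smooth manifolds\<close>

(* The underlying space of the manifold is a whole type 'm. *)
type_synonym ('m, 'e) chart = "'m set \<times> ('m \<Rightarrow> 'e)"

definition chart_inv :: "('m, 'e) chart \<Rightarrow> 'e \<Rightarrow> 'm" where
  "chart_inv c = inv_into (fst c) (snd c)"

definition is_chart :: "('m::topological_space, 'e::euclidean_space) chart \<Rightarrow> bool" where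
  "is_chart c \<longleftrightarrow> open (fst c) \<and> open (snd c ` fst c) \<and>
     homeomorphism (fst c) (snd c ` fst c) (snd c) (chart_inv c)"

definition smooth_atlas :: "('m::topological_space, 'e::euclidean_space) chart set \<Rightarrow> bool" where
  "smooth_atlas A \<longleftrightarrow>
     (\<forall>c\<in>A. is_chart c) \<and> (\<Union>c\<in>A. fst c) = UNIV \<and>
     (\<forall>c\<in>A. \<forall>c'\<in>A. smooth_on (snd c' \<circ> chart_inv c) (snd c ` (fst c \<inter> fst c')))"

(* A preferred chart around p.  The tangent space at p is represented by the model space 'e:
   the vector v :: 'e stands for the tangent vector at p whose coordinates in chart_at A p are v.
   Its coordinates in any other chart are then given by tangent_coord. *)
definition chart_at :: "('m, 'e) chart set \<Rightarrow> 'm \<Rightarrow> ('m, 'e) chart" where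
  "chart_at A p = (SOME c. c \<in> A \<and> p \<in> fst c)"

definition tangent_coord ::
  "('m, 'e::euclidean_space) chart set \<Rightarrow> ('m, 'e) chart \<Rightarrow> 'm \<Rightarrow> 'e \<Rightarrow> 'e" where
  "tangent_coord A c p =
     frechet_derivative (snd c \<circ> chart_inv (chart_at A p)) (at (snd (chart_at A p) p))"

(* The tangent vector at p with coordinates u in the chart c. *)
definition tangent_of_coord ::
  "('m, 'e::euclidean_space) chart set \<Rightarrow> ('m, 'e) chart \<Rightarrow> 'm \<Rightarrow> 'e \<Rightarrow> 'e" where
  "tangent_of_coord A c p =
     frechet_derivative (snd (chart_at A p) \<circ> chart_inv c) (at (snd c p))"

definition smooth_fun_on ::
  "('m, 'e::euclidean_space) chart set \<Rightarrow> 'm set \<Rightarrow> ('m \<Rightarrow> real) \<Rightarrow> bool" where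
  "smooth_fun_on A U f \<longleftrightarrow> (\<forall>c\<in>A. smooth_on (f \<circ> chart_inv c) (snd c ` (fst c \<inter> U)))"

definition smooth_vector_field_on ::
  "('m, 'e::euclidean_space) chart set \<Rightarrow> 'm set \<Rightarrow> ('m \<Rightarrow> 'e) \<Rightarrow> bool" where
  "smooth_vector_field_on A U X \<longleftrightarrow>
     (\<forall>c\<in>A. smooth_on (\<lambda>x. tangent_coord A c (chart_inv c x) (X (chart_inv c x)))
                      (snd c ` (fst c \<inter> U)))"

(* Smoothness jointly in time and space, up to the end points of {0..T}. *)
definition smooth_time_dependent_field ::
  "('m, 'e::euclidean_space) chart set \<Rightarrow> real \<Rightarrow> (real \<Rightarrow> 'm \<Rightarrow> 'e) \<Rightarrow> bool" where
  "smooth_time_dependent_field A T X \<longleftrightarrow>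
     (\<forall>c\<in>A. smooth_on (\<lambda>(t, x). tangent_coord A c (chart_inv c x) (X t (chart_inv c x)))
                      ({0..T} \<times> snd c ` fst c))"

(* v(f), the derivative of the function f along the tangent vector v at p. *)
definition vector_apply ::
  "('m, 'e::euclidean_space) chart set \<Rightarrow> 'm \<Rightarrow> 'e \<Rightarrow> ('m \<Rightarrow> real) \<Rightarrow> real" where
  "vector_apply A p v f =
     frechet_derivative (f \<circ> chart_inv (chart_at A p)) (at (snd (chart_at A p) p)) v"

(* The curve has velocity v at time t relative to S.  Continuity has to be required separately,
   since the chart is an arbitrary function outside its domain. *)
definition has_velocity ::
  "('m::topological_space, 'e::euclidean_space) chart set \<Rightarrow> (real \<Rightarrow> 'm) \<Rightarrow> 'e \<Rightarrow> real
     \<Rightarrow> real set \<Rightarrow> bool" where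
  "has_velocity A \<gamma> v t S \<longleftrightarrow>
     continuous (at t within S) \<gamma> \<and>
     ((\<lambda>u. snd (chart_at A (\<gamma> t)) (\<gamma> u)) has_vector_derivative v) (at t within S)"


section \<open>Riemannian metrics, the length metric and the Levi-Civita connection\<close>

definition riemannian_metric ::
  "('m, 'e::euclidean_space) chart set \<Rightarrow> ('m \<Rightarrow> 'e \<Rightarrow> 'e \<Rightarrow> real) \<Rightarrow> bool" where
  "riemannian_metric A g \<longleftrightarrow>
     (\<forall>p. bilinear (g p) \<and> (\<forall>u v. g p u v = g p v u) \<and> (\<forall>v. v \<noteq> 0 \<longrightarrow> g p v v > 0)) \<and>
     (\<forall>c\<in>A. \<forall>u v. smooth_on
        (\<lambda>x. g (chart_inv c x) (tangent_of_coord A c (chart_inv c x) u)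
                               (tangent_of_coord A c (chart_inv c x) v))
        (snd c ` fst c))"

definition gnorm :: "('m \<Rightarrow> 'e \<Rightarrow> 'e \<Rightarrow> real) \<Rightarrow> 'm \<Rightarrow> 'e \<Rightarrow> real" where
  "gnorm g p v = sqrt (g p v v)"

definition C1_curve_on ::
  "('m::topological_space, 'e::euclidean_space) chart set \<Rightarrow> real set \<Rightarrow> (real \<Rightarrow> 'm) \<Rightarrow> bool" where
  "C1_curve_on A I \<gamma> \<longleftrightarrow>
     continuous_on I \<gamma> \<and> (\<forall>c\<in>A. cont_diff_on 1 (snd c \<circ> \<gamma>) (I \<inter> \<gamma> -` fst c))"

(* B is the finite set of break points; the curve is C^1 up to the end points of each closed
   piece (cf. piecewise_C1_differentiable_on, which would admit unrectifiable curves). *)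
definition piecewise_C1_curve ::
  "('m::topological_space, 'e::euclidean_space) chart set \<Rightarrow> (real \<Rightarrow> 'm) \<Rightarrow> bool" where
  "piecewise_C1_curve A \<gamma> \<longleftrightarrow>
     continuous_on {0..1} \<gamma> \<and>
     (\<exists>B. finite B \<and>
        (\<forall>a b. 0 \<le> a \<and> a < b \<and> b \<le> 1 \<and> B \<inter> {a<..<b} = {} \<longrightarrow> C1_curve_on A {a..b} \<gamma>))"

definition curve_length ::
  "('m, 'e::euclidean_space) chart set \<Rightarrow> ('m \<Rightarrow> 'e \<Rightarrow> 'e \<Rightarrow> real) \<Rightarrow> (real \<Rightarrow> 'm) \<Rightarrow> real" where
  "curve_length A g \<gamma> = integral {0..1}
     (\<lambda>t. gnorm g (\<gamma> t) (vector_derivative (\<lambda>u. snd (chart_at A (\<gamma> t)) (\<gamma> u)) (at t)))"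

definition riemannian_dist ::
  "('m::topological_space, 'e::euclidean_space) chart set \<Rightarrow> ('m \<Rightarrow> 'e \<Rightarrow> 'e \<Rightarrow> real)
     \<Rightarrow> 'm \<Rightarrow> 'm \<Rightarrow> real" where
  "riemannian_dist A g p q =
     Inf {curve_length A g \<gamma> |\<gamma>. piecewise_C1_curve A \<gamma> \<and> \<gamma> 0 = p \<and> \<gamma> 1 = q}"

(* nabla p v X is the covariant derivative of X along the tangent vector v at p.  It is applied
   to vector fields defined and smooth on some open set (global ones being the case U = UNIV);
   their values outside U are irrelevant. *)
definition affine_connection ::
  "('m::topological_space, 'e::euclidean_space) chart set \<Rightarrow> ('m \<Rightarrow> 'e \<Rightarrow> ('m \<Rightarrow> 'e) \<Rightarrow> 'e)
     \<Rightarrow> bool" where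
  "affine_connection A nabla \<longleftrightarrow>
     (\<forall>U X Y f. open U \<and> smooth_vector_field_on A U X \<and> smooth_vector_field_on A U Y \<and>
        smooth_fun_on A U f \<longrightarrow>
        smooth_vector_field_on A U (\<lambda>q. nabla q (X q) Y) \<and>
        (\<forall>p\<in>U. linear (\<lambda>v. nabla p v X)) \<and>
        (\<forall>p\<in>U. \<forall>v. nabla p v (\<lambda>q. X q + Y q) = nabla p v X + nabla p v Y) \<and>
        (\<forall>p\<in>U. \<forall>v. nabla p v (\<lambda>q. f q *\<^sub>R X q) =
           vector_apply A p v f *\<^sub>R X p + f p *\<^sub>R nabla p v X))"

definition metric_compatible ::
  "('m::topological_space, 'e::euclidean_space) chart set \<Rightarrow> ('m \<Rightarrow> 'e \<Rightarrow> 'e \<Rightarrow> real)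
     \<Rightarrow> ('m \<Rightarrow> 'e \<Rightarrow> ('m \<Rightarrow> 'e) \<Rightarrow> 'e) \<Rightarrow> bool" where
  "metric_compatible A g nabla \<longleftrightarrow>
     (\<forall>U X Y. open U \<and> smooth_vector_field_on A U X \<and> smooth_vector_field_on A U Y \<longrightarrow>
        (\<forall>p\<in>U. \<forall>v. vector_apply A p v (\<lambda>q. g q (X q) (Y q)) =
           g p (nabla p v X) (Y p) + g p (X p) (nabla p v Y)))"

(* nabla_X Y - nabla_Y X = [X, Y], where [X, Y] f = X (Y f) - Y (X f). *)
definition torsion_free ::
  "('m::topological_space, 'e::euclidean_space) chart set \<Rightarrow> ('m \<Rightarrow> 'e \<Rightarrow> ('m \<Rightarrow> 'e) \<Rightarrow> 'e)
     \<Rightarrow> bool" where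
  "torsion_free A nabla \<longleftrightarrow>
     (\<forall>U X Y f. open U \<and> smooth_vector_field_on A U X \<and> smooth_vector_field_on A U Y \<and>
        smooth_fun_on A U f \<longrightarrow>
        (\<forall>p\<in>U. vector_apply A p (nabla p (X p) Y - nabla p (Y p) X) f =
           vector_apply A p (X p) (\<lambda>q. vector_apply A q (Y q) f) -
           vector_apply A p (Y p) (\<lambda>q. vector_apply A q (X q) f)))"

definition levi_civita ::
  "('m::topological_space, 'e::euclidean_space) chart set \<Rightarrow> ('m \<Rightarrow> 'e \<Rightarrow> 'e \<Rightarrow> real)
     \<Rightarrow> ('m \<Rightarrow> 'e \<Rightarrow> ('m \<Rightarrow> 'e) \<Rightarrow> 'e) \<Rightarrow> bool" where
  "levi_civita A g nabla \<longleftrightarrow>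
     affine_connection A nabla \<and> metric_compatible A g nabla \<and> torsion_free A nabla"

definition nabla_norm ::
  "('m \<Rightarrow> 'e \<Rightarrow> 'e \<Rightarrow> real) \<Rightarrow> ('m \<Rightarrow> 'e \<Rightarrow> ('m \<Rightarrow> 'e) \<Rightarrow> 'e) \<Rightarrow> ('m \<Rightarrow> 'e) \<Rightarrow> 'm \<Rightarrow> real" where
  "nabla_norm g nabla X p = (SUP v\<in>{v. gnorm g p v = 1}. gnorm g p (nabla p v X))"


section \<open>Flows of time dependent vector fields\<close>

definition integral_curve ::
  "('m::topological_space, 'e::euclidean_space) chart set \<Rightarrow> real \<Rightarrow> (real \<Rightarrow> 'm \<Rightarrow> 'e)
     \<Rightarrow> real \<Rightarrow> 'm \<Rightarrow> (real \<Rightarrow> 'm) \<Rightarrow> bool" where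
  "integral_curve A T Y s m \<sigma> \<longleftrightarrow>
     \<sigma> s = m \<and> (\<forall>t\<in>{0..T}. has_velocity A \<sigma> (Y t (\<sigma> t)) t {0..T})"

definition complete_field ::
  "('m::topological_space, 'e::euclidean_space) chart set \<Rightarrow> real \<Rightarrow> (real \<Rightarrow> 'm \<Rightarrow> 'e) \<Rightarrow> bool" where
  "complete_field A T Y \<longleftrightarrow> (\<forall>s\<in>{0..T}. \<forall>m. \<exists>\<sigma>. integral_curve A T Y s m \<sigma>)"

(* flow A T Y t s is mu^Y_{t,s}.  Integral curves of smooth fields on a Hausdorff manifold are
   unique on {0..T}, so the choice is immaterial. *)
definition flow ::
  "('m::topological_space, 'e::euclidean_space) chart set \<Rightarrow> real \<Rightarrow> (real \<Rightarrow> 'm \<Rightarrow> 'e)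
     \<Rightarrow> real \<Rightarrow> real \<Rightarrow> 'm \<Rightarrow> 'm" where
  "flow A T Y t s m = (SOME \<sigma>. integral_curve A T Y s m \<sigma>) t"


section \<open>Extended real bounds\<close>

(* |rho|^*_t; the supremum and the integral may be infinite. *)
definition star_norm :: "('m \<Rightarrow> real \<Rightarrow> real) \<Rightarrow> real \<Rightarrow> ennreal" where
  "star_norm \<rho> t = (\<integral>\<^sup>+ s\<in>{0..t}. (SUP m. ennreal (\<rho> m s)) \<partial>lborel)"

definition exp_ennreal :: "ennreal \<Rightarrow> ennreal" where
  "exp_ennreal x = (if x = \<infinity> then \<infinity> else ennreal (exp (enn2real x)))"

(* Base point of |nabla X| in the comparison of the two flows.  The curve behind that estimate is
   s -> mu^X_{t,s}(mu^Y_{s,0}(m)), and the differential of mu^X_{t,s} is taken at mu^Y_{s,0}(m);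
   so |nabla X_sigma| is evaluated at mu^X_{sigma,s}(mu^Y_{s,0}(m)).  With mu^X_{sigma,s}(m)
   instead the estimate fails: on the real line, let X vanish for x <= 1/2 and increase
   to 1 beyond, Y = X + 1 and m = 0; the bound would be t, but mu^Y_{t,0}(0) > t for t > 1/2. *)

end

(* The curve s -> mu^X_{t,s}(mu^Y_{s,0}(m)) joins mu^X_{t,0}(m) to mu^Y_{t,0}(m), and its length is at
   most the first integral. To avoid differentiating the flow with respect to the initial value,
   infinitesimally close integral curves x, y of X are compared directly: in a chart, w = y - x
   satisfies d/dt g(w,w) = (L_X g)(w,w) + o(|w|^2) along x, and (L_X g)(w,w) = 2 g(nabla_w X, w) is at
   most 2 |nabla X| g(w,w) because nabla is metric and torsion free. Gronwall's inequality bounds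
   the growth of |w| to first order. Points of the curve for neighbouring parameters s can thus be
   joined by short coordinate segments, and concatenating them gives paths whose length is
   arbitrarily close to the integral. The second estimate is the case X = 0, and the third one
   compares Y with the zero field. Both "local to global" steps are bisection arguments (Bolzano). *)

theory Submission
  imports Defs
begin

section \<open>Calculus of class C^k maps\<close>

text \<open>The differential of the flow is replaced by a statement about neighbourhoods: for every
  \<epsilon> > 0 and every neighbourhood V of \<open>x b\<close> there is a neighbourhood U of
  \<open>x a\<close> such that solutions starting in U end in V, and the size of w grows at most by
  the factor exp (I + \<epsilon>), with I the integral of |nabla X|. Exponents add when time
  intervals are concatenated, and V feeds the neighbourhood found for the later interval into the
  earlier one. The size of w is no function on the manifold, since w depends on a chart; but
  measured with the metric at x it is independent of the chart up to a factor 1 + \<epsilon> near x,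
  and such factors disappear in exp \<epsilon>. The obstacle is a circle: the estimate in a chart
  holds only while y stays close to x, and only the estimate keeps it there. Outside its domain a
  chart is an arbitrary function, so coordinates of y mean nothing until y is known to remain in the
  domain. A continuation argument settles both.\<close>

lemma cont_diff_on_subset:
  "cont_diff_on k f S \<Longrightarrow> R \<subseteq> S \<Longrightarrow> cont_diff_on k f R"
proof (induction k arbitrary: f)
  case 0
  then show ?case by (auto intro: continuous_on_subset)
next
  case (Suc k)
  then show ?case
    by (auto 4 4 intro: has_derivative_subset)
qed

lemma cont_diff_on_SucD: "cont_diff_on (Suc k) f S \<Longrightarrow> cont_diff_on k f S"
proof (induction k arbitrary: f)
  case 0
  then show ?case
    by (auto simp: continuous_on_eq_continuous_within intro: has_derivative_continuous)
next
  case (Suc k)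
  then show ?case by (metis cont_diff_on.simps(2))
qed

lemma cont_diff_on_cong:
  assumes "cont_diff_on k f S" and "\<And>x. x \<in> S \<Longrightarrow> f x = g x"
  shows "cont_diff_on k g S"
proof (cases k)
  case 0
  then show ?thesis using assms by (simp cong: continuous_on_cong)
next
  case (Suc n)
  then obtain f' where f': "\<forall>x\<in>S. (f has_derivative f' x) (at x within S)"
    "\<forall>v. cont_diff_on n (\<lambda>x. f' x v) S"
    using assms(1) by auto
  have "(g has_derivative f' x) (at x within S)" if "x \<in> S" for x
    using has_derivative_transform[OF that _ f'(1)[rule_format, OF that], of g] assms(2) by auto
  then show ?thesis using f'(2) Suc by auto
qed

lemma cont_diff_on_const: "cont_diff_on k (\<lambda>x. c) S"
proof (induction k arbitrary: c)
  case (Suc k)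
  then show ?case
    unfolding cont_diff_on.simps by (intro exI[of _ "\<lambda>x v. 0"]) auto
qed auto

lemma cont_diff_on_add:
  "cont_diff_on k f S \<Longrightarrow> cont_diff_on k g S \<Longrightarrow> cont_diff_on k (\<lambda>x. f x + g x) S"
proof (induction k arbitrary: f g)
  case 0
  then show ?case by (auto intro: continuous_intros)
next
  case (Suc k)
  obtain f' where f': "\<forall>x\<in>S. (f has_derivative f' x) (at x within S)"
    "\<forall>v. cont_diff_on k (\<lambda>x. f' x v) S"
    using Suc.prems(1) by auto
  obtain g' where g': "\<forall>x\<in>S. (g has_derivative g' x) (at x within S)"
    "\<forall>v. cont_diff_on k (\<lambda>x. g' x v) S"
    using Suc.prems(2) by auto
  have "((\<lambda>x. f x + g x) has_derivative (\<lambda>v. f' x v + g' x v)) (at x within S)" if "x \<in> S" for x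
    using f'(1) g'(1) that by (auto intro: has_derivative_add)
  moreover have "cont_diff_on k (\<lambda>x. f' x v + g' x v) S" for v
    using f' g' Suc.IH by auto
  ultimately show ?case
    unfolding cont_diff_on.simps by (intro exI[of _ "\<lambda>x v. f' x v + g' x v"]) auto
qed

lemma cont_diff_on_sum:
  "(\<And>i. i \<in> I \<Longrightarrow> cont_diff_on k (f i) S) \<Longrightarrow> cont_diff_on k (\<lambda>x. \<Sum>i\<in>I. f i x) S"
  by (induction I rule: infinite_finite_induct)
    (auto intro: cont_diff_on_const cont_diff_on_add)

lemma cont_diff_on_bounded_bilinear:
  assumes "bounded_bilinear p" and "cont_diff_on k f S" and "cont_diff_on k g S"
  shows "cont_diff_on k (\<lambda>x. p (f x) (g x)) S"
  using assms(2,3)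
proof (induction k arbitrary: f g)
  case 0
  then show ?case by (auto intro: bounded_bilinear.continuous_on[OF assms(1)])
next
  case (Suc k)
  obtain f' where f': "\<forall>x\<in>S. (f has_derivative f' x) (at x within S)"
    "\<forall>v. cont_diff_on k (\<lambda>x. f' x v) S"
    using Suc.prems(1) by auto
  obtain g' where g': "\<forall>x\<in>S. (g has_derivative g' x) (at x within S)"
    "\<forall>v. cont_diff_on k (\<lambda>x. g' x v) S"
    using Suc.prems(2) by auto
  have "((\<lambda>x. p (f x) (g x)) has_derivative (\<lambda>v. p (f x) (g' x v) + p (f' x v) (g x))) (at x within S)"
    if "x \<in> S" for x
    using f'(1) g'(1) that by (intro bounded_bilinear.FDERIV[OF assms(1)]) auto
  moreover have "cont_diff_on k (\<lambda>x. p (f x) (g' x v) + p (f' x v) (g x)) S" for v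
    using f' g' Suc.IH Suc.prems[THEN cont_diff_on_SucD] by (auto intro: cont_diff_on_add)
  ultimately show ?case
    unfolding cont_diff_on.simps
    by (intro exI[of _ "\<lambda>x v. p (f x) (g' x v) + p (f' x v) (g x)"]) auto
qed

lemma cont_diff_on_bounded_linear:
  assumes "bounded_linear L" and "cont_diff_on k f S"
  shows "cont_diff_on k (\<lambda>x. L (f x)) S"
  using assms(2)
proof (induction k arbitrary: f)
  case 0
  then show ?case using assms(1) by (auto intro: bounded_linear.continuous_on)
next
  case (Suc k)
  obtain f' where f': "\<forall>x\<in>S. (f has_derivative f' x) (at x within S)"
    "\<forall>v. cont_diff_on k (\<lambda>x. f' x v) S"
    using Suc.prems(1) by auto
  then show ?case
    unfolding cont_diff_on.simps
    by (intro exI[of _ "\<lambda>x v. L (f' x v)"])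
      (auto intro: bounded_linear.has_derivative[OF assms(1)] Suc.IH)
qed

lemma cont_diff_on_ident: "cont_diff_on k (\<lambda>x. x) S"
proof (cases k)
  case (Suc n)
  then show ?thesis
    unfolding Suc cont_diff_on.simps
    by (intro exI[of _ "\<lambda>x v. v"]) (auto intro: cont_diff_on_const)
qed auto

text \<open>Continuity and differentiability are available only for fixed direction vectors, as in
  \<open>cont_diff_on\<close>. Expanding in \<open>Basis\<close> turns them into statements about
  directions that vary with the point.\<close>

lemma linear_basis_expansion:
  fixes f :: "'a::euclidean_space \<Rightarrow> 'b::real_vector"
  assumes "linear f"
  shows "f x = (\<Sum>i\<in>Basis. (x \<bullet> i) *\<^sub>R f i)"
proof -
  have "f x = f (\<Sum>i\<in>Basis. (x \<bullet> i) *\<^sub>R i)" by (simp add: euclidean_representation)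
  also have "\<dots> = (\<Sum>i\<in>Basis. (x \<bullet> i) *\<^sub>R f i)"
    using assms by (simp add: linear_sum linear_scale)
  finally show ?thesis .
qed

text \<open>Chain rule by induction on k. The direction \<open>g' x v\<close> depends on x, whereas
  \<open>cont_diff_on\<close> only speaks of \<open>f' x i\<close> for fixed i. Expanding the
  direction in the basis of the Euclidean middle space leaves finitely many products, to whose
  factors the induction hypothesis applies.\<close>

lemma cont_diff_on_compose:
  fixes g :: "'a::real_normed_vector \<Rightarrow> 'b::euclidean_space"
  assumes "cont_diff_on k f S" and "cont_diff_on k g R" and "g ` R \<subseteq> S"
  shows "cont_diff_on k (\<lambda>x. f (g x)) R"
  using assms
proof (induction k arbitrary: f)
  case 0
  then show ?case by (auto intro: continuous_on_compose2)
next
  case (Suc k)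
  obtain f' where f': "\<forall>x\<in>S. (f has_derivative f' x) (at x within S)"
    "\<forall>v. cont_diff_on k (\<lambda>x. f' x v) S"
    using Suc.prems(1) by auto
  obtain g' where g': "\<forall>x\<in>R. (g has_derivative g' x) (at x within R)"
    "\<forall>v. cont_diff_on k (\<lambda>x. g' x v) R"
    using Suc.prems(2) by auto
  have "((\<lambda>x. f (g x)) has_derivative (\<lambda>v. f' (g x) (g' x v))) (at x within R)"
    if "x \<in> R" for x
    using f'(1) g'(1) that Suc.prems(3) has_derivative_in_compose2[where t = S] by blast
  moreover have "cont_diff_on k (\<lambda>x. f' (g x) (g' x v)) R" for v
  proof (rule cont_diff_on_cong)
    have "cont_diff_on k g R" using Suc.prems(2) by (rule cont_diff_on_SucD)
    then show "cont_diff_on k (\<lambda>x. \<Sum>i\<in>Basis. (g' x v \<bullet> i) *\<^sub>R f' (g x) i) R"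
      using f'(2) g'(2) Suc.prems(3)
      by (intro cont_diff_on_sum cont_diff_on_bounded_bilinear[OF bounded_bilinear_scaleR]
          cont_diff_on_bounded_linear[OF bounded_linear_inner_left] Suc.IH) auto
    show "(\<Sum>i\<in>Basis. (g' x v \<bullet> i) *\<^sub>R f' (g x) i) = f' (g x) (g' x v)" if "x \<in> R" for x
      using f'(1) Suc.prems(3) that
      by (intro linear_basis_expansion[symmetric] has_derivative_linear) blast
  qed
  ultimately show ?case
    unfolding cont_diff_on.simps
    by (intro exI[of _ "\<lambda>x v. f' (g x) (g' x v)"]) auto
qed

lemma cont_diff_on_imp_continuous_on: "cont_diff_on k f S \<Longrightarrow> continuous_on S f"
  by (induction k) (auto dest: cont_diff_on_SucD simp del: cont_diff_on.simps(2))

lemma smooth_on_subset: "smooth_on f S \<Longrightarrow> R \<subseteq> S \<Longrightarrow> smooth_on f R"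
  unfolding smooth_on_def using cont_diff_on_subset by blast

lemma smooth_on_cong: "smooth_on f S \<Longrightarrow> (\<And>x. x \<in> S \<Longrightarrow> f x = g x) \<Longrightarrow> smooth_on g S"
  unfolding smooth_on_def using cont_diff_on_cong by blast

lemma smooth_on_compose:
  fixes g :: "'a::real_normed_vector \<Rightarrow> 'b::euclidean_space"
  shows "smooth_on f S \<Longrightarrow> smooth_on g R \<Longrightarrow> g ` R \<subseteq> S \<Longrightarrow> smooth_on (\<lambda>x. f (g x)) R"
  unfolding smooth_on_def using cont_diff_on_compose by blast

lemma smooth_on_const: "smooth_on (\<lambda>x. c) S"
  unfolding smooth_on_def by (simp add: cont_diff_on_const)

lemma smooth_on_bounded_linear:
  "bounded_linear L \<Longrightarrow> smooth_on f S \<Longrightarrow> smooth_on (\<lambda>x. L (f x)) S"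
  unfolding smooth_on_def by (simp add: cont_diff_on_bounded_linear)

lemma smooth_on_imp_continuous_on: "smooth_on f S \<Longrightarrow> continuous_on S f"
  unfolding smooth_on_def using cont_diff_on_imp_continuous_on by blast

lemma smooth_on_has_derivative:
  assumes "smooth_on f S" and "open S" and "x \<in> S"
  shows "(f has_derivative frechet_derivative f (at x)) (at x)"
proof -
  have "cont_diff_on 1 f S" using assms(1) by (simp add: smooth_on_def)
  then obtain f' where "(f has_derivative f' x) (at x within S)" using assms(3) by auto
  then have "(f has_derivative f' x) (at x)" by (simp only: at_within_open[OF assms(3,2)])
  then show ?thesis using frechet_derivative_at by metis
qed

text \<open>The derivatives in \<open>cont_diff_on\<close> are existential witnesses. On an open set
  derivatives are unique, so each witness agrees with \<open>frechet_derivative\<close>, whichever k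
  it comes from.\<close>

lemma smooth_on_frechet_derivative:
  assumes "smooth_on f S" and "open S"
  shows "smooth_on (\<lambda>x. frechet_derivative f (at x) v) S"
  unfolding smooth_on_def
proof
  fix k
  have "cont_diff_on (Suc k) f S" using assms(1) by (simp add: smooth_on_def)
  then obtain f' where f': "\<forall>x\<in>S. (f has_derivative f' x) (at x within S)"
    "\<forall>v. cont_diff_on k (\<lambda>x. f' x v) S"
    by auto
  have "f' x v = frechet_derivative f (at x) v" if "x \<in> S" for x
  proof -
    have "(f has_derivative f' x) (at x)"
      using f'(1)[rule_format, OF that] by (simp only: at_within_open[OF that assms(2)])
    then show ?thesis using frechet_derivative_at by metis
  qed
  then show "cont_diff_on k (\<lambda>x. frechet_derivative f (at x) v) S"
    by (intro cont_diff_on_cong[OF f'(2)[rule_format]])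
qed

section \<open>Functions of time and space: slices at a fixed time\<close>

lemma smooth_on_slice:
  fixes f :: "real \<times> 'a::euclidean_space \<Rightarrow> 'b::real_normed_vector"
  assumes "smooth_on f (I \<times> S)" and "t \<in> I"
  shows "smooth_on (\<lambda>x. f (t, x)) S"
  unfolding smooth_on_def
proof
  fix k
  have 1: "cont_diff_on k (\<lambda>x::'a. (t, x)) S"
  proof (cases k)
    case (Suc n)
    have "((\<lambda>x. (t, x)) has_derivative (\<lambda>v. (0, v))) (at x within S)" for x :: 'a
      by (auto intro!: derivative_eq_intros)
    then show ?thesis
      unfolding Suc cont_diff_on.simps
      by (intro exI[of _ "\<lambda>x v. (0, v)"]) (auto intro: cont_diff_on_const)
  qed (auto intro: continuous_intros)
  have "cont_diff_on k f (I \<times> S)" using assms(1) by (simp add: smooth_on_def)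
  from cont_diff_on_compose[OF this 1] show "cont_diff_on k (\<lambda>x. f (t, x)) S"
    using assms(2) by auto
qed

text \<open>The time set I is a closed interval in the application, so derivatives are taken within
  I \<times> S. Since S is open, the derivative in the direction (0, v) is the ordinary derivative
  of the slice, and it inherits joint continuity from the C^1 condition on the product.\<close>

lemma smooth_on_slice_derivative:
  fixes f :: "real \<times> 'a::euclidean_space \<Rightarrow> 'b::real_normed_vector"
  assumes "smooth_on f (I \<times> S)" and "open S"
  shows "continuous_on (I \<times> S) (\<lambda>(t, x). frechet_derivative (\<lambda>x. f (t, x)) (at x) v)"
proof -
  have "cont_diff_on 1 f (I \<times> S)" using assms(1) by (simp add: smooth_on_def)
  then obtain f' where f': "\<forall>x\<in>I \<times> S. (f has_derivative f' x) (at x within I \<times> S)"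
    "\<forall>v. continuous_on (I \<times> S) (\<lambda>x. f' x v)"
    by auto
  have "f' (t, x) (0, v) = frechet_derivative (\<lambda>x. f (t, x)) (at x) v" if "t \<in> I" "x \<in> S" for t x
  proof -
    have "((\<lambda>x. f (t, x)) has_derivative (\<lambda>v. f' (t, x) (0, v))) (at x within S)"
    proof (rule has_derivative_in_compose2[where t = "I \<times> S" and g = f and g' = f'])
      show "((\<lambda>x. (t, x)) has_derivative (\<lambda>v. (0, v))) (at x within S)"
        by (auto intro!: derivative_eq_intros)
      show "(f has_derivative f' x) (at x within I \<times> S)" if "x \<in> I \<times> S" for x
        using f'(1) that by blast
    qed (use that in auto)
    then have "((\<lambda>x. f (t, x)) has_derivative (\<lambda>v. f' (t, x) (0, v))) (at x)"
      by (simp only: at_within_open[OF that(2) assms(2)])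
    then show ?thesis using frechet_derivative_at by metis
  qed
  then show ?thesis
    using f'(2)[rule_format, of "(0, v)"]
    by (elim continuous_on_eq) auto
qed

section \<open>Charts and coordinate changes\<close>

text \<open>The Jacobian of the transition from c to c' at p. Both \<open>tangent_coord\<close> and
  \<open>tangent_of_coord\<close> are the case where one of the charts is the preferred one; with
  two arbitrary charts the cocycle rule becomes expressible.\<close>

definition coord_change ::
  "('m, 'e::euclidean_space) chart \<Rightarrow> ('m, 'e) chart \<Rightarrow> 'm \<Rightarrow> 'e \<Rightarrow> 'e" where
  "coord_change c c' p = frechet_derivative (snd c' \<circ> chart_inv c) (at (snd c p))"

lemma tangent_coord_eq: "tangent_coord A c p = coord_change (chart_at A p) c p"
  by (simp add: tangent_coord_def coord_change_def)

lemma tangent_of_coord_eq: "tangent_of_coord A c p = coord_change c (chart_at A p) p"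
  by (simp add: tangent_of_coord_def coord_change_def)

locale smooth_manifold =
  fixes A :: "('m::t2_space, 'e::euclidean_space) chart set"
  assumes atlas: "smooth_atlas A"
begin

abbreviation "to_coord \<equiv> tangent_coord A"
abbreviation "of_coord \<equiv> tangent_of_coord A"

definition field_coord :: "('m, 'e) chart \<Rightarrow> ('m \<Rightarrow> 'e) \<Rightarrow> 'e \<Rightarrow> 'e" where
  "field_coord c V x = to_coord c (chart_inv c x) (V (chart_inv c x))"

lemma chart_open: "c \<in> A \<Longrightarrow> open (fst c)"
  and chart_image_open: "c \<in> A \<Longrightarrow> open (snd c ` fst c)"
  and chart_homeomorphism:
    "c \<in> A \<Longrightarrow> homeomorphism (fst c) (snd c ` fst c) (snd c) (chart_inv c)"
  using atlas by (auto simp: smooth_atlas_def is_chart_def)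

lemma chart_inv_chart: "c \<in> A \<Longrightarrow> p \<in> fst c \<Longrightarrow> chart_inv c (snd c p) = p"
  using chart_homeomorphism homeomorphism_apply1 by metis

lemma chart_inv_mem: "c \<in> A \<Longrightarrow> x \<in> snd c ` fst c \<Longrightarrow> chart_inv c x \<in> fst c"
  using chart_inv_chart by fastforce

lemma chart_chart_inv: "c \<in> A \<Longrightarrow> x \<in> snd c ` fst c \<Longrightarrow> snd c (chart_inv c x) = x"
  using chart_inv_chart by fastforce

lemma continuous_on_chart: "c \<in> A \<Longrightarrow> continuous_on (fst c) (snd c)"
  using chart_homeomorphism homeomorphism_cont1 by metis

lemma continuous_on_chart_inv: "c \<in> A \<Longrightarrow> continuous_on (snd c ` fst c) (chart_inv c)"
  using chart_homeomorphism homeomorphism_cont2 by metis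

lemma tendsto_chart: "c \<in> A \<Longrightarrow> p \<in> fst c \<Longrightarrow> (f \<longlongrightarrow> p) F \<Longrightarrow> ((\<lambda>x. snd c (f x)) \<longlongrightarrow> snd c p) F"
  using continuous_on_chart chart_open continuous_on_eq_continuous_at isCont_tendsto_compose
  by metis

lemma chart_at_mem: "chart_at A p \<in> A" and mem_chart_at: "p \<in> fst (chart_at A p)"
proof -
  have "p \<in> (\<Union>c\<in>A. fst c)"
    using atlas by (simp add: smooth_atlas_def)
  then have "\<exists>c. c \<in> A \<and> p \<in> fst c" by blast
  then have "chart_at A p \<in> A \<and> p \<in> fst (chart_at A p)"
    unfolding chart_at_def by (rule someI_ex)
  then show "chart_at A p \<in> A" and "p \<in> fst (chart_at A p)" by auto
qed

lemma open_chart_image: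
  assumes "c \<in> A" and "open U"
  shows "open (snd c ` (fst c \<inter> U))"
proof -
  have "openin (top_of_set (snd c ` fst c)) (snd c ` (fst c \<inter> U))"
    using homeomorphism_imp_open_map[OF chart_homeomorphism[OF assms(1)]] assms(2) by blast
  then show ?thesis using chart_image_open[OF assms(1)] openin_open_trans by blast
qed

lemma smooth_transition:
  assumes "c \<in> A" and "c' \<in> A"
  shows "smooth_on (snd c' \<circ> chart_inv c) (snd c ` (fst c \<inter> fst c'))"
  using assms atlas by (auto simp: smooth_atlas_def)

lemma transition_has_derivative:
  assumes "c \<in> A" and "c' \<in> A" and "p \<in> fst c" and "p \<in> fst c'"
  shows "(snd c' \<circ> chart_inv c has_derivative coord_change c c' p) (at (snd c p))"
  unfolding coord_change_def
  using assms by (intro smooth_on_has_derivative[OF smooth_transition open_chart_image] chart_open) auto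

lemma linear_coord_change:
  assumes "c \<in> A" and "c' \<in> A" and "p \<in> fst c" and "p \<in> fst c'"
  shows "linear (coord_change c c' p)"
  using transition_has_derivative[OF assms] by (rule has_derivative_linear)

text \<open>Charts and their inverses have arbitrary values outside their domains, so identities
  between coordinate expressions hold only on the image of an open set of the manifold. That image
  is open, and a derivative depends only on a neighbourhood.\<close>

lemma has_derivative_at_chart_cong:
  assumes "c \<in> A" and "open U" and "p \<in> fst c" and "p \<in> U"
    and "(f has_derivative f') (at (snd c p))"
    and "\<And>q. q \<in> fst c \<Longrightarrow> q \<in> U \<Longrightarrow> f (snd c q) = h (snd c q)"
  shows "(h has_derivative f') (at (snd c p))"
  using assms(5) open_chart_image[OF assms(1,2)]
  by (rule has_derivative_transform_within_open) (use assms in auto)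

text \<open>Chain rule for transition maps. Together with \<open>coord_change_self\<close> it makes
  \<open>to_coord\<close> and \<open>of_coord\<close> mutually inverse.\<close>

lemma coord_change_compose:
  assumes "c \<in> A" and "c' \<in> A" and "c'' \<in> A"
    and "p \<in> fst c" and "p \<in> fst c'" and "p \<in> fst c''"
  shows "coord_change c' c'' p (coord_change c c' p v) = coord_change c c'' p v"
proof -
  have "(snd c'' \<circ> chart_inv c' has_derivative coord_change c' c'' p)
      (at ((snd c' \<circ> chart_inv c) (snd c p)))"
    using transition_has_derivative[of c' c'' p] assms by (simp add: chart_inv_chart)
  with transition_has_derivative[of c c' p]
  have "(snd c'' \<circ> chart_inv c' \<circ> (snd c' \<circ> chart_inv c) has_derivative
      coord_change c' c'' p \<circ> coord_change c c' p) (at (snd c p))"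
    using assms by (intro diff_chain_at) auto
  then have "(snd c'' \<circ> chart_inv c has_derivative
      coord_change c' c'' p \<circ> coord_change c c' p) (at (snd c p))"
    by (rule has_derivative_at_chart_cong[OF assms(1) chart_open[OF assms(2)] assms(4,5)])
      (auto simp: chart_inv_chart assms)
  from has_derivative_unique[OF this transition_has_derivative[of c c'' p]]
  show ?thesis using assms by (auto simp: fun_eq_iff)
qed

lemma coord_change_self:
  assumes "c \<in> A" and "p \<in> fst c"
  shows "coord_change c c p v = v"
proof -
  have "((\<lambda>x. x) has_derivative (\<lambda>v. v)) (at (snd c p))" by simp
  then have "(snd c \<circ> chart_inv c has_derivative (\<lambda>v. v)) (at (snd c p))"
    by (rule has_derivative_at_chart_cong[OF assms(1) open_UNIV assms(2) UNIV_I])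
      (auto simp: chart_inv_chart assms)
  from has_derivative_unique[OF this transition_has_derivative]
  show ?thesis using assms by (auto simp: fun_eq_iff)
qed

lemma linear_tangent_coord: "c \<in> A \<Longrightarrow> p \<in> fst c \<Longrightarrow> linear (to_coord c p)"
  unfolding tangent_coord_eq using linear_coord_change chart_at_mem mem_chart_at by blast

lemma linear_tangent_of_coord: "c \<in> A \<Longrightarrow> p \<in> fst c \<Longrightarrow> linear (of_coord c p)"
  unfolding tangent_of_coord_eq using linear_coord_change chart_at_mem mem_chart_at by blast

lemma tangent_coord_of_coord:
  "c \<in> A \<Longrightarrow> p \<in> fst c \<Longrightarrow> to_coord c p (of_coord c p v) = v"
  and tangent_of_coord_coord:
  "c \<in> A \<Longrightarrow> p \<in> fst c \<Longrightarrow> of_coord c p (to_coord c p v) = v"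
  unfolding tangent_coord_eq tangent_of_coord_eq
  by (simp_all add: coord_change_compose chart_at_mem mem_chart_at coord_change_self)

lemma tangent_coord_chart_at: "to_coord (chart_at A p) p v = v"
  and tangent_of_coord_chart_at: "of_coord (chart_at A p) p v = v"
  unfolding tangent_coord_eq tangent_of_coord_eq
  by (simp_all add: coord_change_self chart_at_mem mem_chart_at)

section \<open>Velocities, vector fields and directional derivatives in coordinates\<close>

lemma velocity_in_chart:
  assumes "c \<in> A" and "has_velocity A \<gamma> v t S" and "\<gamma> t \<in> fst c" and "t \<in> S"
  shows "((\<lambda>u. snd c (\<gamma> u)) has_vector_derivative to_coord c (\<gamma> t) v) (at t within S)"
proof -
  let ?c = "chart_at A (\<gamma> t)"
  have cont: "(\<gamma> \<longlongrightarrow> \<gamma> t) (at t within S)"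
    and der: "((\<lambda>u. snd ?c (\<gamma> u)) has_vector_derivative v) (at t within S)"
    using assms(2) by (auto simp: has_velocity_def continuous_within)
  \<comment> \<open>The continuity clause of \<open>has_velocity\<close> enters here: it keeps
    nearby points in the preferred chart, where the transition to c is the correct change of
    coordinates.\<close>
  have ev: "\<forall>\<^sub>F u in at t within S. \<gamma> u \<in> fst ?c"
    using cont chart_open[OF chart_at_mem] mem_chart_at by (rule topological_tendstoD)
  have "((snd c \<circ> chart_inv ?c) \<circ> (\<lambda>u. snd ?c (\<gamma> u)) has_derivative
      to_coord c (\<gamma> t) \<circ> (\<lambda>h. h *\<^sub>R v)) (at t within S)"
    unfolding tangent_coord_eq using der
    by (intro diff_chain_within has_derivative_at_withinI[OF transition_has_derivative])
      (auto simp: has_vector_derivative_def assms chart_at_mem mem_chart_at)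
  then have "((\<lambda>u. snd c (\<gamma> u)) has_derivative
      to_coord c (\<gamma> t) \<circ> (\<lambda>h. h *\<^sub>R v)) (at t within S)"
    by (rule has_derivative_transform_eventually)
      (use ev in \<open>auto simp: chart_inv_chart chart_at_mem mem_chart_at assms elim: eventually_mono\<close>)
  then show ?thesis
    using linear_scale[OF linear_tangent_coord[OF assms(1,3)]]
    by (simp add: has_vector_derivative_def o_def)
qed

text \<open>Fields with constant coordinates w in c are the test fields for metric compatibility and
  torsion. In a second chart c' their coordinates are the Jacobian of the transition from c to c'
  applied to w, evaluated at the transition from c' to c, hence smooth on the overlap.\<close>

lemma smooth_coordinate_field:
  assumes "c \<in> A"
  shows "smooth_vector_field_on A (fst c) (\<lambda>q. of_coord c q w)"
  unfolding smooth_vector_field_on_def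
proof
  fix c' assume c': "c' \<in> A"
  have "smooth_on (\<lambda>x. frechet_derivative (snd c' \<circ> chart_inv c) (at ((snd c \<circ> chart_inv c') x)) w)
      (snd c' ` (fst c' \<inter> fst c))"
    using assms c'
    by (intro smooth_on_compose[OF smooth_on_frechet_derivative[OF smooth_transition[of c c'] open_chart_image]]
        smooth_transition chart_open)
      (auto simp: chart_inv_chart)
  then show "smooth_on (\<lambda>x. to_coord c' (chart_inv c' x) (of_coord c (chart_inv c' x) w))
      (snd c' ` (fst c' \<inter> fst c))"
  proof (rule smooth_on_cong)
    fix x assume "x \<in> snd c' ` (fst c' \<inter> fst c)"
    then obtain q where q: "q \<in> fst c'" "q \<in> fst c" "x = snd c' q" by auto
    have "to_coord c' q (of_coord c q w) = coord_change c c' q w"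
      unfolding tangent_coord_eq tangent_of_coord_eq
      using q assms c' by (simp add: coord_change_compose chart_at_mem mem_chart_at)
    then show "frechet_derivative (snd c' \<circ> chart_inv c) (at ((snd c \<circ> chart_inv c') x)) w =
        to_coord c' (chart_inv c' x) (of_coord c (chart_inv c' x) w)"
      using q c' by (simp add: chart_inv_chart coord_change_def)
  qed
qed

lemma smooth_coordinate_fun:
  assumes "c \<in> A"
  shows "smooth_fun_on A (fst c) (\<lambda>q. snd c q \<bullet> b)"
  unfolding smooth_fun_on_def
proof
  fix c' assume "c' \<in> A"
  from smooth_on_bounded_linear[OF bounded_linear_inner_left smooth_transition[OF this assms], of b]
  show "smooth_on ((\<lambda>q. snd c q \<bullet> b) \<circ> chart_inv c') (snd c' ` (fst c' \<inter> fst c))"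
    by (simp add: o_def)
qed

text \<open>\<open>vector_apply\<close> differentiates in the preferred chart; the chain rule
  through the transition from that chart to c shows that any chart computes the same
  derivative.\<close>

lemma vector_apply_eq:
  assumes "c \<in> A" and "p \<in> fst c" and "(f \<circ> chart_inv c has_derivative f') (at (snd c p))"
  shows "vector_apply A p v f = f' (to_coord c p v)"
proof -
  let ?c = "chart_at A p"
  have "((f \<circ> chart_inv c) \<circ> (snd c \<circ> chart_inv ?c) has_derivative f' \<circ> to_coord c p)
      (at (snd ?c p))"
    unfolding tangent_coord_eq using assms
    by (intro diff_chain_at transition_has_derivative)
      (auto simp: chart_at_mem mem_chart_at chart_inv_chart)
  then have "(f \<circ> chart_inv ?c has_derivative f' \<circ> to_coord c p) (at (snd ?c p))"
    by (rule has_derivative_at_chart_cong[OF chart_at_mem chart_open[OF assms(1)] mem_chart_at assms(2)])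
      (auto simp: chart_inv_chart chart_at_mem assms)
  then show ?thesis unfolding vector_apply_def by (metis frechet_derivative_at o_apply)
qed

lemma smooth_field_coord:
  assumes "c \<in> A" and "smooth_vector_field_on A (fst c) V"
  shows "smooth_on (field_coord c V) (snd c ` fst c)"
  using assms unfolding smooth_vector_field_on_def field_coord_def by auto

lemma smooth_zero_field: "smooth_vector_field_on A U (\<lambda>q. 0)"
  unfolding smooth_vector_field_on_def
proof
  fix c assume "c \<in> A"
  then show "smooth_on (\<lambda>x. to_coord c (chart_inv c x) 0) (snd c ` (fst c \<inter> U))"
    by (intro smooth_on_cong[OF smooth_on_const[of 0]])
      (auto simp: chart_inv_chart linear_0[OF linear_tangent_coord])
qed

lemma smooth_time_slice:
  assumes "smooth_time_dependent_field A T X" and "t \<in> {0..T}"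
  shows "smooth_vector_field_on A U (X t)"
  unfolding smooth_vector_field_on_def
proof
  fix c assume "c \<in> A"
  then have "smooth_on (\<lambda>(t, x). to_coord c (chart_inv c x) (X t (chart_inv c x)))
      ({0..T} \<times> snd c ` fst c)"
    using assms(1) by (auto simp: smooth_time_dependent_field_def)
  from smooth_on_slice[OF this assms(2)]
  show "smooth_on (\<lambda>x. to_coord c (chart_inv c x) (X t (chart_inv c x))) (snd c ` (fst c \<inter> U))"
    by (auto intro: smooth_on_subset)
qed

lemma continuous_on_field_coord:
  assumes "smooth_time_dependent_field A T X" and "c \<in> A"
  shows "continuous_on ({0..T} \<times> snd c ` fst c) (\<lambda>(t, x). field_coord c (X t) x)"
  using assms smooth_on_imp_continuous_on
  unfolding smooth_time_dependent_field_def field_coord_def by blast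

lemma field_coord_has_derivative:
  assumes "smooth_time_dependent_field A T X" and "c \<in> A" and "t \<in> {0..T}" and "x \<in> snd c ` fst c"
  shows "(field_coord c (X t) has_derivative frechet_derivative (field_coord c (X t)) (at x)) (at x)"
  using smooth_on_has_derivative[OF smooth_field_coord[OF assms(2) smooth_time_slice[OF assms(1,3)]]
      chart_image_open[OF assms(2)] assms(4)] .

lemma continuous_on_field_coord_derivative:
  assumes "smooth_time_dependent_field A T X" and "c \<in> A"
  shows "continuous_on ({0..T} \<times> snd c ` fst c)
    (\<lambda>(t, x). frechet_derivative (field_coord c (X t)) (at x) v)"
proof -
  have "smooth_on (\<lambda>(t, x). field_coord c (X t) x) ({0..T} \<times> snd c ` fst c)"
    using assms unfolding smooth_time_dependent_field_def field_coord_def by auto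
  from smooth_on_slice_derivative[OF this chart_image_open[OF assms(2)], of v]
  show ?thesis by simp
qed

end

section \<open>Inner products and Gronwall estimates\<close>

text \<open>Kept apart from the manifold because it is applied both to \<open>g p\<close> on a
  tangent space and to the coordinate expression of the metric at a point of a chart image.\<close>

definition inner_form :: "('e::euclidean_space \<Rightarrow> 'e \<Rightarrow> real) \<Rightarrow> bool" where
  "inner_form B \<longleftrightarrow> bilinear B \<and> (\<forall>u v. B u v = B v u) \<and> (\<forall>v. v \<noteq> 0 \<longrightarrow> B v v > 0)"

lemma bilinear_basis_expansion:
  fixes B :: "'e::euclidean_space \<Rightarrow> 'e \<Rightarrow> real"
  assumes "bilinear B"
  shows "B u v = (\<Sum>i\<in>Basis. \<Sum>j\<in>Basis. (u \<bullet> i) * (v \<bullet> j) * B i j)"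
proof -
  have "B u v = (\<Sum>i\<in>Basis. (u \<bullet> i) * B i v)"
    using linear_basis_expansion[of "\<lambda>u. B u v" u] assms by (simp add: bilinear_def)
  also have "\<dots> = (\<Sum>i\<in>Basis. (u \<bullet> i) * (\<Sum>j\<in>Basis. (v \<bullet> j) * B i j))"
    using linear_basis_expansion[of "B _" v] assms by (simp add: bilinear_def)
  finally show ?thesis by (simp add: sum_distrib_left mult.assoc)
qed

lemma inner_form_nonneg: "inner_form B \<Longrightarrow> 0 \<le> B v v"
  by (cases "v = 0") (auto simp: inner_form_def bilinear_lzero intro: less_imp_le)

lemma inner_form_cauchy_schwarz:
  assumes "inner_form B"
  shows "B u v \<le> sqrt (B u u) * sqrt (B v v)"
proof (cases "v = 0")
  case True
  then show ?thesis using assms by (auto simp: inner_form_def bilinear_lzero bilinear_rzero)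
next
  case False
  have bil: "bilinear B" and sym: "B v u = B u v" and pos: "B v v > 0"
    using assms False by (auto simp: inner_form_def)
  let ?k = "B u v / B v v"
  have "0 \<le> B (u - ?k *\<^sub>R v) (u - ?k *\<^sub>R v)" using assms by (rule inner_form_nonneg)
  also have "\<dots> = B u u - (B u v)\<^sup>2 / B v v"
    using pos by (simp add: bilinear_lsub[OF bil] bilinear_rsub[OF bil] bilinear_lmul[OF bil]
        bilinear_rmul[OF bil] sym power2_eq_square)
  finally have "(B u v)\<^sup>2 \<le> B u u * B v v" using pos by (simp add: field_simps)
  then have "B u v \<le> sqrt (B u u * B v v)" by (rule real_le_rsqrt)
  then show ?thesis by (simp add: real_sqrt_mult)
qed

lemma inner_form_triangle:
  assumes "inner_form B"
  shows "sqrt (B (u + v) (u + v)) \<le> sqrt (B u u) + sqrt (B v v)"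
proof (rule real_le_lsqrt)
  have bil: "bilinear B" and sym: "B v u = B u v" using assms by (auto simp: inner_form_def)
  have "B (u + v) (u + v) = B u u + 2 * B u v + B v v"
    by (simp add: bilinear_ladd[OF bil] bilinear_radd[OF bil] sym)
  also have "\<dots> \<le> B u u + 2 * (sqrt (B u u) * sqrt (B v v)) + B v v"
    using inner_form_cauchy_schwarz[OF assms] by simp
  also have "\<dots> = (sqrt (B u u) + sqrt (B v v))\<^sup>2"
    using inner_form_nonneg[OF assms] by (simp add: power2_eq_square algebra_simps)
  finally show "B (u + v) (u + v) \<le> (sqrt (B u u) + sqrt (B v v))\<^sup>2" .
qed (use inner_form_nonneg[OF assms] in auto)

lemma inner_form_scaleR:
  assumes "inner_form B"
  shows "sqrt (B (r *\<^sub>R v) (r *\<^sub>R v)) = \<bar>r\<bar> * sqrt (B v v)"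
proof -
  have bil: "bilinear B" using assms by (auto simp: inner_form_def)
  have "B (r *\<^sub>R v) (r *\<^sub>R v) = r\<^sup>2 * B v v"
    by (simp add: bilinear_lmul[OF bil] bilinear_rmul[OF bil] power2_eq_square)
  then show ?thesis by (simp add: real_sqrt_mult)
qed

text \<open>Minimum and maximum of sqrt (G p v v) over the product of C with the unit sphere,
  extended to all v by homogeneity; the minimum is positive by definiteness. With C a singleton such
  as \<open>{0::real}\<close> this is the equivalence of norms at one point.\<close>

lemma inner_form_norm_comparison:
  fixes G :: "'p::topological_space \<Rightarrow> 'e::euclidean_space \<Rightarrow> 'e \<Rightarrow> real"
  assumes "compact C" and form: "\<And>p. p \<in> C \<Longrightarrow> inner_form (G p)"
    and cont: "\<And>i j. continuous_on C (\<lambda>p. G p i j)"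
  obtains k K where "0 < k" and "0 < K"
    and "\<And>p v. p \<in> C \<Longrightarrow> k * norm v \<le> sqrt (G p v v)"
    and "\<And>p v. p \<in> C \<Longrightarrow> sqrt (G p v v) \<le> K * norm v"
proof (cases "C = {}")
  case True
  then show ?thesis using that[of 1 1] by auto
next
  case False
  let ?N = "\<lambda>(p, v). sqrt (G p v v)" and ?D = "C \<times> sphere (0::'e) 1"
  have "continuous_on ?D (\<lambda>(p, v). sqrt (\<Sum>i\<in>Basis. \<Sum>j\<in>Basis. (v \<bullet> i) * (v \<bullet> j) * G p i j))"
    unfolding case_prod_beta
    by (intro continuous_intros continuous_on_compose2[OF cont]) auto
  then have "continuous_on ?D ?N"
    by (rule continuous_on_eq)
      (use form in \<open>auto simp: inner_form_def intro!: bilinear_basis_expansion[symmetric]\<close>)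
  moreover have "compact ?D" and "?D \<noteq> {}"
    using assms(1) False by (auto intro!: compact_Times)
  ultimately have "\<exists>q\<in>?D. \<forall>q'\<in>?D. ?N q \<le> ?N q'" and "\<exists>q\<in>?D. \<forall>q'\<in>?D. ?N q' \<le> ?N q"
    by (blast intro!: continuous_attains_inf continuous_attains_sup)+
  then obtain q1 q2 where q: "q1 \<in> ?D" "q2 \<in> ?D"
    and le: "\<And>q. q \<in> ?D \<Longrightarrow> ?N q1 \<le> ?N q" "\<And>q. q \<in> ?D \<Longrightarrow> ?N q \<le> ?N q2"
    by blast
  have pos: "0 < ?N q" if "q \<in> ?D" for q
  proof -
    have "snd q \<noteq> 0" using that by auto
    then show ?thesis using that form[of "fst q"] by (auto simp: inner_form_def case_prod_beta)
  qed
  have bounds: "?N q1 * norm v \<le> sqrt (G p v v)" "sqrt (G p v v) \<le> ?N q2 * norm v" if "p \<in> C" for p v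
  proof -
    have "?N q1 * norm v \<le> sqrt (G p v v) \<and> sqrt (G p v v) \<le> ?N q2 * norm v"
    proof (cases "v = 0")
      case True
      then show ?thesis using form[OF that] by (auto simp: inner_form_def bilinear_lzero)
    next
      case False
      let ?u = "(1 / norm v) *\<^sub>R v"
      have N: "?N (p, ?u) = sqrt (G p v v) / norm v"
        by (simp only: prod.case inner_form_scaleR[OF form[OF that]]) simp
      have u: "(p, ?u) \<in> ?D" using that False by simp
      have "?N q1 \<le> sqrt (G p v v) / norm v" "sqrt (G p v v) / norm v \<le> ?N q2"
        using le(1)[OF u] le(2)[OF u] unfolding N by auto
      then show ?thesis using False by (simp add: pos_le_divide_eq pos_divide_le_eq)
    qed
    then show "?N q1 * norm v \<le> sqrt (G p v v)" "sqrt (G p v v) \<le> ?N q2 * norm v" by auto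
  qed
  show ?thesis using that[OF pos[OF q(1)] pos[OF q(2)]] bounds by blast
qed

section \<open>Growth of the difference of two solutions in Euclidean space\<close>

lemma gronwall_integral:
  fixes f f' \<rho> :: "real \<Rightarrow> real"
  assumes "a \<le> c" and cont: "continuous_on {a..c} \<rho>"
    and der: "\<And>t. t \<in> {a..c} \<Longrightarrow> (f has_real_derivative f' t) (at t within {a..c})"
    and le: "\<And>t. t \<in> {a..c} \<Longrightarrow> f' t \<le> \<rho> t * f t"
  shows "f c \<le> exp (integral {a..c} \<rho>) * f a"
proof -
  let ?I = "\<lambda>t. integral {a..t} \<rho>"
  have I: "(?I has_real_derivative \<rho> t) (at t within {a..c})" if "t \<in> {a..c}" for t
    using integral_has_real_derivative[OF cont that] .
  have d: "((\<lambda>t. f t * exp (- ?I t)) has_real_derivative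
      f' t * exp (- ?I t) + f t * (exp (- ?I t) * - \<rho> t)) (at t within {a..c})"
    if "t \<in> {a..c}" for t
    using that by (auto intro!: derivative_eq_intros der I)
  \<comment> \<open>Integrating factor: the derivative of f t * exp (- ?I t) is (f' t - \<rho> t * f
    t) * exp (- ?I t), which is at most 0 whatever the signs of f and \<rho>.\<close>
  have "f c * exp (- ?I c) \<le> f a * exp (- ?I a)"
  proof (rule DERIV_nonpos_imp_decreasing_open[OF \<open>a \<le> c\<close>])
    show "continuous_on {a..c} (\<lambda>t. f t * exp (- ?I t))"
      unfolding continuous_on_eq_continuous_within using d DERIV_continuous by blast
    fix t assume t: "a < t" "t < c"
    then have "t \<in> {a..c}" by auto
    then have "((\<lambda>t. f t * exp (- ?I t)) has_real_derivative
        (f' t - \<rho> t * f t) * exp (- ?I t)) (at t within {a..c})"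
      by (intro DERIV_cong[OF d]) (simp_all add: algebra_simps)
    then have "((\<lambda>t. f t * exp (- ?I t)) has_real_derivative
        (f' t - \<rho> t * f t) * exp (- ?I t)) (at t)"
      using t by (simp add: at_within_Icc_at)
    moreover have "(f' t - \<rho> t * f t) * exp (- ?I t) \<le> 0"
      using le[of t] t by (simp add: mult_le_0_iff)
    ultimately show "\<exists>y. ((\<lambda>t. f t * exp (- ?I t)) has_real_derivative y) (at t) \<and> y \<le> 0"
      by blast
  qed
  then show ?thesis by (simp add: exp_minus field_simps)
qed

text \<open>A first-order Taylor estimate whose radius r is the same at every point of the compact
  curve x. It rests on uniform continuity of the derivatives on a compact tube around the curve and
  on the mean value inequality in the convex balls \<open>cball (x t) r\<close>.\<close>

lemma uniform_linearization:
  fixes \<xi> :: "real \<Rightarrow> 'e::euclidean_space \<Rightarrow> 'e" and \<xi>' :: "real \<Rightarrow> 'e \<Rightarrow> 'e \<Rightarrow> 'e"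
  assumes "compact I" and "open S" and x: "continuous_on I x" and "x ` I \<subseteq> S"
    and der: "\<And>t z. t \<in> I \<Longrightarrow> z \<in> S \<Longrightarrow> (\<xi> t has_derivative \<xi>' t z) (at z)"
    and cont: "\<And>v. continuous_on (I \<times> S) (\<lambda>(t, z). \<xi>' t z v)"
    and "\<eta> > 0"
  obtains r where "r > 0" and "\<And>t. t \<in> I \<Longrightarrow> cball (x t) r \<subseteq> S"
    and "\<And>t w. t \<in> I \<Longrightarrow> norm w \<le> r \<Longrightarrow>
      norm (\<xi> t (x t + w) - \<xi> t (x t) - \<xi>' t (x t) w) \<le> \<eta> * norm w"
proof -
  have "compact (x ` I)" using assms(1) x by (rule compact_continuous_image[rotated])
  then obtain r0 where r0: "r0 > 0" "(\<Union>z\<in>x ` I. cball z r0) \<subseteq> S"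
    using compact_subset_open_imp_cball_epsilon_subset assms(2,4) by metis
  then have sub: "x t + u \<in> S" if "t \<in> I" "norm u \<le> r0" for t u
  proof -
    have "x t + u \<in> cball (x t) r0" using that(2) by (simp add: dist_norm)
    then show ?thesis using r0(2) that(1) by blast
  qed
  \<comment> \<open>E dominates the operator norm of
    \<open>\<xi>' t (x t + u) - \<xi>' t (x t)\<close> through its values on the basis, because
    continuity is known for \<open>\<xi>' t z v\<close> with v fixed. It vanishes at u = 0.\<close>
  define E where "E = (\<lambda>(t, u). \<Sum>i\<in>Basis. norm (\<xi>' t (x t + u) i - \<xi>' t (x t) i))"
  have "continuous_on (I \<times> cball 0 r0) E"
    unfolding E_def case_prod_beta
  proof (intro continuous_intros)
    fix i
    have x': "continuous_on (I \<times> cball (0::'e) r0) (\<lambda>p. x (fst p))"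
      by (rule continuous_on_compose2[OF x continuous_on_fst[OF continuous_on_id]]) auto
    have c: "continuous_on (I \<times> S) (\<lambda>p. \<xi>' (fst p) (snd p) i)"
      using cont[of i] by (simp add: case_prod_beta)
    have "continuous_on (I \<times> cball 0 r0) (\<lambda>p. \<xi>' (fst (fst p, x (fst p) + snd p)) (snd (fst p, x (fst p) + snd p)) i)"
      by (rule continuous_on_compose2[OF c]) (auto intro!: continuous_intros x' sub)
    then show "continuous_on (I \<times> cball 0 r0) (\<lambda>p. \<xi>' (fst p) (x (fst p) + snd p) i)" by simp
    have "continuous_on (I \<times> cball (0::'e) r0) (\<lambda>p. \<xi>' (fst (fst p, x (fst p))) (snd (fst p, x (fst p))) i)"
      by (rule continuous_on_compose2[OF c]) (use assms(4) in \<open>auto intro!: continuous_intros x'\<close>)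
    then show "continuous_on (I \<times> cball (0::'e) r0) (\<lambda>p. \<xi>' (fst p) (x (fst p)) i)" by simp
  qed
  moreover have "compact (I \<times> cball (0::'e) r0)" using assms(1) by (auto intro: compact_Times)
  ultimately have "uniformly_continuous_on (I \<times> cball 0 r0) E"
    by (rule compact_uniformly_continuous)
  then obtain d where d: "d > 0"
    "\<And>p q. p \<in> I \<times> cball 0 r0 \<Longrightarrow> q \<in> I \<times> cball 0 r0 \<Longrightarrow> dist q p < d \<Longrightarrow> dist (E q) (E p) < \<eta>"
    unfolding uniformly_continuous_on_def using \<open>\<eta> > 0\<close> by metis
  define r where "r = min (d / 2) r0"
  have r: "r > 0" "r < d" "r \<le> r0" using d(1) r0(1) by (auto simp: r_def)
  have in_S: "z \<in> S" if "t \<in> I" "z \<in> cball (x t) r" for t z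
    using sub[OF that(1), of "z - x t"] that(2) r by (auto simp: dist_norm norm_minus_commute)
  have E: "E (t, u) \<le> \<eta>" if "t \<in> I" "norm u \<le> r" for t u
  proof -
    have "dist (E (t, u)) (E (t, 0)) < \<eta>"
      using that r by (intro d(2)) (auto simp: dist_Pair_Pair)
    then show ?thesis by (simp add: E_def dist_norm)
  qed
  show ?thesis
  proof (rule that[OF r(1)])
    show "cball (x t) r \<subseteq> S" if "t \<in> I" for t
    proof
      fix z assume "z \<in> cball (x t) r"
      with that show "z \<in> S" by (rule in_S)
    qed
  next
    fix t and w :: 'e assume t: "t \<in> I" and w: "norm w \<le> r"
    have lin: "linear (\<xi>' t z)" if "z \<in> cball (x t) r" for z
      by (rule has_derivative_linear[OF der[OF t in_S[OF t that]]])
    have "norm (\<xi> t (x t + w) - \<xi> t (x t) - \<xi>' t (x t) ((x t + w) - x t)) \<le> norm ((x t + w) - x t) * \<eta>"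
    proof (rule differentiable_bound_linearization[where S = "cball (x t) r" and f' = "\<xi>' t" and ?x0.0 = "x t"])
      show "x t + s *\<^sub>R (x t + w - x t) \<in> cball (x t) r" if "s \<in> {0..1}" for s
        using that w r(1) mult_mono[of s 1 "norm w" r] by (auto simp: dist_norm)
      show "(\<xi> t has_derivative \<xi>' t z) (at z within cball (x t) r)" if "z \<in> cball (x t) r" for z
        by (rule has_derivative_at_withinI[OF der[OF t in_S[OF t that]]])
      show "onorm (\<xi>' t z - \<xi>' t (x t)) \<le> \<eta>" if z: "z \<in> cball (x t) r" for z
      proof (rule onorm_le)
        fix v
        have l: "linear (\<lambda>v. \<xi>' t z v - \<xi>' t (x t) v)"
          using lin[OF z] lin[of "x t"] r(1) by (intro linear_compose_sub) auto
        have "norm (\<xi>' t z v - \<xi>' t (x t) v) = norm (\<Sum>i\<in>Basis. (v \<bullet> i) *\<^sub>R (\<xi>' t z i - \<xi>' t (x t) i))"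
          using linear_basis_expansion[OF l, of v] by simp
        also have "\<dots> \<le> (\<Sum>i\<in>Basis. norm v * norm (\<xi>' t z i - \<xi>' t (x t) i))"
          by (intro sum_norm_le) (simp add: Basis_le_norm mult_right_mono)
        also have "\<dots> = norm v * E (t, z - x t)"
          by (simp add: E_def sum_distrib_left)
        also have "\<dots> \<le> norm v * \<eta>"
          using z t by (intro mult_left_mono E) (auto simp: dist_norm norm_minus_commute)
        finally show "norm ((\<xi>' t z - \<xi>' t (x t)) v) \<le> \<eta> * norm v" by (simp add: mult.commute)
      qed
      show "x t \<in> cball (x t) r" using r(1) by simp
    qed
    then show "norm (\<xi> t (x t + w) - \<xi> t (x t) - \<xi>' t (x t) w) \<le> \<eta> * norm w"
      by (simp add: mult.commute)
  qed
qed

text \<open>Product rule for the three factors that arise when G (x s) (w s) (w s) is expanded in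
  the basis; symmetry merges the two terms with w' into one with factor 2.\<close>

lemma quadratic_form_has_derivative:
  fixes G :: "'e::euclidean_space \<Rightarrow> 'e \<Rightarrow> 'e \<Rightarrow> real"
  assumes "open S" and bil: "\<And>z. z \<in> S \<Longrightarrow> bilinear (G z)"
    and sym: "\<And>z u v. z \<in> S \<Longrightarrow> G z u v = G z v u"
    and der: "\<And>u v. ((\<lambda>z. G z u v) has_derivative (\<lambda>d. DG d u v)) (at (x t))"
    and x: "\<And>s. s \<in> I \<Longrightarrow> x s \<in> S" and "t \<in> I"
    and dx: "(x has_vector_derivative x') (at t within I)"
    and dw: "(w has_vector_derivative w') (at t within I)"
  shows "((\<lambda>s. G (x s) (w s) (w s)) has_real_derivative DG x' (w t) (w t) + 2 * G (x t) w' (w t))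
    (at t within I)"
proof -
  let ?w = "w t" and ?z = "x t"
  \<comment> \<open>\<open>DG\<close> is only known as a derivative for each fixed pair of vectors;
    its expansion on the diagonal follows from uniqueness of the derivative of G z w w in z.\<close>
  have DG: "DG x' ?w ?w = (\<Sum>i\<in>Basis. \<Sum>j\<in>Basis. (?w \<bullet> i) * (?w \<bullet> j) * DG x' i j)"
  proof -
    have "((\<lambda>z. \<Sum>i\<in>Basis. \<Sum>j\<in>Basis. (?w \<bullet> i) * (?w \<bullet> j) * G z i j) has_derivative
        (\<lambda>d. \<Sum>i\<in>Basis. \<Sum>j\<in>Basis. (?w \<bullet> i) * (?w \<bullet> j) * DG d i j)) (at ?z)"
      by (intro has_derivative_sum has_derivative_mult_right der)
    then have "((\<lambda>z. G z ?w ?w) has_derivative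
        (\<lambda>d. \<Sum>i\<in>Basis. \<Sum>j\<in>Basis. (?w \<bullet> i) * (?w \<bullet> j) * DG d i j)) (at ?z)"
      using \<open>open S\<close> x[OF \<open>t \<in> I\<close>]
      by (rule has_derivative_transform_within_open) (simp add: bilinear_basis_expansion[OF bil, symmetric])
    from fun_cong[OF has_derivative_unique[OF this der], of x'] show ?thesis by simp
  qed
  have dG: "((\<lambda>s. G (x s) i j) has_real_derivative DG x' i j) (at t within I)" for i j
  proof -
    have "((\<lambda>s. G (x s) i j) has_derivative (\<lambda>d. DG (d *\<^sub>R x') i j)) (at t within I)"
      using dx unfolding has_vector_derivative_def
      by (rule has_derivative_compose[where g = "\<lambda>z. G z i j" and g' = "\<lambda>d. DG d i j"]) (rule der)
    moreover have "(\<lambda>d. DG (d *\<^sub>R x') i j) = (\<lambda>d. d * DG x' i j)"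
      using linear_scale[OF has_derivative_linear[OF der]] by auto
    ultimately show ?thesis
      by (simp add: has_field_derivative_def mult.commute[of _ "DG x' i j"])
  qed
  have dwi: "((\<lambda>s. w s \<bullet> i) has_real_derivative w' \<bullet> i) (at t within I)" for i
    using bounded_linear.has_vector_derivative[OF bounded_linear_inner_left dw]
    by (simp add: has_real_derivative_iff_has_vector_derivative)
  have "((\<lambda>s. \<Sum>i\<in>Basis. \<Sum>j\<in>Basis. (w s \<bullet> i) * (w s \<bullet> j) * G (x s) i j) has_real_derivative
      (\<Sum>i\<in>Basis. \<Sum>j\<in>Basis. (?w \<bullet> i) * (?w \<bullet> j) * DG x' i j
         + (w' \<bullet> i) * (?w \<bullet> j) * G ?z i j + (?w \<bullet> i) * (w' \<bullet> j) * G ?z i j)) (at t within I)"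
    by (rule DERIV_sum)+ (auto intro!: derivative_eq_intros dG dwi simp: algebra_simps)
  moreover have "(\<Sum>i\<in>Basis. \<Sum>j\<in>Basis. (?w \<bullet> i) * (?w \<bullet> j) * DG x' i j
         + (w' \<bullet> i) * (?w \<bullet> j) * G ?z i j + (?w \<bullet> i) * (w' \<bullet> j) * G ?z i j)
      = DG x' ?w ?w + G ?z w' ?w + G ?z ?w w'"
    unfolding DG bilinear_basis_expansion[OF bil[OF x[OF \<open>t \<in> I\<close>]], of w' ?w]
      bilinear_basis_expansion[OF bil[OF x[OF \<open>t \<in> I\<close>]], of ?w w']
    by (simp add: sum.distrib)
  ultimately have "((\<lambda>s. \<Sum>i\<in>Basis. \<Sum>j\<in>Basis. (w s \<bullet> i) * (w s \<bullet> j) * G (x s) i j) has_real_derivative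
      DG x' ?w ?w + 2 * G ?z w' ?w) (at t within I)"
    using sym[OF x[OF \<open>t \<in> I\<close>], of w' ?w] by (simp add: add.commute)
  then show ?thesis
    by (rule has_field_derivative_transform_within[OF _ zero_less_one \<open>t \<in> I\<close>])
      (simp add: bilinear_basis_expansion[OF bil[OF x], symmetric])
qed

text \<open>For w = y - x the derivative of G (x t) w w is the left side of \<open>le\<close>, which
  is the Lie derivative of the metric in coordinates, plus 2 * G (x t) e w, where e is the error of
  linearizing \<xi> at x t. On a thin tube e has G-norm at most \<eta> times that of w, so Gronwall
  applies to the squared norm with rate 2 * (\<rho> + \<eta>); the square root halves the
  exponent.\<close>

lemma local_flow_comparison:
  fixes \<xi> :: "real \<Rightarrow> 'e::euclidean_space \<Rightarrow> 'e" and \<xi>' :: "real \<Rightarrow> 'e \<Rightarrow> 'e \<Rightarrow> 'e"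
    and G :: "'e \<Rightarrow> 'e \<Rightarrow> 'e \<Rightarrow> real" and \<rho> :: "real \<Rightarrow> real"
  assumes "open S" and xS: "\<And>t. t \<in> {a..b} \<Longrightarrow> x t \<in> S"
    and dx: "\<And>t. t \<in> {a..b} \<Longrightarrow> (x has_vector_derivative \<xi> t (x t)) (at t within {a..b})"
    and der: "\<And>t z. t \<in> {a..b} \<Longrightarrow> z \<in> S \<Longrightarrow> (\<xi> t has_derivative \<xi>' t z) (at z)"
    and cont: "\<And>v. continuous_on ({a..b} \<times> S) (\<lambda>(t, z). \<xi>' t z v)"
    and form: "\<And>z. z \<in> S \<Longrightarrow> inner_form (G z)"
    and dG: "\<And>z u v. z \<in> S \<Longrightarrow> ((\<lambda>z. G z u v) has_derivative (\<lambda>d. DG z d u v)) (at z)"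
    and \<rho>: "continuous_on {a..b} \<rho>"
    and le: "\<And>t w. t \<in> {a..b} \<Longrightarrow>
      DG (x t) (\<xi> t (x t)) w w + 2 * G (x t) (\<xi>' t (x t) w) w \<le> 2 * \<rho> t * G (x t) w w"
    and "\<epsilon> > 0"
  obtains r where "r > 0" and "\<And>t. t \<in> {a..b} \<Longrightarrow> cball (x t) r \<subseteq> S"
    and "\<And>y c. c \<in> {a..b} \<Longrightarrow>
      (\<And>t. t \<in> {a..c} \<Longrightarrow> (y has_vector_derivative \<xi> t (y t)) (at t within {a..c})) \<Longrightarrow>
      (\<And>t. t \<in> {a..c} \<Longrightarrow> norm (y t - x t) \<le> r) \<Longrightarrow>
      sqrt (G (x c) (y c - x c) (y c - x c)) \<le>
        exp (integral {a..c} \<rho> + \<epsilon>) * sqrt (G (x a) (y a - x a) (y a - x a))"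
proof -
  have xc: "continuous_on {a..b} x"
    using dx by (intro continuous_on_vector_derivative)
  have "continuous_on {a..b} (\<lambda>t. G (x t) i j)" for i j
  proof (rule continuous_on_compose2[OF _ xc])
    show "continuous_on S (\<lambda>z. G z i j)"
      by (intro continuous_at_imp_continuous_on ballI has_derivative_continuous[OF dG])
  qed (use xS in auto)
  note Gc = this
  obtain k K where k: "0 < k" "0 < K"
    "\<And>t v. t \<in> {a..b} \<Longrightarrow> k * norm v \<le> sqrt (G (x t) v v)"
    "\<And>t v. t \<in> {a..b} \<Longrightarrow> sqrt (G (x t) v v) \<le> K * norm v"
    by (rule inner_form_norm_comparison[of "{a..b}" "\<lambda>t. G (x t)"]) (blast intro: compact_Icc form xS Gc)+
  \<comment> \<open>The accumulated error \<eta> * (c - a) must not exceed \<epsilon>; adding 1 to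
    the denominator also covers a = b.\<close>
  define \<eta> where "\<eta> = \<epsilon> / (1 + \<bar>b - a\<bar>)"
  have \<eta>: "\<eta> > 0" "\<eta> * (c - a) \<le> \<epsilon>" if "c \<in> {a..b}" for c
    using \<open>\<epsilon> > 0\<close> that by (auto simp: \<eta>_def field_simps intro: add_increasing mult_left_mono)
  \<comment> \<open>The factor k / K converts the Euclidean error bound into G-norms: K bounds the
    G-norm of the error by its Euclidean norm, k bounds the Euclidean norm of w by its G-norm, both
    uniformly along the curve.\<close>
  obtain r where r: "r > 0" "\<And>t. t \<in> {a..b} \<Longrightarrow> cball (x t) r \<subseteq> S"
    and lin: "\<And>t w. t \<in> {a..b} \<Longrightarrow> norm w \<le> r \<Longrightarrow>
      norm (\<xi> t (x t + w) - \<xi> t (x t) - \<xi>' t (x t) w) \<le> (\<eta> * k / K) * norm w"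
  proof (rule uniform_linearization[of "{a..b}" S x \<xi> \<xi>' "\<eta> * k / K"])
    show "\<eta> * k / K > 0" using k(1,2) \<open>\<epsilon> > 0\<close> by (simp add: \<eta>_def)
  qed (use \<open>open S\<close> xc xS der cont in \<open>blast intro: compact_Icc\<close>)+
  show ?thesis
  proof (rule that[OF r])
    fix y c
    assume c: "c \<in> {a..b}"
      and dy: "\<And>t. t \<in> {a..c} \<Longrightarrow> (y has_vector_derivative \<xi> t (y t)) (at t within {a..c})"
      and close: "\<And>t. t \<in> {a..c} \<Longrightarrow> norm (y t - x t) \<le> r"
    define w where "w t = y t - x t" for t
    define w' where "w' t = \<xi> t (y t) - \<xi> t (x t)" for t
    define f where "f t = G (x t) (w t) (w t)" for t
    define f' where "f' t = DG (x t) (\<xi> t (x t)) (w t) (w t) + 2 * G (x t) (w' t) (w t)" for t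
    have sub: "t \<in> {a..b}" if "t \<in> {a..c}" for t using that c by auto
    have dx': "(x has_vector_derivative \<xi> t (x t)) (at t within {a..c})" if "t \<in> {a..c}" for t
      using dx[OF sub[OF that]] by (rule has_vector_derivative_within_subset) (use c in auto)
    have dw: "(w has_vector_derivative w' t) (at t within {a..c})" if "t \<in> {a..c}" for t
      unfolding w_def w'_def using dy[OF that] dx'[OF that] by (rule has_vector_derivative_diff)
    have "f c \<le> exp (integral {a..c} (\<lambda>t. 2 * (\<rho> t + \<eta>))) * f a"
    proof (rule gronwall_integral)
      show "a \<le> c" using c by auto
      show "continuous_on {a..c} (\<lambda>t. 2 * (\<rho> t + \<eta>))"
        by (intro continuous_intros continuous_on_subset[OF \<rho>]) (use c in auto)
      fix t assume t: "t \<in> {a..c}"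
      note tb = sub[OF t]
      have fm: "inner_form (G (x t))" using form xS[OF tb] by blast
      have bil: "bilinear (G (x t))" using fm by (simp add: inner_form_def)
      show "(f has_real_derivative f' t) (at t within {a..c})"
        unfolding f_def f'_def
        using form dG[OF xS[OF tb]] xS[OF sub] t dx'[OF t] dw[OF t] \<open>open S\<close>
        by (intro quadratic_form_has_derivative[where S = S and DG = "DG (x t)"]) (auto simp: inner_form_def)
      define e where "e = w' t - \<xi>' t (x t) (w t)"
      have "norm e \<le> (\<eta> * k / K) * norm (w t)"
        using lin[OF tb, of "w t"] close[OF t] by (simp add: e_def w'_def w_def)
      then have "K * norm e \<le> \<eta> * (k * norm (w t))" using k(2) by (simp add: field_simps)
      also have "\<dots> \<le> \<eta> * sqrt (f t)"
        using k(3)[OF tb] \<eta>(1)[OF c] by (simp add: f_def)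
      finally have "sqrt (G (x t) e e) \<le> \<eta> * sqrt (f t)" using k(4)[OF tb, of e] by linarith
      then have "sqrt (G (x t) e e) * sqrt (f t) \<le> \<eta> * sqrt (f t) * sqrt (f t)"
        using inner_form_nonneg[OF fm] by (intro mult_right_mono) (auto simp: f_def)
      moreover have "sqrt (f t) * sqrt (f t) = f t"
        using inner_form_nonneg[OF fm] by (simp add: f_def)
      ultimately have "G (x t) e (w t) \<le> \<eta> * f t"
        using inner_form_cauchy_schwarz[OF fm, of e "w t"] by (simp add: f_def mult.assoc)
      moreover have "f' t = DG (x t) (\<xi> t (x t)) (w t) (w t) + 2 * G (x t) (\<xi>' t (x t) (w t)) (w t)
          + 2 * G (x t) e (w t)"
        by (simp add: f'_def e_def bilinear_lsub[OF bil])
      ultimately show "f' t \<le> 2 * (\<rho> t + \<eta>) * f t"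
        using le[OF tb, of "w t"] by (simp add: f_def algebra_simps)
    qed
    then have "sqrt (f c) \<le> sqrt (exp (integral {a..c} (\<lambda>t. 2 * (\<rho> t + \<eta>))) * f a)" by simp
    also have "integral {a..c} (\<lambda>t. 2 * (\<rho> t + \<eta>)) = 2 * (integral {a..c} \<rho> + \<eta> * (c - a))"
    proof -
      have "\<rho> integrable_on {a..c}"
        using \<rho> c by (intro integrable_continuous_real continuous_on_subset[OF \<rho>]) auto
      then have "integral {a..c} (\<lambda>t. \<rho> t + \<eta>) = integral {a..c} \<rho> + \<eta> * (c - a)"
        using c by (subst integral_add) (auto simp: mult.commute)
      then show ?thesis by (simp only: integral_mult_right)
    qed
    also have "sqrt (exp (2 * (integral {a..c} \<rho> + \<eta> * (c - a))) * f a)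
        = exp (integral {a..c} \<rho> + \<eta> * (c - a)) * sqrt (f a)"
      by (simp only: real_sqrt_mult exp_double real_sqrt_abs abs_exp_cancel)
    also have "\<dots> \<le> exp (integral {a..c} \<rho> + \<epsilon>) * sqrt (f a)"
      using \<eta>(2)[OF c] inner_form_nonneg[OF form[OF xS[of a]]] c
      by (intro mult_right_mono) (auto simp: f_def)
    finally show "sqrt (G (x c) (y c - x c) (y c - x c)) \<le>
        exp (integral {a..c} \<rho> + \<epsilon>) * sqrt (G (x a) (y a - x a) (y a - x a))"
      by (simp add: f_def w_def)
  qed
qed

section \<open>The metric and the connection in charts\<close>

lemma continuous_on_SUP_compact:
  fixes f :: "'a::topological_space \<times> 'b::topological_space \<Rightarrow> real"
  assumes cont: "continuous_on (U \<times> C) f" and "compact C" and "C \<noteq> {}"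
  shows "continuous_on U (\<lambda>x. SUP y\<in>C. f (x, y))"
proof -
  have bdd: "bdd_above ((\<lambda>y. f (x, y)) ` C)" if "x \<in> U" for x
  proof -
    have "continuous_on C (\<lambda>y. f (x, y))"
      using that by (intro continuous_on_compose2[OF cont] continuous_intros) auto
    then have "compact ((\<lambda>y. f (x, y)) ` C)" using assms(2) by (rule compact_continuous_image)
    then show ?thesis by (intro bounded_imp_bdd_above compact_imp_bounded)
  qed
  have le: "(SUP y\<in>C. f (x, y)) \<le> (SUP y\<in>C. f (x', y)) + e"
    if "x' \<in> U" and "\<forall>y\<in>C. dist (f (x, y)) (f (x', y)) \<le> e" for x x' e
  proof (rule cSUP_least[OF assms(3)])
    fix y assume y: "y \<in> C"
    have "f (x, y) \<le> f (x', y) + e" using that(2) y by (force simp: dist_real_def)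
    also have "f (x', y) \<le> (SUP y\<in>C. f (x', y))" using bdd[OF that(1)] y by (rule cSUP_upper[rotated])
    finally show "f (x, y) \<le> (SUP y\<in>C. f (x', y)) + e" by simp
  qed
  \<comment> \<open>Compactness of C makes f (x', y) close to f (x, y) uniformly in y for x' near x;
    by \<open>le\<close>, applied both ways, the suprema differ by no more.\<close>
  show ?thesis
    unfolding continuous_on_def
  proof (intro ballI tendstoI)
    fix x and e :: real assume x: "x \<in> U" and e: "e > 0"
    obtain X0 where X0: "x \<in> X0" "open X0"
      "\<forall>x'\<in>X0 \<inter> U. \<forall>y\<in>C. dist (f (x', y)) (f (x, y)) \<le> e / 2"
      by (rule continuous_on_prod_compactE[OF cont assms(2) x half_gt_zero[OF e]])
    have "\<forall>\<^sub>F x' in at x within U. x' \<in> X0 \<inter> U"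
      using X0(1,2) by (auto simp: eventually_at_topological)
    then show "\<forall>\<^sub>F x' in at x within U. dist (SUP y\<in>C. f (x', y)) (SUP y\<in>C. f (x, y)) < e"
    proof eventually_elim
      case (elim x')
      then have "(SUP y\<in>C. f (x', y)) \<le> (SUP y\<in>C. f (x, y)) + e / 2"
        and "(SUP y\<in>C. f (x, y)) \<le> (SUP y\<in>C. f (x', y)) + e / 2"
        using X0(3) x by (auto intro!: le simp: dist_commute)
      then show ?case using e by (simp add: dist_real_def abs_if)
    qed
  qed
qed

text \<open>A supremum of reals is meaningful only for a set that is bounded above; M supplies the
  bound for the operator norm below.\<close>

lemma inner_form_operator_bound:
  assumes B: "inner_form (B :: 'e::euclidean_space \<Rightarrow> 'e \<Rightarrow> real)" and L: "linear L"
  obtains M where "\<And>v. sqrt (B (L v) (L v)) \<le> M * sqrt (B v v)"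
proof -
  obtain k K where k: "0 < k" "0 < K" "\<And>v. k * norm v \<le> sqrt (B v v)" "\<And>v. sqrt (B v v) \<le> K * norm v"
    by (rule inner_form_norm_comparison[of "{0::real}" "\<lambda>_. B"]) (use B in auto)
  obtain N where N: "0 < N" "\<And>v. norm (L v) \<le> N * norm v" using linear_bounded_pos[OF L] by auto
  show ?thesis
  proof (rule that)
    fix v
    have "sqrt (B (L v) (L v)) \<le> K * (N * norm v)"
      using k(4)[of "L v"] mult_left_mono[OF N(2)[of v] less_imp_le[OF k(2)]] by linarith
    also have "\<dots> = K * N / k * (k * norm v)" using k(1) by simp
    also have "\<dots> \<le> K * N / k * sqrt (B v v)"
      by (rule mult_left_mono[OF k(3)]) (use k(1,2) N(1) in simp)
    finally show "sqrt (B (L v) (L v)) \<le> K * N / k * sqrt (B v v)" .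
  qed
qed

text \<open>The unit sphere of B varies with the point of the manifold, so the supremum in
  \<open>nabla_norm\<close> runs over a moving set. Since the quotient of the norms is homogeneous
  of degree 0, it may run over the fixed Euclidean sphere instead, to which
  \<open>continuous_on_SUP_compact\<close> applies.\<close>

lemma inner_form_operator_norm:
  assumes B: "inner_form (B :: 'e::euclidean_space \<Rightarrow> 'e \<Rightarrow> real)" and L: "linear L"
  defines "N \<equiv> SUP v\<in>{v. sqrt (B v v) = 1}. sqrt (B (L v) (L v))"
  shows "N = (SUP v\<in>sphere 0 1. sqrt (B (L v) (L v)) / sqrt (B v v))"
    and "0 \<le> N" and "sqrt (B (L v) (L v)) \<le> N * sqrt (B v v)"
proof -
  let ?q = "\<lambda>v. sqrt (B (L v) (L v)) / sqrt (B v v)"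
  have bil: "bilinear B" using B by (simp add: inner_form_def)
  have pos: "0 < sqrt (B v v)" if "v \<noteq> 0" for v using B that by (auto simp: inner_form_def)
  have scale: "sqrt (B (L (r *\<^sub>R v)) (L (r *\<^sub>R v))) = \<bar>r\<bar> * sqrt (B (L v) (L v))" for r v
    by (simp only: linear_scale[OF L] inner_form_scaleR[OF B])
  have hom: "?q (r *\<^sub>R v) = ?q v" if "r \<noteq> 0" for r v
    using that by (simp only: scale inner_form_scaleR[OF B]) simp
  have unit: "sqrt (B (L v) (L v)) = ?q v" if "sqrt (B v v) = 1" for v
    using that by simp
  have normed: "sqrt (B ((1 / sqrt (B v v)) *\<^sub>R v) ((1 / sqrt (B v v)) *\<^sub>R v)) = 1" if "v \<noteq> 0" for v
    using pos[OF that] by (simp only: inner_form_scaleR[OF B]) simp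
  have img: "(\<lambda>v. sqrt (B (L v) (L v))) ` {v. sqrt (B v v) = 1} = ?q ` sphere 0 1"
  proof (intro equalityI subsetI; elim imageE)
    fix y v assume y: "y = sqrt (B (L v) (L v))" and v: "v \<in> {v. sqrt (B v v) = 1}"
    then have "v \<noteq> 0" using bil by (auto simp: bilinear_lzero)
    have "?q ((1 / norm v) *\<^sub>R v) = ?q v" by (rule hom) (use \<open>v \<noteq> 0\<close> in simp)
    then have "?q ((1 / norm v) *\<^sub>R v) = y" using y v unit[of v] by simp
    moreover have "(1 / norm v) *\<^sub>R v \<in> sphere 0 1" using \<open>v \<noteq> 0\<close> by simp
    ultimately show "y \<in> ?q ` sphere 0 1" by blast
  next
    fix y v assume y: "y = ?q v" and v: "v \<in> sphere (0::'e) 1"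
    then have v0: "v \<noteq> 0" by auto
    have "?q ((1 / sqrt (B v v)) *\<^sub>R v) = y"
      unfolding y by (rule hom) (use pos[OF v0] in simp)
    then have "sqrt (B (L ((1 / sqrt (B v v)) *\<^sub>R v)) (L ((1 / sqrt (B v v)) *\<^sub>R v))) = y"
      using unit[OF normed[OF v0]] by metis
    then show "y \<in> (\<lambda>v. sqrt (B (L v) (L v))) ` {v. sqrt (B v v) = 1}"
      using normed[OF v0] by blast
  qed
  show N: "N = (SUP v\<in>sphere 0 1. ?q v)" unfolding N_def img ..
  obtain M where M: "\<And>v. sqrt (B (L v) (L v)) \<le> M * sqrt (B v v)"
    using inner_form_operator_bound[OF B L] by blast
  have "?q v \<le> M" if "v \<in> sphere 0 1" for v
    using M[of v] pos[of v] that by (cases "v = 0") (auto simp: pos_divide_le_eq)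
  then have bdd: "bdd_above (?q ` sphere 0 1)" by (auto intro!: bdd_aboveI)
  have q_le: "?q v \<le> N" if "v \<noteq> 0" for v
  proof -
    have "?q ((1 / norm v) *\<^sub>R v) \<le> N"
      unfolding N by (rule cSUP_upper[OF _ bdd]) (use that in simp)
    moreover have "?q ((1 / norm v) *\<^sub>R v) = ?q v" by (rule hom) (use that in simp)
    ultimately show ?thesis by simp
  qed
  \<comment> \<open>A supremum of nonnegative numbers is known to be nonnegative only over a
    nonempty index set; a basis vector provides an element.\<close>
  obtain b :: 'e where b: "b \<in> Basis" using nonempty_Basis by blast
  have "0 \<le> ?q b" using inner_form_nonneg[OF B] by simp
  then show "0 \<le> N" using q_le[of b] b nonzero_Basis by force
  show "sqrt (B (L v) (L v)) \<le> N * sqrt (B v v)"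
  proof (cases "v = 0")
    case True
    then show ?thesis using bil by (simp add: linear_0[OF L] bilinear_lzero)
  next
    case False
    then show ?thesis using q_le[OF False] pos[OF False] by (simp add: pos_divide_le_eq)
  qed
qed

section \<open>The metric in coordinates, and limits on the manifold\<close>

locale riemannian_manifold = smooth_manifold A
  for A :: "('m::t2_space, 'e::euclidean_space) chart set" +
  fixes g :: "'m \<Rightarrow> 'e \<Rightarrow> 'e \<Rightarrow> real"
  assumes metric: "riemannian_metric A g"
begin

definition metric_coord :: "('m, 'e) chart \<Rightarrow> 'e \<Rightarrow> 'e \<Rightarrow> 'e \<Rightarrow> real" where
  "metric_coord c x u v =
     g (chart_inv c x) (of_coord c (chart_inv c x) u) (of_coord c (chart_inv c x) v)"

lemma inner_form_metric: "inner_form (g p)"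
  using metric by (auto simp: riemannian_metric_def inner_form_def)

lemma gnorm_nonneg: "0 \<le> gnorm g p v"
  using inner_form_nonneg[OF inner_form_metric] by (simp add: gnorm_def)

lemma gnorm_zero: "gnorm g p 0 = 0"
  using inner_form_metric[of p] by (simp add: gnorm_def inner_form_def bilinear_lzero)

lemma gnorm_scaleR: "gnorm g p (r *\<^sub>R v) = \<bar>r\<bar> * gnorm g p v"
  unfolding gnorm_def by (rule inner_form_scaleR[OF inner_form_metric])

lemma gnorm_minus_commute: "gnorm g p (u - v) = gnorm g p (v - u)"
  using gnorm_scaleR[of p "-1" "v - u"] by simp

lemma gnorm_triangle: "gnorm g p (u + v) \<le> gnorm g p u + gnorm g p v"
  unfolding gnorm_def by (rule inner_form_triangle[OF inner_form_metric])

lemma inner_form_metric_coord: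
  assumes "c \<in> A" and "x \<in> snd c ` fst c"
  shows "inner_form (metric_coord c x)"
proof -
  let ?p = "chart_inv c x"
  have p: "?p \<in> fst c" using assms by (rule chart_inv_mem)
  have lin: "linear (of_coord c ?p)" using assms(1) p by (rule linear_tangent_of_coord)
  have inj: "of_coord c ?p v \<noteq> 0" if "v \<noteq> 0" for v
    using tangent_coord_of_coord[OF assms(1) p] linear_0[OF linear_tangent_coord[OF assms(1) p]] that
    by metis
  have bil: "bilinear (g ?p)" using inner_form_metric by (auto simp: inner_form_def)
  have "bilinear (\<lambda>u v. g ?p (of_coord c ?p u) (of_coord c ?p v))"
    using bil lin by (auto simp: bilinear_def intro: linear_compose[unfolded o_def])
  then show ?thesis
    using inner_form_metric[of ?p] inj by (auto simp: inner_form_def metric_coord_def[abs_def])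
qed

lemma metric_coord_has_derivative:
  assumes "c \<in> A" and "x \<in> snd c ` fst c"
  shows "((\<lambda>x. metric_coord c x u v) has_derivative
    frechet_derivative (\<lambda>x. metric_coord c x u v) (at x)) (at x)"
  using metric assms chart_image_open
  by (intro smooth_on_has_derivative[where S = "snd c ` fst c"])
    (auto simp: riemannian_metric_def metric_coord_def)

lemma continuous_on_metric_coord:
  "c \<in> A \<Longrightarrow> continuous_on (snd c ` fst c) (\<lambda>x. metric_coord c x u v)"
  using metric by (auto simp: riemannian_metric_def metric_coord_def intro: smooth_on_imp_continuous_on)

lemma gnorm_of_coord:
  "c \<in> A \<Longrightarrow> p \<in> fst c \<Longrightarrow>
    gnorm g p (of_coord c p v) = sqrt (metric_coord c (snd c p) v v)"
  by (simp add: gnorm_def metric_coord_def chart_inv_chart)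

lemma gnorm_eq_coord:
  "c \<in> A \<Longrightarrow> p \<in> fst c \<Longrightarrow> gnorm g p v =
    sqrt (metric_coord c (snd c p) (to_coord c p v) (to_coord c p v))"
  using gnorm_of_coord[of c p "to_coord c p v"] by (simp add: tangent_of_coord_coord)

lemma continuous_on_metric_coord_compose:
  assumes "c \<in> A" and x: "continuous_on D x" and "x ` D \<subseteq> snd c ` fst c"
    and w: "continuous_on D w"
  shows "continuous_on D (\<lambda>s. sqrt (metric_coord c (x s) (w s) (w s)))"
proof (rule continuous_on_eq)
  show "continuous_on D (\<lambda>s. sqrt (\<Sum>i\<in>Basis. \<Sum>j\<in>Basis. (w s \<bullet> i) * (w s \<bullet> j) * metric_coord c (x s) i j))"
    using assms by (intro continuous_intros continuous_on_compose2[OF continuous_on_metric_coord x]) auto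
  show "sqrt (\<Sum>i\<in>Basis. \<Sum>j\<in>Basis. (w s \<bullet> i) * (w s \<bullet> j) * metric_coord c (x s) i j) =
      sqrt (metric_coord c (x s) (w s) (w s))" if "s \<in> D" for s
    using inner_form_metric_coord[OF assms(1)] assms(3) that
    by (subst bilinear_basis_expansion[of "metric_coord c (x s)"]) (auto simp: inner_form_def)
qed

text \<open>Joint continuity in time and in the preferred chart at the limit point suffices, since q
  eventually enters that chart. The filter F is arbitrary so that the lemma serves both for single
  curves and for families with two parameters.\<close>

lemma tendsto_chartwise:
  assumes "continuous_on ({0..T} \<times> snd (chart_at A p) ` fst (chart_at A p))
      (\<lambda>(s, x). h s (chart_inv (chart_at A p) x))"
    and f: "(f \<longlongrightarrow> s) F" and q: "(q \<longlongrightarrow> p) F" and "s \<in> {0..T}"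
    and ev: "\<forall>\<^sub>F u in F. f u \<in> {0..T}"
  shows "((\<lambda>u. h (f u) (q u)) \<longlongrightarrow> (h s p :: real)) F"
proof -
  let ?c = "chart_at A p"
  have evq: "\<forall>\<^sub>F u in F. q u \<in> fst ?c"
    using q chart_open[OF chart_at_mem] mem_chart_at by (rule topological_tendstoD)
  have "((\<lambda>u. (f u, snd ?c (q u))) \<longlongrightarrow> (s, snd ?c p)) F"
    using f tendsto_chart[OF chart_at_mem mem_chart_at q] by (rule tendsto_Pair)
  moreover have "(s, snd ?c p) \<in> {0..T} \<times> snd ?c ` fst ?c"
    using assms(4) mem_chart_at by auto
  moreover have "\<forall>\<^sub>F u in F. (f u, snd ?c (q u)) \<in> {0..T} \<times> snd ?c ` fst ?c"
    using ev evq by eventually_elim auto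
  ultimately have "((\<lambda>u. h (f u) (chart_inv ?c (snd ?c (q u)))) \<longlongrightarrow> h s (chart_inv ?c (snd ?c p))) F"
    using continuous_on_tendsto_compose[OF assms(1)] by fastforce
  then have "((\<lambda>u. h (f u) (chart_inv ?c (snd ?c (q u)))) \<longlongrightarrow> h s p) F"
    by (simp add: chart_inv_chart[OF chart_at_mem mem_chart_at])
  then show ?thesis
    by (rule Lim_transform_eventually) (use evq in \<open>eventually_elim, simp add: chart_inv_chart[OF chart_at_mem]\<close>)
qed

lemma tendsto_gnorm_diff:
  assumes X: "smooth_time_dependent_field A T X" and Z: "smooth_time_dependent_field A T Z"
    and "(f \<longlongrightarrow> s) F" and "(q \<longlongrightarrow> p) F" and "s \<in> {0..T}" and "\<forall>\<^sub>F u in F. f u \<in> {0..T}"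
  shows "((\<lambda>u. gnorm g (q u) (Z (f u) (q u) - X (f u) (q u))) \<longlongrightarrow> gnorm g p (Z s p - X s p)) F"
proof (rule tendsto_chartwise[OF _ assms(3-6)])
  let ?c = "chart_at A p"
  let ?w = "\<lambda>(s, x). field_coord ?c (Z s) x - field_coord ?c (X s) x"
  let ?D = "{0..T} \<times> snd ?c ` fst ?c"
  have w: "continuous_on ?D ?w"
    using continuous_on_diff[OF continuous_on_field_coord[OF Z chart_at_mem[of p]]
        continuous_on_field_coord[OF X chart_at_mem[of p]]]
    by (simp add: case_prod_beta)
  have "continuous_on ?D (\<lambda>a. sqrt (metric_coord ?c (snd a) (?w a) (?w a)))"
    by (rule continuous_on_metric_coord_compose[OF chart_at_mem _ _ w]) (auto intro: continuous_intros)
  then show "continuous_on ?D (\<lambda>(s, x). gnorm g (chart_inv ?c x) (Z s (chart_inv ?c x) - X s (chart_inv ?c x)))"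
  proof (rule continuous_on_eq)
    fix a assume "a \<in> ?D"
    then obtain s y where a: "a = (s, snd ?c y)" "y \<in> fst ?c" by auto
    show "sqrt (metric_coord ?c (snd a) (?w a) (?w a)) =
        (case a of (s, x) \<Rightarrow> gnorm g (chart_inv ?c x) (Z s (chart_inv ?c x) - X s (chart_inv ?c x)))"
      using a chart_at_mem[of p]
      by (simp add: gnorm_eq_coord[of ?c] chart_inv_chart field_coord_def
          linear_diff[OF linear_tangent_coord])
  qed
qed

end

section \<open>The Levi-Civita connection in coordinates\<close>

locale levi_civita_manifold = riemannian_manifold A g
  for A :: "('m::t2_space, 'e::euclidean_space) chart set" and g +
  fixes nabla :: "'m \<Rightarrow> 'e \<Rightarrow> ('m \<Rightarrow> 'e) \<Rightarrow> 'e"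
  assumes levi_civita: "levi_civita A g nabla"
begin

definition nabla_coord :: "('m, 'e) chart \<Rightarrow> ('m \<Rightarrow> 'e) \<Rightarrow> 'e \<Rightarrow> 'e \<Rightarrow> 'e" where
  "nabla_coord c V x w =
     to_coord c (chart_inv c x) (nabla (chart_inv c x) (of_coord c (chart_inv c x) w) V)"

lemma
  assumes "open U" and "smooth_vector_field_on A U V"
  shows nabla_linear: "p \<in> U \<Longrightarrow> linear (\<lambda>v. nabla p v V)"
    and nabla_smooth: "smooth_vector_field_on A U W \<Longrightarrow> smooth_vector_field_on A U (\<lambda>q. nabla q (V q) W)"
    and nabla_add: "smooth_vector_field_on A U W \<Longrightarrow> p \<in> U \<Longrightarrow>
      nabla p v (\<lambda>q. V q + W q) = nabla p v V + nabla p v W"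
proof -
  \<comment> \<open>The clauses of \<open>affine_connection\<close> are bundled under one quantifier
    that also ranges over a smooth function f; the zero function instantiates it for the clauses
    without f.\<close>
  have 0: "smooth_fun_on A U (\<lambda>_. 0)"
    unfolding smooth_fun_on_def o_def by (simp add: smooth_on_const)
  note ax = levi_civita[unfolded levi_civita_def affine_connection_def] assms 0
  show "p \<in> U \<Longrightarrow> linear (\<lambda>v. nabla p v V)"
    and "smooth_vector_field_on A U W \<Longrightarrow> smooth_vector_field_on A U (\<lambda>q. nabla q (V q) W)"
    and "smooth_vector_field_on A U W \<Longrightarrow> p \<in> U \<Longrightarrow>
      nabla p v (\<lambda>q. V q + W q) = nabla p v V + nabla p v W"
    using ax by blast+
qed

lemma nabla_zero: "nabla p v (\<lambda>q. 0) = 0"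
  using nabla_add[OF open_UNIV smooth_zero_field smooth_zero_field UNIV_I, of p v] by simp

lemma vector_apply_coordinate:
  assumes "c \<in> A" and "p \<in> fst c"
  shows "vector_apply A p v (\<lambda>q. snd c q \<bullet> b) = to_coord c p v \<bullet> b"
proof (rule vector_apply_eq[OF assms])
  have "((\<lambda>x. x \<bullet> b) has_derivative (\<lambda>d. d \<bullet> b)) (at (snd c p))"
    by (intro bounded_linear_imp_has_derivative bounded_linear_inner_left)
  then show "((\<lambda>q. snd c q \<bullet> b) \<circ> chart_inv c has_derivative (\<lambda>d. d \<bullet> b)) (at (snd c p))"
    by (rule has_derivative_at_chart_cong[OF assms(1) open_UNIV assms(2) UNIV_I])
      (simp add: chart_inv_chart[OF assms(1)])
qed

text \<open>Torsion freeness, tested on the coordinate functions, with a field of constant coordinates.\<close>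

lemma nabla_coordinate_field:
  assumes "c \<in> A" and V: "smooth_vector_field_on A (fst c) V" and "p \<in> fst c"
  shows "to_coord c p (nabla p (of_coord c p w) V) =
    to_coord c p (nabla p (V p) (\<lambda>q. of_coord c q w))
    + frechet_derivative (field_coord c V) (at (snd c p)) w"
proof (rule euclidean_eqI)
  fix b :: 'e
  define W where "W = (\<lambda>q. of_coord c q w)"
  let ?f = "\<lambda>q. snd c q \<bullet> b" and ?D = "frechet_derivative (field_coord c V) (at (snd c p))"
  have W: "smooth_vector_field_on A (fst c) W"
    unfolding W_def using assms(1) by (rule smooth_coordinate_field)
  have "vector_apply A p (nabla p (V p) W - nabla p (W p) V) ?f =
      vector_apply A p (V p) (\<lambda>q. vector_apply A q (W q) ?f) -
      vector_apply A p (W p) (\<lambda>q. vector_apply A q (V q) ?f)"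
    using levi_civita chart_open[OF assms(1)] V W smooth_coordinate_fun[OF assms(1)] assms(3)
    unfolding levi_civita_def torsion_free_def by blast
  \<comment> \<open>W has constant coordinates w, so W applied to a coordinate function is constant
    and one of the two terms of the bracket vanishes. The other one is the derivative of the
    coordinates of V in direction w.\<close>
  moreover have "vector_apply A p (V p) (\<lambda>q. vector_apply A q (W q) ?f) = 0"
  proof (rule vector_apply_eq[OF assms(1,3), where f' = "\<lambda>_. 0"])
    have "((\<lambda>x. w \<bullet> b) has_derivative (\<lambda>_. 0)) (at (snd c p))" by (rule has_derivative_const)
    then show "((\<lambda>q. vector_apply A q (W q) ?f) \<circ> chart_inv c has_derivative (\<lambda>_. 0)) (at (snd c p))"
      by (rule has_derivative_at_chart_cong[OF assms(1) open_UNIV assms(3) UNIV_I])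
        (simp add: chart_inv_chart[OF assms(1)] vector_apply_coordinate[OF assms(1)] W_def
          tangent_coord_of_coord[OF assms(1)])
  qed
  moreover have "vector_apply A p (W p) (\<lambda>q. vector_apply A q (V q) ?f) = ?D (to_coord c p (W p)) \<bullet> b"
  proof (rule vector_apply_eq[OF assms(1,3), where f' = "\<lambda>d. ?D d \<bullet> b"])
    have "(field_coord c V has_derivative ?D) (at (snd c p))"
      using smooth_field_coord[OF assms(1) V] chart_image_open[OF assms(1)] assms(3)
      by (intro smooth_on_has_derivative) auto
    then have "((\<lambda>x. field_coord c V x \<bullet> b) has_derivative (\<lambda>d. ?D d \<bullet> b)) (at (snd c p))"
      by (rule has_derivative_inner_left)
    then show "((\<lambda>q. vector_apply A q (V q) ?f) \<circ> chart_inv c has_derivative (\<lambda>d. ?D d \<bullet> b)) (at (snd c p))"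
      by (rule has_derivative_at_chart_cong[OF assms(1) open_UNIV assms(3) UNIV_I])
        (simp add: chart_inv_chart[OF assms(1)] vector_apply_coordinate[OF assms(1)] field_coord_def)
  qed
  moreover have "to_coord c p (W p) = w"
    unfolding W_def using assms(1,3) by (rule tangent_coord_of_coord)
  ultimately have "to_coord c p (nabla p (W p) V) \<bullet> b = (to_coord c p (nabla p (V p) W) + ?D w) \<bullet> b"
    using assms(1,3)
    by (simp add: vector_apply_coordinate linear_diff[OF linear_tangent_coord] inner_diff_left inner_add_left)
  then show "to_coord c p (nabla p (of_coord c p w) V) \<bullet> b =
      (to_coord c p (nabla p (V p) (\<lambda>q. of_coord c q w)) + ?D w) \<bullet> b"
    by (simp only: W_def)
qed

text \<open>For the field W with constant coordinates w, metric compatibility gives 2 g (nabla_V W,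
  W) as the derivative of g (W, W) along V. By \<open>nabla_coordinate_field\<close>, nabla_V W is
  nabla_W V minus the coordinate derivative of V in direction w, and the second summand on the left
  cancels exactly this last term.\<close>

lemma lie_derivative_metric:
  assumes "c \<in> A" and V: "smooth_vector_field_on A (fst c) V" and "p \<in> fst c"
  shows "frechet_derivative (\<lambda>x. metric_coord c x w w) (at (snd c p)) (field_coord c V (snd c p))
      + 2 * metric_coord c (snd c p) (frechet_derivative (field_coord c V) (at (snd c p)) w) w
      = 2 * g p (nabla p (of_coord c p w) V) (of_coord c p w)"
proof -
  let ?v = "of_coord c p w"
  let ?W = "\<lambda>q. of_coord c q w" and ?D = "frechet_derivative (field_coord c V) (at (snd c p))"
  have W: "smooth_vector_field_on A (fst c) ?W"
    using assms(1) by (rule smooth_coordinate_field)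
  have bil: "bilinear (g p)" and sym: "g p a b = g p b a" for a b
    using inner_form_metric by (auto simp: inner_form_def)
  have "(\<lambda>q. g q (?W q) (?W q)) \<circ> chart_inv c = (\<lambda>x. metric_coord c x w w)"
    by (simp add: o_def metric_coord_def)
  then have "vector_apply A p (V p) (\<lambda>q. g q (?W q) (?W q)) =
      frechet_derivative (\<lambda>x. metric_coord c x w w) (at (snd c p)) (to_coord c p (V p))"
    using metric_coord_has_derivative[OF assms(1)] assms(3)
    by (intro vector_apply_eq[OF assms(1,3)]) auto
  moreover have "vector_apply A p (V p) (\<lambda>q. g q (?W q) (?W q)) =
      g p (nabla p (V p) ?W) (?W p) + g p (?W p) (nabla p (V p) ?W)"
    using levi_civita chart_open[OF assms(1)] W assms(3)
    unfolding levi_civita_def metric_compatible_def by blast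
  moreover have "nabla p (V p) ?W = nabla p ?v V - of_coord c p (?D w)"
  proof -
    have "to_coord c p (nabla p (V p) ?W) = to_coord c p (nabla p ?v V) - ?D w"
      using nabla_coordinate_field[OF assms, of w] by simp
    then have "of_coord c p (to_coord c p (nabla p (V p) ?W)) =
        of_coord c p (to_coord c p (nabla p ?v V) - ?D w)" by simp
    then show ?thesis
      using assms(1,3) by (simp add: linear_diff[OF linear_tangent_of_coord] tangent_of_coord_coord)
  qed
  ultimately show ?thesis
    using assms(1,3)
    by (simp add: field_coord_def metric_coord_def chart_inv_chart bilinear_lsub[OF bil]
        sym[of _ "nabla p _ _ - _"])
qed

lemma nabla_norm_nonneg:
  assumes "open U" and "smooth_vector_field_on A U V" and "p \<in> U"
  shows "0 \<le> nabla_norm g nabla V p"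
  using inner_form_operator_norm(2)[OF inner_form_metric nabla_linear[OF assms]]
  by (simp add: nabla_norm_def gnorm_def)

lemma gnorm_nabla_le:
  assumes "open U" and "smooth_vector_field_on A U V" and "p \<in> U"
  shows "gnorm g p (nabla p v V) \<le> nabla_norm g nabla V p * gnorm g p v"
  using inner_form_operator_norm(3)[OF inner_form_metric nabla_linear[OF assms]]
  by (simp add: nabla_norm_def gnorm_def)

text \<open>Cauchy-Schwarz and the operator norm. In this form it provides the hypothesis
  \<open>le\<close> of \<open>local_flow_comparison\<close>, with \<rho> the norm of nabla X along
  the curve.\<close>

lemma lie_derivative_metric_le:
  assumes "c \<in> A" and V: "smooth_vector_field_on A (fst c) V" and "p \<in> fst c"
  shows "frechet_derivative (\<lambda>x. metric_coord c x w w) (at (snd c p)) (field_coord c V (snd c p))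
      + 2 * metric_coord c (snd c p) (frechet_derivative (field_coord c V) (at (snd c p)) w) w
      \<le> 2 * nabla_norm g nabla V p * metric_coord c (snd c p) w w"
proof -
  let ?v = "of_coord c p w"
  have "g p (nabla p ?v V) ?v \<le> gnorm g p (nabla p ?v V) * gnorm g p ?v"
    unfolding gnorm_def by (rule inner_form_cauchy_schwarz[OF inner_form_metric])
  also have "\<dots> \<le> nabla_norm g nabla V p * gnorm g p ?v * gnorm g p ?v"
    using gnorm_nabla_le[OF chart_open[OF assms(1)] V assms(3)] gnorm_nonneg
    by (rule mult_right_mono)
  also have "\<dots> = nabla_norm g nabla V p * (gnorm g p ?v * gnorm g p ?v)" by simp
  also have "gnorm g p ?v * gnorm g p ?v = metric_coord c (snd c p) w w"
    using inner_form_nonneg[OF inner_form_metric_coord[OF assms(1)]] assms(1,3)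
    by (simp add: gnorm_of_coord)
  finally show ?thesis
    unfolding lie_derivative_metric[OF assms] by (simp add: mult.assoc)
qed

lemma linear_nabla_coord:
  assumes "c \<in> A" and "smooth_vector_field_on A (fst c) V" and "x \<in> snd c ` fst c"
  shows "linear (nabla_coord c V x)"
proof -
  have p: "chart_inv c x \<in> fst c" using assms chart_inv_mem by blast
  show ?thesis
    unfolding nabla_coord_def[abs_def]
    using linear_compose[OF linear_compose[OF linear_tangent_of_coord[OF assms(1) p]
          nabla_linear[OF chart_open[OF assms(1)] assms(2) p]] linear_tangent_coord[OF assms(1) p]]
    by (simp add: o_def)
qed

text \<open>\<open>of_coord\<close> maps the unit vectors of the coordinate form onto those of g, so
  the supremum moves into the chart; \<open>inner_form_operator_norm\<close> then replaces the
  moving unit sphere by the Euclidean one.\<close>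

lemma nabla_norm_coord:
  assumes "c \<in> A" and V: "smooth_vector_field_on A (fst c) V" and "x \<in> snd c ` fst c"
  shows "nabla_norm g nabla V (chart_inv c x) = (SUP w\<in>sphere 0 1.
    sqrt (metric_coord c x (nabla_coord c V x w) (nabla_coord c V x w))
      / sqrt (metric_coord c x w w))"
proof -
  let ?p = "chart_inv c x" and ?L = "nabla_coord c V x" and ?B = "metric_coord c x"
  have p: "?p \<in> fst c" and x: "snd c ?p = x" using assms chart_inv_mem chart_chart_inv by auto
  have norm: "gnorm g ?p (of_coord c ?p w) = sqrt (?B w w)" for w
    using gnorm_of_coord[OF assms(1) p] x by simp
  have normL: "gnorm g ?p (nabla ?p (of_coord c ?p w) V) = sqrt (?B (?L w) (?L w))" for w
    using gnorm_eq_coord[OF assms(1) p] x by (simp add: nabla_coord_def)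
  have "(\<lambda>v. gnorm g ?p (nabla ?p v V)) ` {v. gnorm g ?p v = 1} =
      (\<lambda>w. sqrt (?B (?L w) (?L w))) ` {w. sqrt (?B w w) = 1}"
  proof (intro equalityI subsetI; elim imageE)
    fix y v assume "y = gnorm g ?p (nabla ?p v V)" and "v \<in> {v. gnorm g ?p v = 1}"
    then show "y \<in> (\<lambda>w. sqrt (?B (?L w) (?L w))) ` {w. sqrt (?B w w) = 1}"
      using norm[of "to_coord c ?p v"] normL[of "to_coord c ?p v"]
      by (intro image_eqI[of _ _ "to_coord c ?p v"])
        (auto simp: tangent_of_coord_coord[OF assms(1) p])
  next
    fix y w assume "y = sqrt (?B (?L w) (?L w))" and "w \<in> {w. sqrt (?B w w) = 1}"
    then show "y \<in> (\<lambda>v. gnorm g ?p (nabla ?p v V)) ` {v. gnorm g ?p v = 1}"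
      using norm[of w] normL[of w] by (intro image_eqI[of _ _ "of_coord c ?p w"]) auto
  qed
  then show ?thesis
    using inner_form_operator_norm(1)[OF inner_form_metric_coord[OF assms(1,3)] linear_nabla_coord[OF assms]]
    by (simp add: nabla_norm_def)
qed

text \<open>The axioms give smoothness of nabla for fields without time parameter, so the time
  dependence is isolated first. With E_j the coordinate fields, nabla of X_s along E_j has as
  coordinates the j-th partial derivative of X_s plus the combination of the \<open>?K i\<close>
  with the coordinates of X_s as coefficients. The \<open>?K i\<close> are Christoffel symbols
  (nabla of E_j along E_i) and do not involve time.\<close>

lemma continuous_on_nabla_coord_Basis:
  assumes X: "smooth_time_dependent_field A T X" and "c \<in> A"
  shows "continuous_on ({0..T} \<times> snd c ` fst c) (\<lambda>(s, x). nabla_coord c (X s) x j)"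
proof -
  let ?D = "{0..T} \<times> snd c ` fst c"
  let ?K = "\<lambda>i. field_coord c (\<lambda>q. nabla q (of_coord c q i) (\<lambda>q. of_coord c q j))"
  have K: "continuous_on (snd c ` fst c) (?K i)" for i
    using assms(2)
    by (intro smooth_on_imp_continuous_on smooth_field_coord nabla_smooth smooth_coordinate_field chart_open)
  have "continuous_on ?D (\<lambda>a. frechet_derivative (field_coord c (X (fst a))) (at (snd a)) j
      + (\<Sum>i\<in>Basis. (field_coord c (X (fst a)) (snd a) \<bullet> i) *\<^sub>R ?K i (snd a)))"
    using continuous_on_field_coord[OF assms] continuous_on_field_coord_derivative[OF assms, of j]
    unfolding case_prod_beta
    by (intro continuous_intros continuous_on_compose2[OF K]) auto
  then show ?thesis
  proof (rule continuous_on_eq)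
    fix a assume "a \<in> ?D"
    then obtain s p where a: "a = (s, snd c p)" "s \<in> {0..T}" and p: "p \<in> fst c" by auto
    let ?E = "\<lambda>i q. of_coord c q i"
    have Xs: "smooth_vector_field_on A (fst c) (X s)" using X a(2) by (rule smooth_time_slice)
    let ?\<xi> = "field_coord c (X s) (snd c p)"
    have l: "linear (\<lambda>u. to_coord c p (nabla p (of_coord c p u) (?E j)))"
      using linear_nabla_coord[OF assms(2) smooth_coordinate_field[OF assms(2)], of "snd c p" j] p
      by (simp add: nabla_coord_def[abs_def] chart_inv_chart[OF assms(2)])
    have Kp: "?K i (snd c p) = to_coord c p (nabla p (of_coord c p i) (?E j))" for i
      using p by (simp add: field_coord_def chart_inv_chart[OF assms(2)])
    have "X s p = of_coord c p ?\<xi>"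
      using p assms(2) by (simp add: field_coord_def chart_inv_chart tangent_of_coord_coord)
    then have "to_coord c p (nabla p (X s p) (?E j)) = (\<Sum>i\<in>Basis. (?\<xi> \<bullet> i) *\<^sub>R ?K i (snd c p))"
      using linear_basis_expansion[OF l, of ?\<xi>] by (simp add: Kp)
    then show "frechet_derivative (field_coord c (X (fst a))) (at (snd a)) j
        + (\<Sum>i\<in>Basis. (field_coord c (X (fst a)) (snd a) \<bullet> i) *\<^sub>R ?K i (snd a)) =
        (case a of (s, x) \<Rightarrow> nabla_coord c (X s) x j)"
      using nabla_coordinate_field[OF assms(2) Xs p, of j] p
      by (simp add: a nabla_coord_def chart_inv_chart[OF assms(2)])
  qed
qed

text \<open>The quotient of norms is jointly continuous in time, point and direction, and
  compactness of the Euclidean sphere carries this over to the supremum.\<close>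

lemma continuous_on_nabla_norm:
  assumes X: "smooth_time_dependent_field A T X" and "c \<in> A"
  shows "continuous_on ({0..T} \<times> snd c ` fst c) (\<lambda>(s, x). nabla_norm g nabla (X s) (chart_inv c x))"
proof -
  let ?D = "{0..T} \<times> snd c ` fst c" and ?S = "sphere (0::'e) 1"
  let ?n = "\<lambda>a. \<Sum>j\<in>Basis. (snd a \<bullet> j) *\<^sub>R nabla_coord c (X (fst (fst a))) (snd (fst a)) j"
  let ?q = "\<lambda>a. sqrt (metric_coord c (snd (fst a)) (?n a) (?n a))
      / sqrt (metric_coord c (snd (fst a)) (snd a) (snd a))"
  have nc: "continuous_on ?D (\<lambda>a. nabla_coord c (X (fst a)) (snd a) j)" for j
    using continuous_on_nabla_coord_Basis[OF assms, of j] by (simp add: case_prod_beta)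
  have "continuous_on (?D \<times> ?S) ?n"
    by (intro continuous_intros continuous_on_compose2[OF nc]) auto
  moreover have "metric_coord c (snd (fst a)) (snd a) (snd a) \<noteq> 0" if "a \<in> ?D \<times> ?S" for a
  proof -
    have "snd a \<noteq> 0" and "snd (fst a) \<in> snd c ` fst c" using that by auto
    then show ?thesis using inner_form_metric_coord[OF assms(2)] by (force simp: inner_form_def)
  qed
  ultimately have "continuous_on (?D \<times> ?S) ?q"
    by (intro continuous_on_divide continuous_on_metric_coord_compose[OF assms(2)])
      (auto intro!: continuous_intros)
  then have "continuous_on ?D (\<lambda>a. SUP w\<in>?S. ?q (a, w))"
    by (rule continuous_on_SUP_compact) auto
  then show ?thesis
  proof (rule continuous_on_eq)
    fix a assume "a \<in> ?D"
    then obtain s x where a: "a = (s, x)" "s \<in> {0..T}" "x \<in> snd c ` fst c" by auto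
    have Xs: "smooth_vector_field_on A (fst c) (X s)" using X a(2) by (rule smooth_time_slice)
    have "?n (a, w) = nabla_coord c (X s) x w" for w
      using linear_basis_expansion[OF linear_nabla_coord[OF assms(2) Xs a(3)], of w] a(1) by simp
    then show "(SUP w\<in>?S. ?q (a, w)) = (case a of (s, x) \<Rightarrow> nabla_norm g nabla (X s) (chart_inv c x))"
      using nabla_norm_coord[OF assms(2) Xs a(3)] a(1) by simp
  qed
qed

lemma tendsto_nabla_norm:
  assumes "smooth_time_dependent_field A T X"
    and "(f \<longlongrightarrow> s) F" and "(q \<longlongrightarrow> p) F" and "s \<in> {0..T}" and "\<forall>\<^sub>F u in F. f u \<in> {0..T}"
  shows "((\<lambda>u. nabla_norm g nabla (X (f u)) (q u)) \<longlongrightarrow> nabla_norm g nabla (X s) p) F"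
  by (rule tendsto_chartwise[OF continuous_on_nabla_norm[OF assms(1) chart_at_mem] assms(2-5)])

end

section \<open>Integral curves\<close>

lemma vector_derivative_norm_bound:
  fixes f :: "real \<Rightarrow> 'a::real_normed_vector"
  assumes "a \<le> b" and der: "\<And>t. t \<in> {a..b} \<Longrightarrow> (f has_vector_derivative f' t) (at t within {a..b})"
    and le: "\<And>t. t \<in> {a..b} \<Longrightarrow> norm (f' t) \<le> M"
  shows "norm (f b - f a) \<le> M * (b - a)"
proof -
  have "norm (f b - f a) \<le> M * norm (b - a)"
  proof (rule differentiable_bound[where S = "{a..b}" and f' = "\<lambda>t h. h *\<^sub>R f' t"])
    show "(f has_derivative (\<lambda>h. h *\<^sub>R f' t)) (at t within {a..b})" if "t \<in> {a..b}" for t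
      using der[OF that] by (simp add: has_vector_derivative_def)
    show "onorm (\<lambda>h. h *\<^sub>R f' t) \<le> M" if "t \<in> {a..b}" for t
      by (rule onorm_le) (use mult_left_mono[OF le[OF that] abs_ge_zero] in \<open>simp add: mult.commute\<close>)
  qed (use assms(1) in auto)
  then show ?thesis using assms(1) by simp
qed

section \<open>Solutions in charts: confinement and equicontinuity\<close>

context smooth_manifold
begin

text \<open>\<open>integral_curve\<close> without an initial condition: the comparison results
  quantify over all solutions passing near a given one.\<close>

definition solution_curve :: "real \<Rightarrow> (real \<Rightarrow> 'm \<Rightarrow> 'e) \<Rightarrow> (real \<Rightarrow> 'm) \<Rightarrow> bool" where
  "solution_curve T X y \<longleftrightarrow> (\<forall>t\<in>{0..T}. has_velocity A y (X t (y t)) t {0..T})"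

lemma solution_curve_continuous_on: "solution_curve T X y \<Longrightarrow> continuous_on {0..T} y"
  by (simp add: solution_curve_def has_velocity_def continuous_on_eq_continuous_within)

lemma open_chart_preimage: "c \<in> A \<Longrightarrow> open B \<Longrightarrow> open (fst c \<inter> snd c -` B)"
  using continuous_open_preimage[OF continuous_on_chart chart_open] by blast

lemma solution_chart_derivative:
  assumes "solution_curve T X y" and "c \<in> A" and "t \<in> {0..T}" and "y t \<in> fst c"
  shows "((\<lambda>s. snd c (y s)) has_vector_derivative field_coord c (X t) (snd c (y t)))
    (at t within {0..T})"
  using velocity_in_chart[of c y "X t (y t)" t "{0..T}"] assms
  by (simp add: solution_curve_def field_coord_def chart_inv_chart)

text \<open>A curve cannot leave a tube around \<open>x\<close> within a chart if it never touches the boundary of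
  the tube. Hausdorffness enters here: it excludes that the curve leaves the domain of the chart
  through a point that is not separated from the tube.\<close>

lemma chart_confinement:
  fixes a b u :: real
  assumes "c \<in> A" and "a \<le> b" and \<gamma>: "continuous_on {a..b} \<gamma>" and x: "continuous_on {a..b} x"
    and tube: "\<And>u. u \<in> {a..b} \<Longrightarrow> cball (x u) r \<subseteq> snd c ` fst c"
    and start: "\<gamma> a \<in> fst c" "norm (snd c (\<gamma> a) - x a) \<le> r"
    and step: "\<And>u. u \<in> {a..b} \<Longrightarrow>
      (\<And>v. v \<in> {a..u} \<Longrightarrow> \<gamma> v \<in> fst c \<and> norm (snd c (\<gamma> v) - x v) \<le> r) \<Longrightarrow>
      norm (snd c (\<gamma> u) - x u) < r"
    and "u \<in> {a..b}"
  shows "\<gamma> u \<in> fst c \<and> norm (snd c (\<gamma> u) - x u) \<le> r"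
proof -
  \<comment> \<open>The closed tube around x, a continuous image of a compact product. The
    corresponding set on the manifold is compact, hence closed, so staying in the tube is a closed
    condition on u even though \<open>snd c\<close> is meaningless outside the chart.\<close>
  define K where "K = (\<lambda>(u, w). x u + w) ` ({a..b} \<times> cball 0 r)"
  define W where "W = {u \<in> {a..b}. \<gamma> u \<in> fst c \<and> norm (snd c (\<gamma> u) - x u) \<le> r}"
  have x': "continuous_on ({a..b} \<times> cball 0 r) (\<lambda>p. x (fst p))"
    by (rule continuous_on_compose2[OF x continuous_on_fst[OF continuous_on_id]]) auto
  have "compact K"
    unfolding K_def case_prod_beta
    by (intro compact_continuous_image continuous_intros x' compact_Times compact_Icc compact_cball)
  moreover have K: "K \<subseteq> snd c ` fst c"
  proof
    fix z assume "z \<in> K"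
    then obtain u w where "u \<in> {a..b}" "norm w \<le> r" "z = x u + w" by (auto simp: K_def)
    then show "z \<in> snd c ` fst c" using tube[of u] by (auto simp: subset_iff dist_norm)
  qed
  ultimately have "compact (chart_inv c ` K)"
    using continuous_on_subset[OF continuous_on_chart_inv[OF assms(1)]]
    by (intro compact_continuous_image) auto
  then have "closed (chart_inv c ` K)" by (rule compact_imp_closed)
  then have P: "closed ({a..b} \<inter> \<gamma> -` (chart_inv c ` K))"
    by (intro continuous_closed_preimage \<gamma>) auto
  let ?P = "{a..b} \<inter> \<gamma> -` (chart_inv c ` K)"
  have Pc: "\<gamma> u \<in> fst c" if "u \<in> ?P" for u
    using that K chart_inv_mem[OF assms(1)] by auto
  have "continuous_on ?P (\<lambda>u. norm (snd c (\<gamma> u) - x u))"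
    by (intro continuous_intros continuous_on_compose2[OF continuous_on_chart[OF assms(1)]]
        continuous_on_subset[OF \<gamma>] continuous_on_subset[OF x]) (use Pc in blast)+
  then have "closed (?P \<inter> (\<lambda>u. norm (snd c (\<gamma> u) - x u)) -` {..r})"
    using P by (rule continuous_closed_preimage) auto
  also have "?P \<inter> (\<lambda>u. norm (snd c (\<gamma> u) - x u)) -` {..r} = W"
  proof (intro equalityI subsetI)
    fix u assume "u \<in> W"
    then have u: "u \<in> {a..b}" "\<gamma> u \<in> fst c" "norm (snd c (\<gamma> u) - x u) \<le> r" by (auto simp: W_def)
    have "snd c (\<gamma> u) \<in> K"
      unfolding K_def using u by (intro image_eqI[of _ _ "(u, snd c (\<gamma> u) - x u)"]) auto
    then have "\<gamma> u \<in> chart_inv c ` K"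
      using chart_inv_chart[OF assms(1) u(2)] by (metis image_eqI)
    then show "u \<in> ?P \<inter> (\<lambda>u. norm (snd c (\<gamma> u) - x u)) -` {..r}" using u by auto
  next
    fix u assume "u \<in> ?P \<inter> (\<lambda>u. norm (snd c (\<gamma> u) - x u)) -` {..r}"
    then have "u \<in> ?P" and "norm (snd c (\<gamma> u) - x u) \<le> r" by auto
    then show "u \<in> W" using Pc[of u] unfolding W_def by blast
  qed
  finally have "closed W" .
  \<comment> \<open>Continuation: Z collects the times up to which the curve has stayed in the tube.
    The curve is still in the tube at the supremum s because W is closed; there the strict
    inequality from \<open>step\<close> leaves room to go on, so s < b is impossible.\<close>
  define Z where "Z = {u \<in> {a..b}. {a..u} \<subseteq> W}"
  define s where "s = Sup Z"
  have "a \<in> Z" using start assms(2) by (auto simp: Z_def W_def)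
  have bdd: "bdd_above Z" by (rule bdd_aboveI[of _ b]) (auto simp: Z_def)
  have "a \<le> s" unfolding s_def by (rule cSup_upper[OF \<open>a \<in> Z\<close> bdd])
  moreover have "s \<le> b"
    unfolding s_def by (rule cSup_least) (use \<open>a \<in> Z\<close> in blast, simp add: Z_def)
  ultimately have s: "a \<le> s" "s \<le> b" by auto
  have "{a..<s} \<subseteq> W"
  proof
    fix v assume v: "v \<in> {a..<s}"
    then obtain u where "u \<in> Z" "v < u"
      using less_cSup_iff[of Z v] bdd \<open>a \<in> Z\<close> by (auto simp: s_def)
    then show "v \<in> W" using v by (auto simp: Z_def)
  qed
  then have "closure {a..<s} \<subseteq> W" using \<open>closed W\<close> by (simp add: closure_minimal)
  then have sW: "{a..s} \<subseteq> W"
    using s \<open>a \<in> Z\<close> by (cases "a = s") (auto simp: Z_def)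
  have "s = b"
  proof (rule ccontr)
    assume "s \<noteq> b"
    then have "s < b" using s by simp
    have sb: "s \<in> {a..b}" using s by simp
    have lt: "norm (snd c (\<gamma> s) - x s) < r"
      by (rule step[OF sb]) (use sW in \<open>auto simp: W_def\<close>)
    have sc: "\<gamma> s \<in> fst c" using sW s by (auto simp: W_def)
    have lim: "(\<gamma> \<longlongrightarrow> \<gamma> s) (at s within {a..b})" and "(x \<longlongrightarrow> x s) (at s within {a..b})"
      using \<gamma> x sb by (auto simp: continuous_on_def)
    then have "((\<lambda>u. norm (snd c (\<gamma> u) - x u)) \<longlongrightarrow> norm (snd c (\<gamma> s) - x s)) (at s within {a..b})"
      by (intro tendsto_intros tendsto_chart[OF assms(1) sc])
    then have "\<forall>\<^sub>F u in at s within {a..b}. norm (snd c (\<gamma> u) - x u) < r"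
      using lt by (rule order_tendstoD(2))
    moreover have "\<forall>\<^sub>F u in at s within {a..b}. \<gamma> u \<in> fst c"
      using lim chart_open[OF assms(1)] sc by (rule topological_tendstoD)
    ultimately have "\<forall>\<^sub>F u in at s within {a..b}. u \<in> {a..b} \<longrightarrow> u \<in> W"
      by eventually_elim (auto simp: W_def)
    then obtain d where d: "d > 0" "\<And>u. u \<in> {a..b} \<Longrightarrow> u \<noteq> s \<Longrightarrow> dist u s < d \<Longrightarrow> u \<in> W"
      by (auto simp: eventually_at)
    define s' where "s' = min b (s + d / 2)"
    have s': "s < s'" "s' \<le> b" "s' < s + d" using \<open>s < b\<close> d(1) by (auto simp: s'_def min_def)
    have "{a..s'} \<subseteq> W"
    proof
      fix u assume u: "u \<in> {a..s'}"
      show "u \<in> W"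
      proof (cases "u \<le> s")
        case True
        then show ?thesis using sW u by auto
      next
        case False
        then show ?thesis using u s' s by (intro d(2)) (auto simp: dist_real_def)
      qed
    qed
    then have "s' \<in> Z" using s s' by (auto simp: Z_def)
    then have "s' \<le> s" unfolding s_def using bdd by (rule cSup_upper)
    then show False using s' by simp
  qed
  then show ?thesis using sW assms(9) by (auto simp: W_def)
qed

text \<open>In a coordinate ball of radius r the speed of every solution is at most M, so a solution
  within r / 2 of the centre needs a time of at least r / (2 * M) to leave the ball. The bound is
  uniform in the time a and covers b < a as well.\<close>

lemma solution_curves_equicontinuous:
  assumes X: "smooth_time_dependent_field A T X" and "open V" and "p \<in> V"
  obtains U \<delta> where "open U" and "p \<in> U" and "\<delta> > 0"
    and "\<And>y a b. solution_curve T X y \<Longrightarrow> a \<in> {0..T} \<Longrightarrow> b \<in> {0..T} \<Longrightarrow> \<bar>b - a\<bar> < \<delta> \<Longrightarrow>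
      y a \<in> U \<Longrightarrow> y b \<in> V"
proof -
  define c where "c = chart_at A p"
  have c: "c \<in> A" "p \<in> fst c" by (simp_all add: c_def chart_at_mem mem_chart_at)
  let ?x0 = "snd c p"
  have "open (snd c ` (fst c \<inter> V))" using c(1) assms(2) by (rule open_chart_image)
  moreover have "?x0 \<in> snd c ` (fst c \<inter> V)" using c(2) assms(3) by blast
  ultimately obtain r where r: "r > 0" "cball ?x0 r \<subseteq> snd c ` (fst c \<inter> V)"
    using open_contains_cball by blast
  have tube: "cball ?x0 r \<subseteq> snd c ` fst c" using r(2) by blast
  have "compact ((\<lambda>(t, x). field_coord c (X t) x) ` ({0..T} \<times> cball ?x0 r))"
  proof (intro compact_continuous_image compact_Times compact_Icc compact_cball)
    show "continuous_on ({0..T} \<times> cball ?x0 r) (\<lambda>(t, x). field_coord c (X t) x)"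
      by (rule continuous_on_subset[OF continuous_on_field_coord[OF X c(1)]]) (use tube in auto)
  qed
  then obtain M where M: "M > 0"
    "\<And>z. z \<in> (\<lambda>(t, x). field_coord c (X t) x) ` ({0..T} \<times> cball ?x0 r) \<Longrightarrow> norm z \<le> M"
    using compact_imp_bounded bounded_pos by metis
  have bound: "norm (field_coord c (X t) x) \<le> M" if "t \<in> {0..T}" "x \<in> cball ?x0 r" for t x
    by (rule M(2)) (use that in force)
  show ?thesis
  proof (rule that)
    show "open (fst c \<inter> snd c -` ball ?x0 (r / 2))" using c(1) by (rule open_chart_preimage) simp
    show "p \<in> fst c \<inter> snd c -` ball ?x0 (r / 2)" using c(2) r(1) by simp
    show "r / (2 * M) > 0" using r(1) M(1) by simp
  next
    fix y a b
    assume y: "solution_curve T X y" and a: "a \<in> {0..T}" and b: "b \<in> {0..T}"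
      and \<delta>: "\<bar>b - a\<bar> < r / (2 * M)" and ya: "y a \<in> fst c \<inter> snd c -` ball ?x0 (r / 2)"
    \<comment> \<open>The sign \<tau> reverses time when b < a, so that \<gamma> always runs over
      {0..\<bar>b - a\<bar>} and \<open>chart_confinement\<close> applies in both
      directions.\<close>
    define \<tau> where "\<tau> = sgn (b - a)"
    define \<gamma> where "\<gamma> u = y (a + \<tau> * u)" for u
    have mem: "a + \<tau> * u \<in> {0..T}" if "u \<in> {0..\<bar>b - a\<bar>}" for u
      using that a b by (auto simp: \<tau>_def sgn_if)
    have \<tau>1: "\<bar>\<tau>\<bar> \<le> 1" by (simp add: \<tau>_def sgn_if)
    have "\<gamma> \<bar>b - a\<bar> \<in> fst c \<and> norm (snd c (\<gamma> \<bar>b - a\<bar>) - ?x0) \<le> r"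
    proof (rule chart_confinement[OF c(1), where a = 0 and b = "\<bar>b - a\<bar>" and x = "\<lambda>_. ?x0" and r = r])
      show "continuous_on {0..\<bar>b - a\<bar>} \<gamma>"
        unfolding \<gamma>_def
        by (intro continuous_on_compose2[OF solution_curve_continuous_on[OF y]] continuous_intros)
          (use mem in auto)
      show "cball ?x0 r \<subseteq> snd c ` fst c" by (rule tube)
      show "\<gamma> 0 \<in> fst c" and "norm (snd c (\<gamma> 0) - ?x0) \<le> r"
        using ya r(1) by (auto simp: \<gamma>_def dist_norm norm_minus_commute)
    next
      fix u assume u: "u \<in> {0..\<bar>b - a\<bar>}"
        and in_tube: "\<And>v. v \<in> {0..u} \<Longrightarrow> \<gamma> v \<in> fst c \<and> norm (snd c (\<gamma> v) - ?x0) \<le> r"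
      let ?f' = "\<lambda>v. \<tau> *\<^sub>R field_coord c (X (a + \<tau> * v)) (snd c (\<gamma> v))"
      have "norm (snd c (\<gamma> u) - snd c (\<gamma> 0)) \<le> M * (u - 0)"
      proof (rule vector_derivative_norm_bound[where f' = ?f'])
        fix v assume v: "v \<in> {0..u}"
        have v': "v \<in> {0..\<bar>b - a\<bar>}" using v u by auto
        have l: "((\<lambda>v. a + \<tau> * v) has_vector_derivative \<tau>) (at v within {0..u})"
          by (auto intro!: derivative_eq_intros)
        have "((\<lambda>s. snd c (y s)) has_vector_derivative
            field_coord c (X (a + \<tau> * v)) (snd c (y (a + \<tau> * v)))) (at (a + \<tau> * v) within {0..T})"
          by (rule solution_chart_derivative[OF y c(1) mem[OF v']]) (use in_tube[OF v] in \<open>simp add: \<gamma>_def\<close>)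
        then have d: "((\<lambda>s. snd c (y s)) has_vector_derivative
            field_coord c (X (a + \<tau> * v)) (snd c (y (a + \<tau> * v))))
            (at (a + \<tau> * v) within (\<lambda>v. a + \<tau> * v) ` {0..u})"
          by (rule has_vector_derivative_within_subset) (use mem u in auto)
        show "((\<lambda>v. snd c (\<gamma> v)) has_vector_derivative ?f' v) (at v within {0..u})"
          using vector_diff_chain_within[OF l d] by (simp add: o_def \<gamma>_def)
        have "norm (field_coord c (X (a + \<tau> * v)) (snd c (\<gamma> v))) \<le> M"
          using in_tube[OF v] by (intro bound mem[OF v']) (auto simp: dist_norm norm_minus_commute)
        then show "norm (?f' v) \<le> M"
          using mult_mono[OF \<tau>1] by fastforce
      qed (use u in auto)
      also have "M * (u - 0) \<le> M * \<bar>b - a\<bar>" using u M(1) by simp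
      also have "\<dots> < r / 2" using \<delta> M(1) by (simp add: field_simps)
      finally have "norm (snd c (\<gamma> u) - snd c (\<gamma> 0)) < r / 2" .
      moreover have "norm (snd c (\<gamma> 0) - ?x0) < r / 2"
        using ya by (simp add: \<gamma>_def dist_norm norm_minus_commute)
      ultimately show "norm (snd c (\<gamma> u) - ?x0) < r"
        using norm_triangle_lt[of "snd c (\<gamma> u) - snd c (\<gamma> 0)" "snd c (\<gamma> 0) - ?x0" r] by simp
    qed auto
    moreover have "\<gamma> \<bar>b - a\<bar> = y b"
      by (simp add: \<gamma>_def \<tau>_def sgn_mult_abs mult.commute abs_mult_sgn)
    ultimately have yb: "y b \<in> fst c" "snd c (y b) \<in> cball ?x0 r"
      by (auto simp: dist_norm norm_minus_commute)
    then obtain q where "q \<in> fst c \<inter> V" "snd c (y b) = snd c q" using r(2) by blast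
    then show "y b \<in> V" using yb(1) chart_inv_chart[OF c(1)] by (metis IntE)
  qed
qed

end

section \<open>Comparison of integral curves\<close>

context riemannian_manifold
begin

text \<open>To first order at \<open>p\<close> neither quantity depends on the chart, so that estimates obtained in
  different charts can be composed.\<close>

definition local_dist :: "'m \<Rightarrow> 'm \<Rightarrow> real" where
  "local_dist p q = gnorm g p (snd (chart_at A p) q - snd (chart_at A p) p)"

definition chart_dist :: "('m, 'e) chart \<Rightarrow> 'm \<Rightarrow> 'm \<Rightarrow> real" where
  "chart_dist c p q = sqrt (metric_coord c (snd c p) (snd c q - snd c p) (snd c q - snd c p))"

lemma chart_dist_chart_at: "chart_dist (chart_at A p) p q = local_dist p q"
  by (simp add: chart_dist_def local_dist_def tangent_of_coord_chart_at
      flip: gnorm_of_coord[OF chart_at_mem mem_chart_at])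

lemma chart_dist_nonneg: "c \<in> A \<Longrightarrow> p \<in> fst c \<Longrightarrow> 0 \<le> chart_dist c p q"
  unfolding chart_dist_def using inner_form_nonneg[OF inner_form_metric_coord] by simp

lemma local_dist_nonneg: "0 \<le> local_dist p q"
  unfolding local_dist_def by (rule gnorm_nonneg)

text \<open>The Jacobian \<open>?J\<close> of the transition is an isometry between the two
  coordinate forms at p, and the transition differs from its linearization by o(|w|). Exchanging c
  and c' gives the inequality in the other direction.\<close>

lemma chart_dist_le:
  assumes c: "c \<in> A" "p \<in> fst c" and c': "c' \<in> A" "p \<in> fst c'" and "\<epsilon> > 0"
  shows "\<forall>\<^sub>F q in nhds p. chart_dist c' p q \<le> (1 + \<epsilon>) * chart_dist c p q"
proof -
  let ?B = "metric_coord c (snd c p)" and ?B' = "metric_coord c' (snd c' p)"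
  let ?J = "coord_change c c' p" and ?\<psi> = "snd c' \<circ> chart_inv c"
  have form: "inner_form ?B" and form': "inner_form ?B'"
    using c c' by (auto intro: inner_form_metric_coord)
  have J: "sqrt (?B' (?J w) (?J w)) = sqrt (?B w w)" for w
  proof -
    have "of_coord c' p (?J w) = of_coord c p w"
      using c c' unfolding tangent_of_coord_eq
      by (simp add: coord_change_compose chart_at_mem mem_chart_at)
    then show ?thesis using c c' by (metis gnorm_of_coord)
  qed
  obtain k where k: "0 < k" "\<And>v. k * norm v \<le> sqrt (?B v v)"
    by (rule inner_form_norm_comparison[of "{0::real}" "\<lambda>_. ?B"]) (use form in auto)
  obtain K where K: "0 < K" "\<And>v. sqrt (?B' v v) \<le> K * norm v"
    by (rule inner_form_norm_comparison[of "{0::real}" "\<lambda>_. ?B'"]) (use form' in auto)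
  \<comment> \<open>With this tolerance the remainder has norm at most \<epsilon> times that of w: K
    passes from the Euclidean norm to the form in c', and k from the form in c to the Euclidean
    norm.\<close>
  have "\<epsilon> * k / K > 0" using \<open>\<epsilon> > 0\<close> k(1) K(1) by simp
  moreover have "(?\<psi> has_derivative ?J) (at (snd c p))"
    using c c' by (intro transition_has_derivative)
  ultimately obtain d where d: "d > 0" "\<And>z. norm (z - snd c p) < d \<Longrightarrow>
      norm (?\<psi> z - ?\<psi> (snd c p) - ?J (z - snd c p)) \<le> (\<epsilon> * k / K) * norm (z - snd c p)"
    unfolding has_derivative_at_alt by blast
  have "open (fst c \<inter> snd c -` ball (snd c p) d)" using c(1) by (rule open_chart_preimage) simp
  moreover have "p \<in> fst c \<inter> snd c -` ball (snd c p) d" using c(2) d(1) by simp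
  ultimately have "\<forall>\<^sub>F q in nhds p. q \<in> fst c \<inter> snd c -` ball (snd c p) d"
    by (rule eventually_nhds_in_open)
  then show ?thesis
  proof eventually_elim
    case (elim q)
    let ?w = "snd c q - snd c p"
    define e where "e = snd c' q - snd c' p - ?J ?w"
    have "norm e \<le> (\<epsilon> * k / K) * norm ?w"
      using d(2)[of "snd c q"] elim c by (simp add: e_def chart_inv_chart dist_norm norm_minus_commute)
    then have "K * norm e \<le> \<epsilon> * (k * norm ?w)" using K(1) by (simp add: field_simps)
    also have "\<dots> \<le> \<epsilon> * sqrt (?B ?w ?w)" using k(2) \<open>\<epsilon> > 0\<close> by simp
    finally have "sqrt (?B' e e) \<le> \<epsilon> * sqrt (?B ?w ?w)" using K(2)[of e] by linarith
    moreover have "chart_dist c' p q \<le> sqrt (?B' (?J ?w) (?J ?w)) + sqrt (?B' e e)"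
      using inner_form_triangle[OF form', of "?J ?w" e] by (simp add: chart_dist_def e_def)
    ultimately show ?case unfolding J by (simp add: chart_dist_def algebra_simps)
  qed
qed

end

section \<open>Growth of the distance between nearby solutions\<close>

context levi_civita_manifold
begin

lemma continuous_on_nabla_norm_curve:
  assumes "smooth_time_dependent_field A T X" and "continuous_on I x" and "I \<subseteq> {0..T}"
  shows "continuous_on I (\<lambda>t. nabla_norm g nabla (X t) (x t))"
  unfolding continuous_on_def
proof
  fix t assume t: "t \<in> I"
  have "\<forall>\<^sub>F u in at t within I. u \<in> {0..T}"
    using assms(3) by (auto simp: eventually_at_topological intro!: exI[of _ UNIV])
  then show "((\<lambda>u. nabla_norm g nabla (X u) (x u)) \<longlongrightarrow> nabla_norm g nabla (X t) (x t)) (at t within I)"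
    using assms t by (intro tendsto_nabla_norm[OF assms(1)]) (auto simp: continuous_on_def)
qed

lemma nabla_norm_time_nonneg:
  "smooth_time_dependent_field A T X \<Longrightarrow> t \<in> {0..T} \<Longrightarrow> 0 \<le> nabla_norm g nabla (X t) p"
  using nabla_norm_nonneg[OF open_UNIV smooth_time_slice UNIV_I] by blast

text \<open>The estimate of \<open>local_flow_comparison\<close> presupposes that y stays within r
  of x in the chart, and y stays there because of the estimate. \<open>chart_confinement\<close>
  resolves the circle: as long as y is in the closed tube, \<open>est\<close> puts it strictly
  inside.\<close>

lemma flow_comparison_in_chart:
  assumes X: "smooth_time_dependent_field A T X" and x: "solution_curve T X x"
    and c: "c \<in> A" and ab: "0 \<le> a" "a \<le> b" "b \<le> T" and xc: "x ` {a..b} \<subseteq> fst c"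
    and "\<epsilon> > 0" and V: "open V" "x b \<in> V"
  obtains U where "open U" and "x a \<in> U"
    and "\<And>y. solution_curve T X y \<Longrightarrow> y a \<in> U \<Longrightarrow> y b \<in> V \<and>
      chart_dist c (x b) (y b) \<le>
        exp (integral {a..b} (\<lambda>t. nabla_norm g nabla (X t) (x t)) + \<epsilon>) * chart_dist c (x a) (y a)"
proof -
  let ?S = "snd c ` fst c" and ?\<rho> = "\<lambda>t. nabla_norm g nabla (X t) (x t)"
  let ?x = "\<lambda>t. snd c (x t)" and ?G = "metric_coord c"
  let ?E = "\<lambda>u. exp (integral {a..u} ?\<rho> + \<epsilon>)" and ?n = "\<lambda>y u. sqrt (?G (?x u) (snd c (y u) - ?x u) (snd c (y u) - ?x u))"
  have sub: "t \<in> {0..T}" if "t \<in> {a..b}" for t using that ab by auto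
  have xin: "x t \<in> fst c" if "t \<in> {a..b}" for t using xc that by blast
  have chart_der: "((\<lambda>t. snd c (y t)) has_vector_derivative field_coord c (X t) (snd c (y t))) (at t within {a..u})"
    if y: "solution_curve T X y" and "t \<in> {a..u}" "u \<in> {a..b}" "y t \<in> fst c" for y t u
  proof -
    have "t \<in> {a..b}" using that by auto
    from solution_chart_derivative[OF y c sub[OF this] that(4)] show ?thesis
      by (rule has_vector_derivative_within_subset) (use that ab in auto)
  qed
  have x_cont: "continuous_on {a..b} x"
    by (rule continuous_on_subset[OF solution_curve_continuous_on[OF x]]) (use ab in auto)
  then have xh_cont: "continuous_on {a..b} ?x"
    by (rule continuous_on_compose2[OF continuous_on_chart[OF c]]) (rule xc)
  have \<rho>_cont: "continuous_on {a..b} ?\<rho>"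
    by (rule continuous_on_nabla_norm_curve[OF X x_cont]) (use ab in auto)
  have form: "inner_form (?G z)" if "z \<in> ?S" for z using c that by (rule inner_form_metric_coord)
  obtain r where r: "r > 0" "\<And>t. t \<in> {a..b} \<Longrightarrow> cball (?x t) r \<subseteq> ?S"
    and cmp: "\<And>y u. u \<in> {a..b} \<Longrightarrow>
      (\<And>t. t \<in> {a..u} \<Longrightarrow> (y has_vector_derivative field_coord c (X t) (y t)) (at t within {a..u})) \<Longrightarrow>
      (\<And>t. t \<in> {a..u} \<Longrightarrow> norm (y t - ?x t) \<le> r) \<Longrightarrow>
      sqrt (?G (?x u) (y u - ?x u) (y u - ?x u)) \<le>
        ?E u * sqrt (?G (?x a) (y a - ?x a) (y a - ?x a))"
  proof (rule local_flow_comparison[where S = ?S and a = a and b = b and x = ?x and \<rho> = ?\<rho> and G = ?G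
        and \<xi> = "\<lambda>t. field_coord c (X t)"
        and \<xi>' = "\<lambda>t z. frechet_derivative (field_coord c (X t)) (at z)"
        and DG = "\<lambda>z d u v. frechet_derivative (\<lambda>z. ?G z u v) (at z) d"])
    show "open ?S" using c by (rule chart_image_open)
    show "?x t \<in> ?S" if "t \<in> {a..b}" for t using xin[OF that] by blast
    show "(?x has_vector_derivative field_coord c (X t) (?x t)) (at t within {a..b})"
      if "t \<in> {a..b}" for t
      using chart_der[OF x that _ xin[OF that]] ab by auto
    show "(field_coord c (X t) has_derivative frechet_derivative (field_coord c (X t)) (at z)) (at z)"
      if "t \<in> {a..b}" "z \<in> ?S" for t z
      using X c sub[OF that(1)] that(2) by (rule field_coord_has_derivative)
    show "continuous_on ({a..b} \<times> ?S) (\<lambda>(t, z). frechet_derivative (field_coord c (X t)) (at z) v)" for v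
      by (rule continuous_on_subset[OF continuous_on_field_coord_derivative[OF X c]]) (use sub in auto)
    show "((\<lambda>z. ?G z u v) has_derivative frechet_derivative (\<lambda>z. ?G z u v) (at z)) (at z)"
      if "z \<in> ?S" for z u v
      using c that by (rule metric_coord_has_derivative)
    show "frechet_derivative (\<lambda>z. ?G z w w) (at (?x t)) (field_coord c (X t) (?x t)) +
        2 * ?G (?x t) (frechet_derivative (field_coord c (X t)) (at (?x t)) w) w
        \<le> 2 * ?\<rho> t * ?G (?x t) w w" if "t \<in> {a..b}" for t w
      using c smooth_time_slice[OF X sub[OF that]] xin[OF that] by (rule lie_derivative_metric_le)
  qed (use form \<rho>_cont \<open>\<epsilon> > 0\<close> in auto)
  have G_cont: "continuous_on {a..b} (\<lambda>t. ?G (?x t) i j)" for i j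
    by (rule continuous_on_compose2[OF continuous_on_metric_coord[OF c] xh_cont]) (use xin in auto)
  obtain k K where k: "0 < k" "0 < K"
    "\<And>t v. t \<in> {a..b} \<Longrightarrow> k * norm v \<le> sqrt (?G (?x t) v v)"
    "\<And>t v. t \<in> {a..b} \<Longrightarrow> sqrt (?G (?x t) v v) \<le> K * norm v"
    by (rule inner_form_norm_comparison[of "{a..b}" "\<lambda>t. ?G (?x t)"])
      (use form xin G_cont in \<open>blast intro: compact_Icc\<close>)+
  define E where "E = ?E b"
  have E: "E > 0" by (simp add: E_def)
  have E_ge: "?E u \<le> E" if u: "u \<in> {a..b}" for u
  proof -
    have "integral {a..u} ?\<rho> \<le> integral {a..b} ?\<rho>"
      using u sub nabla_norm_time_nonneg[OF X]
      by (intro integral_subset_le integrable_continuous_real \<rho>_cont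
          continuous_on_subset[OF \<rho>_cont]) auto
    then show ?thesis by (simp add: E_def)
  qed
  have "open (snd c ` (fst c \<inter> V))" using c V(1) by (rule open_chart_image)
  moreover have "?x b \<in> snd c ` (fst c \<inter> V)" using xin[of b] ab V(2) by auto
  ultimately obtain r' where r': "r' > 0" "ball (?x b) r' \<subseteq> snd c ` (fst c \<inter> V)"
    using open_contains_ball by blast
  \<comment> \<open>The initial distance is multiplied by at most E, and comparing the metric with
    the Euclidean norm costs K at the start and k at the end. So \<delta> keeps y within r, where
    the estimate is valid, and brings \<open>y b\<close> within r' of \<open>x b\<close>, hence into
    V.\<close>
  define \<delta> where "\<delta> = min r (min r' (k * min r r' / (E * K)))"
  have \<delta>: "\<delta> > 0" "\<delta> \<le> r" "E * (K * \<delta>) \<le> k * min r r'"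
  proof -
    show "\<delta> > 0" using r r' k E by (simp add: \<delta>_def)
    show "\<delta> \<le> r" by (simp add: \<delta>_def)
    have "\<delta> \<le> k * min r r' / (E * K)" by (simp add: \<delta>_def)
    then show "E * (K * \<delta>) \<le> k * min r r'" using k E by (simp add: field_simps)
  qed
  show ?thesis
  proof (rule that)
    show "open (fst c \<inter> snd c -` ball (?x a) \<delta>)" using c by (rule open_chart_preimage) simp
    show "x a \<in> fst c \<inter> snd c -` ball (?x a) \<delta>" using xin[of a] ab \<delta>(1) by simp
  next
    fix y assume y: "solution_curve T X y" and ya: "y a \<in> fst c \<inter> snd c -` ball (?x a) \<delta>"
    have est: "?n y u \<le> ?E u * chart_dist c (x a) (y a) \<and>
        norm (snd c (y u) - ?x u) < min r r'"
      if u: "u \<in> {a..b}" and "\<And>v. v \<in> {a..u} \<Longrightarrow> y v \<in> fst c \<and> norm (snd c (y v) - ?x v) \<le> r" for u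
    proof
      show 1: "?n y u \<le> ?E u * chart_dist c (x a) (y a)"
        unfolding chart_dist_def
        by (rule cmp[OF u, where y = "\<lambda>t. snd c (y t)"]) (use that chart_der[OF y] in auto)
      have "k * norm (snd c (y u) - ?x u) \<le> ?E u * chart_dist c (x a) (y a)"
        using k(3)[OF u, of "snd c (y u) - ?x u"] 1 by linarith
      also have "\<dots> \<le> E * chart_dist c (x a) (y a)"
        using E_ge[OF u] chart_dist_nonneg[OF c xin] ab by (intro mult_right_mono) auto
      also have "\<dots> \<le> E * (K * norm (snd c (y a) - ?x a))"
        unfolding chart_dist_def using E k(4)[of a] ab by (intro mult_left_mono) auto
      also have "\<dots> < E * (K * \<delta>)"
        using ya E k(2) by (simp add: dist_norm norm_minus_commute)
      also have "\<dots> \<le> k * min r r'" by (rule \<delta>(3))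
      finally show "norm (snd c (y u) - ?x u) < min r r'" using k(1) by simp
    qed
    have conf: "y u \<in> fst c \<and> norm (snd c (y u) - ?x u) \<le> r" if "u \<in> {a..b}" for u
    proof (rule chart_confinement[OF c ab(2) _ xh_cont r(2)])
      show "continuous_on {a..b} y"
        by (rule continuous_on_subset[OF solution_curve_continuous_on[OF y]]) (use ab in auto)
      show "y a \<in> fst c" and "norm (snd c (y a) - ?x a) \<le> r"
        using ya \<delta>(2) by (auto simp: dist_norm norm_minus_commute)
      show "norm (snd c (y u) - ?x u) < r"
        if "u \<in> {a..b}" and "\<And>v. v \<in> {a..u} \<Longrightarrow> y v \<in> fst c \<and> norm (snd c (y v) - ?x v) \<le> r" for u
        using est[OF that] by simp
    qed (use that in auto)
    have b: "b \<in> {a..b}" using ab by simp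
    have final: "?n y b \<le> ?E b * chart_dist c (x a) (y a) \<and>
        norm (snd c (y b) - ?x b) < min r r'"
      by (rule est[OF b]) (rule conf)
    then have "snd c (y b) \<in> ball (?x b) r'" by (simp add: dist_norm norm_minus_commute)
    then obtain q where q: "q \<in> fst c" "q \<in> V" "snd c (y b) = snd c q" using r'(2) by blast
    have "y b = chart_inv c (snd c (y b))" using conf[OF b] chart_inv_chart[OF c] by simp
    also have "\<dots> = q" using q chart_inv_chart[OF c] by simp
    finally have "y b \<in> V" using q(2) by simp
    then show "y b \<in> V \<and> chart_dist c (x b) (y b) \<le>
        ?E b * chart_dist c (x a) (y a)"
      using final by (simp add: chart_dist_def)
  qed
qed

text \<open>The property P is quantified over all \<epsilon> and V so that it composes: the
  neighbourhood U1 obtained for the later interval is the target for the earlier one, and each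
  interval gets \<epsilon> / 2. Estimates from different charts meet at a common end point because
  both are expressed by \<open>local_dist\<close>.\<close>

lemma flow_comparison:
  assumes X: "smooth_time_dependent_field A T X" and x: "solution_curve T X x"
    and st: "0 \<le> s" "s \<le> t" "t \<le> T" and "\<epsilon> > 0" and "open V" and "x t \<in> V"
  obtains U where "open U" and "x s \<in> U"
    and "\<And>y. solution_curve T X y \<Longrightarrow> y s \<in> U \<Longrightarrow> y t \<in> V \<and>
      local_dist (x t) (y t) \<le>
        exp (integral {s..t} (\<lambda>t. nabla_norm g nabla (X t) (x t)) + \<epsilon>) * local_dist (x s) (y s)"
proof -
  let ?\<rho> = "\<lambda>t. nabla_norm g nabla (X t) (x t)" and ?d = "\<lambda>y u. local_dist (x u) (y u)"
  let ?E = "\<lambda>a b e. exp (integral {a..b} ?\<rho> + e)"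
  define Q where "Q a b \<epsilon> V U \<longleftrightarrow> open U \<and> x a \<in> U \<and>
    (\<forall>y. solution_curve T X y \<longrightarrow> y a \<in> U \<longrightarrow> y b \<in> V \<and>
      ?d y b \<le> ?E a b \<epsilon> * ?d y a)"
    for a b \<epsilon> V U
  \<comment> \<open>The guard keeps the intervals inside {0..T}, since the local clause of Bolzano's
    principle also yields intervals that reach beyond {s..t}.\<close>
  define P where "P a b \<longleftrightarrow> (0 \<le> a \<and> b \<le> T \<longrightarrow>
    (\<forall>\<epsilon>>0. \<forall>V. open V \<longrightarrow> x b \<in> V \<longrightarrow> (\<exists>U. Q a b \<epsilon> V U)))" for a b
  have \<rho>_int: "?\<rho> integrable_on {a..b}" if "0 \<le> a" "b \<le> T" for a b
    by (intro integrable_continuous_real continuous_on_nabla_norm_curve[OF X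
          continuous_on_subset[OF solution_curve_continuous_on[OF x]]]) (use that in auto)
  from st(2) have "P s t"
  proof (induction rule: Bolzano)
    case (trans a b c)
    show ?case
      unfolding P_def
    proof (intro impI allI)
      fix \<epsilon> :: real and V assume "0 \<le> a \<and> c \<le> T" and \<epsilon>: "\<epsilon> > 0" and V: "open V" "x c \<in> V"
      then have b: "b \<le> T" "0 \<le> b" and ac: "0 \<le> a" "c \<le> T" using trans(3,4) by auto
      have \<epsilon>2: "\<epsilon> / 2 > 0" using \<epsilon> by simp
      obtain U1 where U1: "Q b c (\<epsilon> / 2) V U1"
        using trans(2) b ac \<epsilon>2 V unfolding P_def by blast
      then have "open U1" "x b \<in> U1" by (auto simp: Q_def)
      then obtain U2 where U2: "Q a b (\<epsilon> / 2) U1 U2"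
        using trans(1) b ac \<epsilon>2 unfolding P_def by blast
      have "Q a c \<epsilon> V U2"
        unfolding Q_def
      proof (intro conjI allI impI)
        show "open U2" "x a \<in> U2" using U2 by (auto simp: Q_def)
        fix y assume y: "solution_curve T X y" "y a \<in> U2"
        then have yb: "y b \<in> U1" and 1: "?d y b \<le>
            ?E a b (\<epsilon> / 2) * ?d y a"
          using U2 by (auto simp: Q_def)
        then show "y c \<in> V" using U1 y(1) by (auto simp: Q_def)
        have "?d y c \<le> ?E b c (\<epsilon> / 2) * ?d y b"
          using U1 y(1) yb by (auto simp: Q_def)
        also have "\<dots> \<le> ?E b c (\<epsilon> / 2) *
            (?E a b (\<epsilon> / 2) * ?d y a)"
          using 1 by (intro mult_left_mono) auto
        also have "\<dots> = exp ((integral {a..b} ?\<rho> + integral {b..c} ?\<rho>) + \<epsilon>) * ?d y a"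
          by (simp add: mult_ac flip: exp_add)
        also have "integral {a..b} ?\<rho> + integral {b..c} ?\<rho> = integral {a..c} ?\<rho>"
          using trans(3,4) \<rho>_int[OF ac] by (intro Henstock_Kurzweil_Integration.integral_combine) auto
        finally show "?d y c \<le> ?E a c \<epsilon> * ?d y a" .
      qed
      then show "\<exists>U. Q a c \<epsilon> V U" by blast
    qed
  next
    case (local \<tau>)
    let ?c = "chart_at A (x \<tau>)"
    let ?C = "\<lambda>y u. chart_dist ?c (x u) (y u)"
    have "\<tau> \<in> {0..T}" using local st by auto
    then have "(x \<longlongrightarrow> x \<tau>) (at \<tau> within {0..T})"
      using solution_curve_continuous_on[OF x] by (auto simp: continuous_on_def)
    then have "\<forall>\<^sub>F u in at \<tau> within {0..T}. x u \<in> fst ?c"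
      using chart_open[OF chart_at_mem] mem_chart_at by (rule topological_tendstoD)
    then obtain d where d: "d > 0" "\<And>u. u \<in> {0..T} \<Longrightarrow> u \<noteq> \<tau> \<Longrightarrow> dist u \<tau> < d \<Longrightarrow> x u \<in> fst ?c"
      by (auto simp: eventually_at)
    have "P a b" if ab: "a \<le> \<tau>" "\<tau> \<le> b" "b - a < d" for a b
      unfolding P_def
    proof (intro impI allI)
      fix \<epsilon> :: real and V assume ab': "0 \<le> a \<and> b \<le> T" and \<epsilon>: "\<epsilon> > 0" and V: "open V" "x b \<in> V"
      have xin: "x u \<in> fst ?c" if "u \<in> {a..b}" for u
        using that ab ab' d(2)[of u] mem_chart_at by (cases "u = \<tau>") (auto simp: dist_real_def)
      have xa: "x a \<in> fst ?c" and xb: "x b \<in> fst ?c" using ab by (auto intro: xin)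
      \<comment> \<open>Budget: \<epsilon> / 2 for the comparison in the chart \<open>?c\<close>,
        and \<epsilon> / 4 at each end for passing between \<open>local_dist\<close> and
        \<open>?c\<close>, where 1 + \<epsilon> / 4 \<le> exp (\<epsilon> / 4).\<close>
      have \<epsilon>4: "\<epsilon> / 4 > 0" "\<epsilon> / 2 > 0" using \<epsilon> by auto
      obtain Vb where Vb: "open Vb" "x b \<in> Vb"
        "\<And>q. q \<in> Vb \<Longrightarrow> local_dist (x b) q \<le> (1 + \<epsilon> / 4) * chart_dist ?c (x b) q"
        using chart_dist_le[OF chart_at_mem xb chart_at_mem mem_chart_at \<epsilon>4(1)]
        by (auto simp: eventually_nhds chart_dist_chart_at)
      obtain Va where Va: "open Va" "x a \<in> Va"
        "\<And>q. q \<in> Va \<Longrightarrow> chart_dist ?c (x a) q \<le> (1 + \<epsilon> / 4) * local_dist (x a) q"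
        using chart_dist_le[OF chart_at_mem mem_chart_at chart_at_mem xa \<epsilon>4(1)]
        by (auto simp: eventually_nhds chart_dist_chart_at)
      have a0: "0 \<le> a" "a \<le> b" "b \<le> T" using ab ab' by auto
      have "x ` {a..b} \<subseteq> fst ?c" using xin by blast
      from flow_comparison_in_chart[OF X x chart_at_mem a0 this \<epsilon>4(2), of "V \<inter> Vb"]
      obtain U where U: "open U" "x a \<in> U"
        "\<And>y. solution_curve T X y \<Longrightarrow> y a \<in> U \<Longrightarrow> y b \<in> V \<inter> Vb \<and>
          ?C y b \<le> ?E a b (\<epsilon> / 2) * ?C y a"
        using V Vb(1,2) by blast
      have "Q a b \<epsilon> V (U \<inter> Va)"
        unfolding Q_def
      proof (intro conjI allI impI)
        show "open (U \<inter> Va)" "x a \<in> U \<inter> Va" using U Va by auto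
        fix y assume y: "solution_curve T X y" "y a \<in> U \<inter> Va"
        note Uy = U(3)[OF y(1)]
        show "y b \<in> V" using Uy y(2) by auto
        have "y b \<in> Vb" using Uy y(2) by auto
        then have "?d y b \<le> (1 + \<epsilon> / 4) * ?C y b"
          by (rule Vb(3))
        also have "\<dots> \<le> (1 + \<epsilon> / 4) * (?E a b (\<epsilon> / 2) * ?C y a)"
          using Uy y(2) \<epsilon> by (intro mult_left_mono) auto
        also have "\<dots> \<le> (1 + \<epsilon> / 4) * (?E a b (\<epsilon> / 2) *
            ((1 + \<epsilon> / 4) * ?d y a))"
          using Va(3)[of "y a"] y(2) \<epsilon> by (intro mult_left_mono) auto
        also have "\<dots> = (1 + \<epsilon> / 4) * (1 + \<epsilon> / 4) *
            (?E a b (\<epsilon> / 2) * ?d y a)"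
          by (simp add: mult_ac)
        also have "\<dots> \<le> exp (\<epsilon> / 4) * exp (\<epsilon> / 4) *
            (?E a b (\<epsilon> / 2) * ?d y a)"
          using exp_ge_add_one_self[of "\<epsilon> / 4"] \<epsilon> local_dist_nonneg
          by (intro mult_right_mono mult_mono) auto
        also have "\<dots> = ?E a b \<epsilon> * ?d y a"
          by (simp add: mult_ac flip: exp_add mult.assoc)
        finally show "?d y b \<le> ?E a b \<epsilon> * ?d y a" .
      qed
      then show "\<exists>U. Q a b \<epsilon> V U" by blast
    qed
    then show ?case using d(1) by blast
  qed
  then obtain U where "Q s t \<epsilon> V U" using assms(3,5-8) unfolding P_def by blast
  then show ?thesis using that[of U] by (simp add: Q_def)
qed

end

section \<open>One-parameter families of integral curves\<close>

text \<open>In the paper's notation, \<open>F \<sigma> s\<close> is the image of \<open>z s\<close> under the flow of \<open>X\<close> from time \<open>s\<close>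
  to time \<open>\<sigma>\<close>; the comparison of \<open>X\<close> and \<open>Y\<close> uses the integral curve \<open>z\<close> of \<open>Z = Y\<close>.\<close>

locale solution_family = levi_civita_manifold A g nabla
  for A :: "('m::t2_space, 'e::euclidean_space) chart set" and g and nabla +
  fixes T :: real and X Z :: "real \<Rightarrow> 'm \<Rightarrow> 'e" and z :: "real \<Rightarrow> 'm" and F :: "real \<Rightarrow> real \<Rightarrow> 'm"
  assumes X_smooth: "smooth_time_dependent_field A T X"
    and Z_smooth: "smooth_time_dependent_field A T Z"
    and z_solution: "solution_curve T Z z"
    and F_solution: "s \<in> {0..T} \<Longrightarrow> solution_curve T X (\<lambda>\<sigma>. F \<sigma> s)"
    and F_diagonal: "s \<in> {0..T} \<Longrightarrow> F s s = z s"
begin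

abbreviation relative_speed :: "real \<Rightarrow> real" where
  "relative_speed s \<equiv> gnorm g (z s) (Z s (z s) - X s (z s))"

abbreviation growth_exponent :: "real \<Rightarrow> real \<Rightarrow> real" where
  "growth_exponent t s \<equiv> integral {s..t} (\<lambda>\<sigma>. nabla_norm g nabla (X \<sigma>) (F \<sigma> s))"

text \<open>Continuous dependence on initial values, in three moves along solutions: from time f u
  to s, from s to \<sigma>, and from \<sigma> to h u. The outer moves are
  \<open>solution_curves_equicontinuous\<close>; the middle one uses the neighbourhoods supplied by
  \<open>flow_comparison\<close>, where any \<epsilon> will do and 1 is taken.\<close>

lemma family_tendsto:
  assumes "0 \<le> s" and "s \<le> \<sigma>" and "\<sigma> \<le> T" and f: "(f \<longlongrightarrow> s) G" and h: "(h \<longlongrightarrow> \<sigma>) G"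
    and fT: "\<forall>\<^sub>F u in G. f u \<in> {0..T}" and hT: "\<forall>\<^sub>F u in G. h u \<in> {0..T}"
  shows "((\<lambda>u. F (h u) (f u)) \<longlongrightarrow> F \<sigma> s) G"
proof (rule topological_tendstoI)
  fix V assume V: "open V" "F \<sigma> s \<in> V"
  have s: "s \<in> {0..T}" and \<sigma>: "\<sigma> \<in> {0..T}" using assms by auto
  obtain U1 \<delta>1 where U1: "open U1" "F \<sigma> s \<in> U1" "\<delta>1 > 0"
    "\<And>y a b. solution_curve T X y \<Longrightarrow> a \<in> {0..T} \<Longrightarrow> b \<in> {0..T} \<Longrightarrow> \<bar>b - a\<bar> < \<delta>1 \<Longrightarrow> y a \<in> U1 \<Longrightarrow> y b \<in> V"
    by (fact solution_curves_equicontinuous[OF X_smooth V])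
  obtain U2 where U2: "open U2" "F s s \<in> U2"
    "\<And>y. solution_curve T X y \<Longrightarrow> y s \<in> U2 \<Longrightarrow> y \<sigma> \<in> U1 \<and>
      local_dist (F \<sigma> s) (y \<sigma>) \<le>
        exp (integral {s..\<sigma>} (\<lambda>t. nabla_norm g nabla (X t) (F t s)) + 1) * local_dist (F s s) (y s)"
    by (fact flow_comparison[OF X_smooth F_solution[OF s] assms(1-3) zero_less_one U1(1,2)])
  obtain U3 \<delta>3 where U3: "open U3" "F s s \<in> U3" "\<delta>3 > 0"
    "\<And>y a b. solution_curve T X y \<Longrightarrow> a \<in> {0..T} \<Longrightarrow> b \<in> {0..T} \<Longrightarrow> \<bar>b - a\<bar> < \<delta>3 \<Longrightarrow> y a \<in> U3 \<Longrightarrow> y b \<in> U2"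
    by (fact solution_curves_equicontinuous[OF X_smooth U2(1,2)])
  have "((\<lambda>u. z (f u)) \<longlongrightarrow> z s) G"
    using solution_curve_continuous_on[OF z_solution] f s fT by (rule continuous_on_tendsto_compose)
  then have 1: "\<forall>\<^sub>F u in G. z (f u) \<in> U3"
    using U3(1,2) F_diagonal[OF s] by (auto intro: topological_tendstoD)
  have 2: "\<forall>\<^sub>F u in G. \<bar>f u - s\<bar> < \<delta>3" and 3: "\<forall>\<^sub>F u in G. \<bar>h u - \<sigma>\<bar> < \<delta>1"
    using f h U1(3) U3(3) by (auto simp: tendsto_iff dist_real_def)
  show "\<forall>\<^sub>F u in G. F (h u) (f u) \<in> V"
    using 1 2 3 fT hT
  proof eventually_elim
    case (elim u)
    note sol = F_solution[OF elim(4)]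
    have "F (f u) (f u) \<in> U3" using F_diagonal[OF elim(4)] elim(1) by simp
    then have "F s (f u) \<in> U2" using U3(4)[OF sol elim(4) s] elim(2) by (simp add: abs_minus_commute)
    then have "F \<sigma> (f u) \<in> U1" using U2(3)[OF sol] by blast
    then show "F (h u) (f u) \<in> V" using U1(4)[OF sol \<sigma> elim(5)] elim(3) by simp
  qed
qed

text \<open>To first order z s' is z s + (s' - s) Z, and following X from time s' back to s adds -
  (s' - s) X. Hence F s s' is displaced from z s by (s' - s) (Z - X).\<close>

lemma initial_rate:
  assumes s: "s \<in> {0..T}" and "\<epsilon> > 0"
  shows "\<forall>\<^sub>F s' in at s within {0..T}.
    local_dist (z s) (F s s') \<le> (relative_speed s + \<epsilon>) * \<bar>s' - s\<bar>"
proof -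
  define c where "c = chart_at A (z s)"
  have c: "c \<in> A" "z s \<in> fst c" by (simp_all add: c_def chart_at_mem mem_chart_at)
  define v where "v = Z s (z s)"
  define w where "w = X s (z s)"
  obtain K where K: "0 < K" "\<And>u. sqrt (g (z s) u u) \<le> K * norm u"
    by (rule inner_form_norm_comparison[of "{0::real}" "\<lambda>_. g (z s)"]) (use inner_form_metric in auto)
  \<comment> \<open>Two Euclidean errors of size \<eta> * \<bar>s' - s\<bar> arise, one from z and
    one from the solution of X; K turns them into g-norms.\<close>
  define \<eta> where "\<eta> = \<epsilon> / (2 * K)"
  have \<eta>: "\<eta> > 0" "K * (2 * \<eta>) = \<epsilon>" using K(1) \<open>\<epsilon> > 0\<close> by (auto simp: \<eta>_def)
  let ?\<xi> = "\<lambda>(t, x). field_coord c (X t) x"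
  have \<xi>0: "?\<xi> (s, snd c (z s)) = w"
    using c by (simp add: field_coord_def chart_inv_chart w_def) (simp add: c_def tangent_coord_chart_at)
  have "continuous (at (s, snd c (z s)) within {0..T} \<times> snd c ` fst c) ?\<xi>"
    using continuous_on_field_coord[OF X_smooth c(1)] s c(2)
    by (auto simp: continuous_on_eq_continuous_within)
  then obtain d where d: "d > 0" "\<And>a. a \<in> {0..T} \<times> snd c ` fst c \<Longrightarrow>
      dist a (s, snd c (z s)) < d \<Longrightarrow> dist (?\<xi> a) w < \<eta>"
    using \<eta>(1) \<xi>0 unfolding continuous_within_eps_delta by metis
  define V where "V = fst c \<inter> snd c -` ball (snd c (z s)) (d / 2)"
  have V: "open V" "z s \<in> V"
    using open_chart_preimage[OF c(1)] c(2) d(1) by (auto simp: V_def)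
  have \<xi>_close: "norm (field_coord c (X \<tau>) (snd c q) - w) \<le> \<eta>"
    if "\<tau> \<in> {0..T}" "\<bar>\<tau> - s\<bar> < d / 2" "q \<in> V" for \<tau> q
  proof -
    have "dist (\<tau>, snd c q) (s, snd c (z s)) \<le> dist \<tau> s + dist (snd c q) (snd c (z s))"
      by (simp add: dist_Pair_Pair sqrt_sum_squares_le_sum)
    also have "\<dots> < d" using that by (auto simp: V_def dist_real_def dist_commute)
    finally show ?thesis
      using d(2)[of "(\<tau>, snd c q)"] that by (auto simp: V_def dist_norm)
  qed
  obtain U \<delta> where U: "open U" "z s \<in> U" "\<delta> > 0"
    "\<And>y a b. solution_curve T X y \<Longrightarrow> a \<in> {0..T} \<Longrightarrow> b \<in> {0..T} \<Longrightarrow> \<bar>b - a\<bar> < \<delta> \<Longrightarrow> y a \<in> U \<Longrightarrow> y b \<in> V"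
    by (fact solution_curves_equicontinuous[OF X_smooth V])
  have "(z \<longlongrightarrow> z s) (at s within {0..T})"
    using solution_curve_continuous_on[OF z_solution] s by (auto simp: continuous_on_def)
  then have 1: "\<forall>\<^sub>F s' in at s within {0..T}. z s' \<in> U"
    using U(1,2) by (rule topological_tendstoD)
  have 2: "\<forall>\<^sub>F s' in at s within {0..T}. s' \<in> {0..T} \<and> \<bar>s' - s\<bar> < min \<delta> (d / 2)"
    unfolding eventually_at using U(3) d(1)
    by (intro exI[of _ "min \<delta> (d / 2)"]) (auto simp: dist_real_def)
  have "((\<lambda>u. snd c (z u)) has_derivative (\<lambda>h. h *\<^sub>R v)) (at s within {0..T})"
    using z_solution s
    by (simp add: solution_curve_def has_velocity_def c_def v_def has_vector_derivative_def)
  then obtain d' where d': "d' > 0" "\<And>s'. s' \<in> {0..T} \<Longrightarrow> norm (s' - s) < d' \<Longrightarrow>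
      norm (snd c (z s') - snd c (z s) - (s' - s) *\<^sub>R v) \<le> \<eta> * norm (s' - s)"
    using \<eta>(1) unfolding has_derivative_within_alt by blast
  have 3: "\<forall>\<^sub>F s' in at s within {0..T}. \<bar>s' - s\<bar> < d'"
    unfolding eventually_at using d'(1) by (intro exI[of _ d']) (auto simp: dist_real_def)
  show ?thesis
    using 1 2 3
  proof eventually_elim
    case (elim s')
    then have s': "s' \<in> {0..T}" and near: "\<bar>s' - s\<bar> < \<delta>" "\<bar>s' - s\<bar> < d / 2" by auto
    note sol = F_solution[OF s']
    let ?a = "min s s'" and ?b = "max s s'"
    \<comment> \<open>Subtracting the uniform motion with velocity w leaves a curve of speed at most
      \<eta>: between s and s' the solution stays in V, where the field is within \<eta> of
      w.\<close>
    let ?k = "\<lambda>\<tau>. snd c (F \<tau> s') - \<tau> *\<^sub>R w"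
    have "norm (?k ?b - ?k ?a) \<le> \<eta> * (?b - ?a)"
    proof (rule vector_derivative_norm_bound[where f' = "\<lambda>\<tau>. field_coord c (X \<tau>) (snd c (F \<tau> s')) - w"])
      fix \<tau> assume \<tau>: "\<tau> \<in> {?a..?b}"
      have \<tau>T: "\<tau> \<in> {0..T}" using \<tau> s s' by auto
      have between: "\<bar>\<tau> - s\<bar> \<le> \<bar>s' - s\<bar>" "\<bar>\<tau> - s'\<bar> \<le> \<bar>s' - s\<bar>"
        using \<tau> by (auto simp: min_def max_def split: if_splits)
      have FV: "F \<tau> s' \<in> V"
        by (rule U(4)[OF sol s' \<tau>T]) (use between near elim(1) F_diagonal[OF s'] in auto)
      then have "F \<tau> s' \<in> fst c" by (simp add: V_def)
      from solution_chart_derivative[OF sol c(1) \<tau>T this]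
      have "((\<lambda>\<tau>. snd c (F \<tau> s')) has_vector_derivative field_coord c (X \<tau>) (snd c (F \<tau> s'))) (at \<tau> within {?a..?b})"
        by (rule has_vector_derivative_within_subset) (use s s' in auto)
      moreover have "((\<lambda>\<tau>. \<tau> *\<^sub>R w) has_vector_derivative w) (at \<tau> within {?a..?b})"
        by (auto intro!: derivative_eq_intros)
      ultimately show "(?k has_vector_derivative field_coord c (X \<tau>) (snd c (F \<tau> s')) - w) (at \<tau> within {?a..?b})"
        by (rule has_vector_derivative_diff)
      show "norm (field_coord c (X \<tau>) (snd c (F \<tau> s')) - w) \<le> \<eta>"
        by (rule \<xi>_close[OF \<tau>T _ FV]) (use between near in auto)
    qed simp
    then have k: "norm (?k s - ?k s') \<le> \<eta> * \<bar>s' - s\<bar>"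
      by (cases "s \<le> s'") (auto simp: min_def max_def norm_minus_commute)
    define e where "e = (?k s - ?k s') + (snd c (z s') - snd c (z s) - (s' - s) *\<^sub>R v)"
    have "norm e \<le> \<eta> * \<bar>s' - s\<bar> + \<eta> * \<bar>s' - s\<bar>"
      unfolding e_def using k d'(2)[OF s'] elim(3) by (intro norm_triangle_mono) auto
    then have "K * norm e \<le> K * (2 * \<eta> * \<bar>s' - s\<bar>)"
      using K(1) by (intro mult_left_mono) auto
    also have "\<dots> = K * (2 * \<eta>) * \<bar>s' - s\<bar>" by simp
    finally have "K * norm e \<le> \<epsilon> * \<bar>s' - s\<bar>" unfolding \<eta>(2) .
    then have e: "gnorm g (z s) e \<le> \<epsilon> * \<bar>s' - s\<bar>"
      using K(2)[of e] by (simp add: gnorm_def)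
    have "snd c (F s s') - snd c (z s) = (s' - s) *\<^sub>R (v - w) + e"
      by (simp add: e_def F_diagonal[OF s'] algebra_simps)
    then have "local_dist (z s) (F s s') = gnorm g (z s) ((s' - s) *\<^sub>R (v - w) + e)"
      by (simp add: local_dist_def c_def)
    also have "\<dots> \<le> \<bar>s' - s\<bar> * gnorm g (z s) (v - w) + \<epsilon> * \<bar>s' - s\<bar>"
      using gnorm_triangle[of "z s" "(s' - s) *\<^sub>R (v - w)" e] e by (simp add: gnorm_scaleR)
    finally show ?case by (simp add: v_def w_def algebra_simps)
  qed
qed

lemma continuous_on_speed_bound:
  assumes "t \<le> T"
  shows "continuous_on {0..t} relative_speed"
  unfolding continuous_on_def
proof
  fix s assume s: "s \<in> {0..t}"
  have "\<forall>\<^sub>F u in at s within {0..t}. u \<in> {0..T}"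
    using assms by (auto simp: eventually_at_topological intro!: exI[of _ UNIV])
  moreover have "(z \<longlongrightarrow> z s) (at s within {0..t})"
    using continuous_on_subset[OF solution_curve_continuous_on[OF z_solution], of "{0..t}"] assms s
    by (auto simp: continuous_on_def)
  ultimately show "(relative_speed \<longlongrightarrow> relative_speed s)
      (at s within {0..t})"
    using s assms by (intro tendsto_gnorm_diff[OF X_smooth Z_smooth]) auto
qed

text \<open>The lower limit s varies together with the integrand, and \<open>family_tendsto\<close>
  controls F \<sigma> s only for s \<le> \<sigma>. Replacing \<sigma> by max \<sigma> s gives a
  jointly continuous integrand on a fixed square. On {0..s} it is constant in \<sigma>, so the
  surplus is s times its value at time s and point z s.\<close>

lemma continuous_on_nabla_norm_integral:
  assumes "0 \<le> t" and "t \<le> T"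
  shows "continuous_on {0..t} (growth_exponent t)"
proof -
  define \<rho> where "\<rho> s \<sigma> = nabla_norm g nabla (X (max \<sigma> s)) (F (max \<sigma> s) s)" for s \<sigma>
  have \<rho>: "continuous_on ({0..t} \<times> cbox 0 t) (\<lambda>(s, \<sigma>). \<rho> s \<sigma>)"
    unfolding continuous_on_def
  proof
    fix a assume "a \<in> {0..t} \<times> cbox 0 t"
    then obtain s \<sigma> where a: "a = (s, \<sigma>)" "s \<in> {0..t}" "\<sigma> \<in> {0..t}" by auto
    let ?G = "at a within {0..t} \<times> cbox 0 t"
    have "\<forall>\<^sub>F u in ?G. u \<in> {0..t} \<times> cbox 0 t"
      by (auto simp: eventually_at_topological)
    then have 1: "\<forall>\<^sub>F u in ?G. fst u \<in> {0..T}" and 2: "\<forall>\<^sub>F u in ?G. max (snd u) (fst u) \<in> {0..T}"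
      using assms by (auto elim!: eventually_mono)
    have f: "(fst \<longlongrightarrow> s) ?G" and h: "((\<lambda>u. max (snd u) (fst u)) \<longlongrightarrow> max \<sigma> s) ?G"
      by (auto simp: a(1) intro!: tendsto_eq_intros)
    have "((\<lambda>u. F (max (snd u) (fst u)) (fst u)) \<longlongrightarrow> F (max \<sigma> s) s) ?G"
      by (rule family_tendsto[OF _ _ _ f h 1 2]) (use a assms in auto)
    then have "((\<lambda>u. nabla_norm g nabla (X (max (snd u) (fst u))) (F (max (snd u) (fst u)) (fst u))) \<longlongrightarrow>
        nabla_norm g nabla (X (max \<sigma> s)) (F (max \<sigma> s) s)) ?G"
      by (rule tendsto_nabla_norm[OF X_smooth h _ _ 2]) (use a assms in auto)
    then show "((\<lambda>(s, \<sigma>). \<rho> s \<sigma>) \<longlongrightarrow> (case a of (s, \<sigma>) \<Rightarrow> \<rho> s \<sigma>)) ?G"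
      unfolding case_prod_unfold \<rho>_def a(1) by simp
  qed
  have "continuous_on {0..t} (\<lambda>s. nabla_norm g nabla (X s) (z s))"
    by (rule continuous_on_nabla_norm_curve[OF X_smooth
          continuous_on_subset[OF solution_curve_continuous_on[OF z_solution]]]) (use assms in auto)
  then have "continuous_on {0..t} (\<lambda>s. integral (cbox 0 t) (\<rho> s) - s * nabla_norm g nabla (X s) (z s))"
    by (intro continuous_intros integral_continuous_on_param[OF \<rho>])
  then show ?thesis
  proof (rule continuous_on_eq)
    fix s assume s: "s \<in> {0..t}"
    have c: "continuous_on {0..t} (\<rho> s)"
    proof -
      have "continuous_on {0..t} (\<lambda>\<sigma>. (s, \<sigma>))" by (intro continuous_intros)
      then have "continuous_on {0..t} (\<lambda>\<sigma>. case (s, \<sigma>) of (s, \<sigma>) \<Rightarrow> \<rho> s \<sigma>)"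
        by (rule continuous_on_compose2[OF \<rho>]) (use s in auto)
      then show ?thesis by simp
    qed
    have "integral {0..s} (\<rho> s) = integral {0..s} (\<lambda>\<sigma>. nabla_norm g nabla (X s) (z s))"
      using s assms F_diagonal[of s] by (intro integral_cong) (auto simp: \<rho>_def max_def)
    also have "\<dots> = s * nabla_norm g nabla (X s) (z s)" using s by simp
    finally have "integral {0..s} (\<rho> s) = s * nabla_norm g nabla (X s) (z s)" .
    moreover have "integral {s..t} (\<rho> s) = growth_exponent t s"
      by (intro integral_cong) (auto simp: \<rho>_def max_def)
    moreover have "integral {0..s} (\<rho> s) + integral {s..t} (\<rho> s) = integral {0..t} (\<rho> s)"
      using s c by (intro Henstock_Kurzweil_Integration.integral_combine integrable_continuous_real) auto
    ultimately show "integral (cbox 0 t) (\<rho> s) - s * nabla_norm g nabla (X s) (z s) =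
        growth_exponent t s"
      by simp
  qed
qed

end

section \<open>Lengths of curves\<close>

lemma C1_curve_on_cong:
  assumes "C1_curve_on A I \<gamma>" and eq: "\<And>u. u \<in> I \<Longrightarrow> \<gamma> u = \<gamma>' u"
  shows "C1_curve_on A I \<gamma>'"
  unfolding C1_curve_on_def
proof (intro conjI ballI)
  show "continuous_on I \<gamma>'"
    using assms by (auto simp: C1_curve_on_def cong: continuous_on_cong)
  fix c assume "c \<in> A"
  then have "cont_diff_on 1 (snd c \<circ> \<gamma>) (I \<inter> \<gamma> -` fst c)"
    using assms(1) by (simp only: C1_curve_on_def)
  then have "cont_diff_on 1 (snd c \<circ> \<gamma>') (I \<inter> \<gamma> -` fst c)"
    by (rule cont_diff_on_cong) (use eq in auto)
  moreover have "I \<inter> \<gamma> -` fst c = I \<inter> \<gamma>' -` fst c" using eq by auto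
  ultimately show "cont_diff_on 1 (snd c \<circ> \<gamma>') (I \<inter> \<gamma>' -` fst c)" by (simp only:)
qed

lemma C1_curve_on_affine:
  assumes \<gamma>: "C1_curve_on A I \<gamma>" and maps: "\<And>u. u \<in> I' \<Longrightarrow> k * u + l \<in> I"
  shows "C1_curve_on A I' (\<lambda>u. \<gamma> (k * u + l))"
  unfolding C1_curve_on_def
proof (intro conjI ballI)
  show "continuous_on I' (\<lambda>u. \<gamma> (k * u + l))"
  proof (rule continuous_on_compose2[of I \<gamma>])
    show "continuous_on I \<gamma>" using \<gamma> by (simp only: C1_curve_on_def)
  qed (use maps in \<open>auto intro!: continuous_intros\<close>)
  fix c assume "c \<in> A"
  then have "cont_diff_on 1 (snd c \<circ> \<gamma>) (I \<inter> \<gamma> -` fst c)"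
    using \<gamma> by (simp only: C1_curve_on_def)
  moreover have "cont_diff_on 1 (\<lambda>u. k * u + l) (I' \<inter> (\<lambda>u. \<gamma> (k * u + l)) -` fst c)"
    by (intro cont_diff_on_add cont_diff_on_const
        cont_diff_on_bounded_linear[OF bounded_linear_mult_right] cont_diff_on_ident)
  ultimately have "cont_diff_on 1 (\<lambda>u. (snd c \<circ> \<gamma>) (k * u + l)) (I' \<inter> (\<lambda>u. \<gamma> (k * u + l)) -` fst c)"
    by (rule cont_diff_on_compose) (use maps in auto)
  then show "cont_diff_on 1 (snd c \<circ> (\<lambda>u. \<gamma> (k * u + l))) (I' \<inter> (\<lambda>u. \<gamma> (k * u + l)) -` fst c)"
    by (simp only: o_def)
qed

text \<open>The halves of \<open>joinpaths\<close> run at double speed: l = 0 gives the first half,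
  l = - 1 the second. The break points are those of the original curve, pulled back.\<close>

lemma piecewise_C1_curve_affine:
  assumes "piecewise_C1_curve A \<gamma>"
  obtains B where "finite B" and "\<And>a b. 0 \<le> 2 * a + l \<Longrightarrow> a < b \<Longrightarrow> 2 * b + l \<le> 1 \<Longrightarrow>
    B \<inter> {a<..<b} = {} \<Longrightarrow> C1_curve_on A {a..b} (\<lambda>u. \<gamma> (2 * u + l))"
proof -
  obtain B where B: "finite B"
    "\<And>a b. 0 \<le> a \<Longrightarrow> a < b \<Longrightarrow> b \<le> 1 \<Longrightarrow> B \<inter> {a<..<b} = {} \<Longrightarrow> C1_curve_on A {a..b} \<gamma>"
    using assms unfolding piecewise_C1_curve_def by blast
  show ?thesis
  proof (rule that)
    show "finite ((\<lambda>x. (x - l) / 2) ` B)" using B(1) by simp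
    fix a b assume ab: "0 \<le> 2 * a + l" "a < b" "2 * b + l \<le> 1"
      and no: "(\<lambda>x. (x - l) / 2) ` B \<inter> {a<..<b} = {}"
    have "B \<inter> {2 * a + l<..<2 * b + l} = {}"
    proof (rule ccontr)
      assume "B \<inter> {2 * a + l<..<2 * b + l} \<noteq> {}"
      then obtain x where x: "x \<in> B" "x \<in> {2 * a + l<..<2 * b + l}" by blast
      then have "(x - l) / 2 \<in> {a<..<b}" by auto
      then show False using x(1) no by blast
    qed
    then have "C1_curve_on A {2 * a + l..2 * b + l} \<gamma>" using B(2) ab by simp
    then show "C1_curve_on A {a..b} (\<lambda>u. \<gamma> (2 * u + l))"
      by (rule C1_curve_on_affine) auto
  qed
qed

lemma piecewise_C1_curve_joinpaths:
  assumes "piecewise_C1_curve A \<gamma>1" and "piecewise_C1_curve A \<gamma>2" and "\<gamma>1 1 = \<gamma>2 0"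
  shows "piecewise_C1_curve A (\<gamma>1 +++ \<gamma>2)"
proof -
  obtain B1 where B1: "finite B1" "\<And>a b. 0 \<le> 2 * a + 0 \<Longrightarrow> a < b \<Longrightarrow> 2 * b + 0 \<le> 1 \<Longrightarrow>
      B1 \<inter> {a<..<b} = {} \<Longrightarrow> C1_curve_on A {a..b} (\<lambda>u. \<gamma>1 (2 * u + 0))"
    by (fact piecewise_C1_curve_affine[OF assms(1)])
  obtain B2 where B2: "finite B2" "\<And>a b. 0 \<le> 2 * a + - 1 \<Longrightarrow> a < b \<Longrightarrow> 2 * b + - 1 \<le> 1 \<Longrightarrow>
      B2 \<inter> {a<..<b} = {} \<Longrightarrow> C1_curve_on A {a..b} (\<lambda>u. \<gamma>2 (2 * u + - 1))"
    by (fact piecewise_C1_curve_affine[OF assms(2)])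
  \<comment> \<open>The junction 1 / 2 becomes a break point. The closed pieces on either side may
    contain it as an end point, where both formulas give the same point because \<gamma>1 1 =
    \<gamma>2 0.\<close>
  define B where "B = B1 \<union> B2 \<union> {1 / 2}"
  have "path (\<gamma>1 +++ \<gamma>2)"
    using assms by (intro path_join_imp) (auto simp: path_def piecewise_C1_curve_def pathfinish_def pathstart_def)
  moreover have "finite B" using B1(1) B2(1) by (simp add: B_def)
  moreover have "C1_curve_on A {a..b} (\<gamma>1 +++ \<gamma>2)"
    if ab: "0 \<le> a" "a < b" "b \<le> 1" and no: "B \<inter> {a<..<b} = {}" for a b
  proof -
    have "1 / 2 \<notin> {a<..<b}" and no': "B1 \<inter> {a<..<b} = {}" "B2 \<inter> {a<..<b} = {}"
      using no by (auto simp: B_def)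
    then consider "b \<le> 1 / 2" | "1 / 2 \<le> a" by fastforce
    then show ?thesis
    proof cases
      case 1
      have "C1_curve_on A {a..b} (\<lambda>u. \<gamma>1 (2 * u + 0))"
        using ab 1 no'(1) by (intro B1(2)) auto
      then show ?thesis
        by (rule C1_curve_on_cong) (use 1 in \<open>auto simp: joinpaths_def\<close>)
    next
      case 2
      have "C1_curve_on A {a..b} (\<lambda>u. \<gamma>2 (2 * u + - 1))"
        using ab 2 no'(2) by (intro B2(2)) auto
      then show ?thesis
      proof (rule C1_curve_on_cong)
        fix u assume "u \<in> {a..b}"
        then consider "u = 1 / 2" | "u > 1 / 2" using 2 by fastforce
        then show "\<gamma>2 (2 * u + - 1) = (\<gamma>1 +++ \<gamma>2) u"
        proof cases
          case 1
          show ?thesis unfolding 1 using assms(3) by (simp add: joinpaths_def)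
        qed (simp add: joinpaths_def)
      qed
    qed
  qed
  ultimately show ?thesis unfolding piecewise_C1_curve_def path_def by blast
qed

section \<open>Speed, length and concatenation of paths\<close>

context riemannian_manifold
begin

definition speed :: "(real \<Rightarrow> 'm) \<Rightarrow> real \<Rightarrow> real" where
  "speed \<gamma> t = gnorm g (\<gamma> t) (vector_derivative (\<lambda>u. snd (chart_at A (\<gamma> t)) (\<gamma> u)) (at t))"

text \<open>An explicit path with a length bound, in place of the infimum: such bounds add up under
  concatenation, and the set whose infimum is \<open>riemannian_dist\<close> then contains an
  element.\<close>

definition joinable :: "'m \<Rightarrow> 'm \<Rightarrow> real \<Rightarrow> bool" where
  "joinable p q L \<longleftrightarrow>
     (\<exists>\<gamma>. piecewise_C1_curve A \<gamma> \<and> \<gamma> 0 = p \<and> \<gamma> 1 = q \<and> curve_length A g \<gamma> \<le> L)"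

lemma curve_length_eq: "curve_length A g \<gamma> = integral {0..1} (speed \<gamma>)"
  by (simp add: curve_length_def speed_def[abs_def])

lemma joinable_mono: "joinable p q L \<Longrightarrow> L \<le> L' \<Longrightarrow> joinable p q L'"
  unfolding joinable_def by (blast intro: order_trans)

text \<open>\<open>curve_length\<close> uses two-sided derivatives, whereas
  \<open>C1_curve_on\<close> gives derivatives within closed pieces. They agree in the interior of a
  piece, which is where every point off the finite set B can be placed.\<close>

lemma piecewise_C1_curve_differentiable:
  assumes "piecewise_C1_curve A \<gamma>"
  obtains B where "finite B" and "\<And>t c. t \<in> {0<..<1} - B \<Longrightarrow> c \<in> A \<Longrightarrow> \<gamma> t \<in> fst c \<Longrightarrow>
    ((\<lambda>u. snd c (\<gamma> u)) has_vector_derivative vector_derivative (\<lambda>u. snd c (\<gamma> u)) (at t)) (at t)"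
proof -
  obtain B where B: "finite B"
    "\<And>a b. 0 \<le> a \<Longrightarrow> a < b \<Longrightarrow> b \<le> 1 \<Longrightarrow> B \<inter> {a<..<b} = {} \<Longrightarrow> C1_curve_on A {a..b} \<gamma>"
    using assms unfolding piecewise_C1_curve_def by blast
  show ?thesis
  proof (rule that[OF B(1)])
    fix t c assume t: "t \<in> {0<..<1} - B" and c: "c \<in> A" "\<gamma> t \<in> fst c"
    have "open ({0<..<1} - B)" using B(1) by (intro open_Diff finite_imp_closed) auto
    then obtain e where e: "e > 0" "ball t e \<subseteq> {0<..<1} - B" using t open_contains_ball by blast
    define a where "a = t - e / 2"
    define b where "b = t + e / 2"
    have "a \<in> ball t e" "b \<in> ball t e" using e(1) by (auto simp: a_def b_def dist_real_def)
    then have "a \<in> {0<..<1}" "b \<in> {0<..<1}" using e(2) by blast+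
    moreover have "a < b" using e(1) by (simp add: a_def b_def)
    ultimately have ab: "0 \<le> a" "a < b" "b \<le> 1" by auto
    have "{a<..<b} \<subseteq> ball t e" using e(1) by (auto simp: a_def b_def dist_real_def abs_if)
    then have "B \<inter> {a<..<b} = {}" using e(2) by blast
    then have C1: "C1_curve_on A {a..b} \<gamma>" using B(2) ab by blast
    then have "continuous_on {a<..<b} \<gamma>"
      by (auto simp: C1_curve_on_def intro: continuous_on_subset)
    then have W: "open ({a<..<b} \<inter> \<gamma> -` fst c)"
      using chart_open[OF c(1)] by (intro continuous_open_preimage) auto
    have "cont_diff_on 1 (snd c \<circ> \<gamma>) ({a..b} \<inter> \<gamma> -` fst c)"
      using C1 c(1) by (simp only: C1_curve_on_def)
    moreover have tW: "t \<in> {a<..<b} \<inter> \<gamma> -` fst c" using c(2) e(1) by (auto simp: a_def b_def)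
    moreover from tW have "t \<in> {a..b} \<inter> \<gamma> -` fst c" by auto
    ultimately obtain f' where "((snd c \<circ> \<gamma>) has_derivative f') (at t within {a..b} \<inter> \<gamma> -` fst c)"
      unfolding One_nat_def cont_diff_on.simps by blast
    then have "((snd c \<circ> \<gamma>) has_derivative f') (at t within {a<..<b} \<inter> \<gamma> -` fst c)"
      by (rule has_derivative_subset) auto
    then have "((snd c \<circ> \<gamma>) has_derivative f') (at t)"
      by (simp only: at_within_open[OF tW W])
    then have "(\<lambda>u. snd c (\<gamma> u)) differentiable (at t)"
      unfolding o_def by (rule differentiableI)
    then show "((\<lambda>u. snd c (\<gamma> u)) has_vector_derivative vector_derivative (\<lambda>u. snd c (\<gamma> u)) (at t)) (at t)"
      by (simp only: vector_derivative_works)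
  qed
qed

lemma speed_affine:
  assumes "k > 0" and "\<gamma> t = \<gamma>' (k * t + l)" and ev: "\<forall>\<^sub>F u in nhds t. \<gamma> u = \<gamma>' (k * u + l)"
    and der: "((\<lambda>u. snd (chart_at A (\<gamma> t)) (\<gamma>' u)) has_vector_derivative
      vector_derivative (\<lambda>u. snd (chart_at A (\<gamma> t)) (\<gamma>' u)) (at (k * t + l))) (at (k * t + l))"
  shows "speed \<gamma> t = k * speed \<gamma>' (k * t + l)"
proof -
  let ?c = "chart_at A (\<gamma> t)"
  let ?v = "vector_derivative (\<lambda>u. snd ?c (\<gamma>' u)) (at (k * t + l))"
  have "((\<lambda>u. k * u + l) has_vector_derivative k) (at t)"
    by (auto intro!: derivative_eq_intros)
  from vector_diff_chain_at[OF this der]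
  have "((\<lambda>u. snd ?c (\<gamma>' (k * u + l))) has_vector_derivative k *\<^sub>R ?v) (at t)"
    by (simp add: o_def)
  moreover have "\<forall>\<^sub>F u in nhds t. snd ?c (\<gamma>' (k * u + l)) = snd ?c (\<gamma> u)"
    using ev by eventually_elim simp
  ultimately have "((\<lambda>u. snd ?c (\<gamma> u)) has_vector_derivative k *\<^sub>R ?v) (at t)"
    by (subst (asm) has_vector_derivative_cong_ev[where f = "\<lambda>u. snd ?c (\<gamma>' (k * u + l))" and g = "\<lambda>u. snd ?c (\<gamma> u)"])
      (auto simp: eventually_mono dest: eventually_nhds_x_imp_x)
  then have "vector_derivative (\<lambda>u. snd ?c (\<gamma> u)) (at t) = k *\<^sub>R ?v"
    by (rule vector_derivative_at)
  then show ?thesis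
    using assms(1,2) by (simp add: speed_def gnorm_scaleR)
qed

lemma curve_length_nonneg: "0 \<le> curve_length A g \<gamma>"
proof (cases "speed \<gamma> integrable_on {0..1}")
  case True
  then show ?thesis
    unfolding curve_length_eq by (intro integral_nonneg) (auto simp: speed_def gnorm_nonneg)
next
  case False
  then show ?thesis by (simp add: curve_length_eq not_integrable_integral)
qed

text \<open>Substitution of 2 * t + l: the speed doubles while the interval is halved. The end
  points and the preimages of break points form a finite set, negligible for the integral.
  Integrability passes from \<gamma> to \<gamma>' along the way.\<close>

lemma speed_integral_half:
  assumes "piecewise_C1_curve A \<gamma>'" and eq: "\<And>u. u \<in> {a<..<b} \<Longrightarrow> \<gamma> u = \<gamma>' (2 * u + l)"
    and ends: "2 * a + l = 0" "2 * b + l = 1" and int: "speed \<gamma> integrable_on {a..b}"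
  shows "integral {a..b} (speed \<gamma>) = curve_length A g \<gamma>'"
proof -
  obtain B where B: "finite B" "\<And>t c. t \<in> {0<..<1} - B \<Longrightarrow> c \<in> A \<Longrightarrow> \<gamma>' t \<in> fst c \<Longrightarrow>
    ((\<lambda>u. snd c (\<gamma>' u)) has_vector_derivative vector_derivative (\<lambda>u. snd c (\<gamma>' u)) (at t)) (at t)"
    by (fact piecewise_C1_curve_differentiable[OF assms(1)])
  let ?N = "(\<lambda>x. (x - l) / 2) ` B \<union> {a, b}"
  have sp: "speed \<gamma> t = 2 * speed \<gamma>' (2 * t + l)" if t: "t \<in> {a..b} - ?N" for t
  proof (rule speed_affine)
    have tab: "t \<in> {a<..<b}" using t by auto
    have "2 * t + l \<notin> B"
    proof
      assume "2 * t + l \<in> B"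
      then have "t \<in> (\<lambda>x. (x - l) / 2) ` B" by (rule image_eqI[rotated]) simp
      then show False using t by blast
    qed
    then have t1: "2 * t + l \<in> {0<..<1} - B" using tab ends by auto
    have "\<forall>\<^sub>F u in nhds t. u \<in> {a<..<b}" using tab by (intro eventually_nhds_in_open) auto
    then show "\<forall>\<^sub>F u in nhds t. \<gamma> u = \<gamma>' (2 * u + l)" by eventually_elim (rule eq)
    show \<gamma>t: "\<gamma> t = \<gamma>' (2 * t + l)" using tab by (rule eq)
    show "((\<lambda>u. snd (chart_at A (\<gamma> t)) (\<gamma>' u)) has_vector_derivative
      vector_derivative (\<lambda>u. snd (chart_at A (\<gamma> t)) (\<gamma>' u)) (at (2 * t + l))) (at (2 * t + l))"
      by (rule B(2)[OF t1 chart_at_mem]) (simp only: \<gamma>t[symmetric] mem_chart_at)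
  qed simp
  let ?I = "integral {a..b} (speed \<gamma>)"
  have "((\<lambda>t. 2 * speed \<gamma>' (2 *\<^sub>R t + l)) has_integral ?I) {a..b}"
    by (rule has_integral_spike_finite[OF _ _ integrable_integral[OF int], of ?N]) (use B(1) sp in auto)
  moreover have ab: "cbox ((0 - l) /\<^sub>R 2) ((1 - l) /\<^sub>R 2) = {a..b}"
    using ends by (auto simp: field_simps)
  ultimately have "((\<lambda>u. 2 * speed \<gamma>' u) has_integral 2 * ?I) {0..1}"
    using has_integral_affinity_iff[of 2 "\<lambda>u. 2 * speed \<gamma>' u" l "2 * ?I" 0 1, unfolded ab] by simp
  then show ?thesis
    using has_integral_mult_right[of "\<lambda>u. 2 * speed \<gamma>' u" "2 * ?I" "{0..1}" "1 / 2"]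
    by (simp add: curve_length_eq integral_unique)
qed

text \<open>Only the inequality is needed, and it holds even if the integral for the joined curve
  took its junk value 0.\<close>

lemma curve_length_joinpaths:
  assumes "piecewise_C1_curve A \<gamma>1" and "piecewise_C1_curve A \<gamma>2"
  shows "curve_length A g (\<gamma>1 +++ \<gamma>2) \<le> curve_length A g \<gamma>1 + curve_length A g \<gamma>2"
proof (cases "speed (\<gamma>1 +++ \<gamma>2) integrable_on {0..1}")
  case False
  then show ?thesis
    using curve_length_nonneg[of \<gamma>1] curve_length_nonneg[of \<gamma>2]
    by (simp add: curve_length_eq[of "\<gamma>1 +++ \<gamma>2"] not_integrable_integral)
next
  case True
  let ?s = "speed (\<gamma>1 +++ \<gamma>2)"
  have int: "?s integrable_on {0..1 / 2}" "?s integrable_on {1 / 2..1}"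
    using True by (auto intro: integrable_on_subinterval)
  have "integral {0..1 / 2} ?s = curve_length A g \<gamma>1"
    by (rule speed_integral_half[OF assms(1), where l = 0]) (use int in \<open>auto simp: joinpaths_def\<close>)
  moreover have "integral {1 / 2..1} ?s = curve_length A g \<gamma>2"
    by (rule speed_integral_half[OF assms(2), where l = "- 1"]) (use int in \<open>auto simp: joinpaths_def\<close>)
  moreover have "integral {0..1 / 2} ?s + integral {1 / 2..1} ?s = integral {0..1} ?s"
    by (rule Henstock_Kurzweil_Integration.integral_combine[OF _ _ True]) auto
  ultimately show ?thesis by (simp add: curve_length_eq[of "\<gamma>1 +++ \<gamma>2"])
qed

lemma joinable_trans:
  assumes "joinable p q L" and "joinable q r L'"
  shows "joinable p r (L + L')"
proof -
  obtain \<gamma>1 where 1: "piecewise_C1_curve A \<gamma>1" "\<gamma>1 0 = p" "\<gamma>1 1 = q" "curve_length A g \<gamma>1 \<le> L"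
    using assms(1) by (auto simp: joinable_def)
  obtain \<gamma>2 where 2: "piecewise_C1_curve A \<gamma>2" "\<gamma>2 0 = q" "\<gamma>2 1 = r" "curve_length A g \<gamma>2 \<le> L'"
    using assms(2) by (auto simp: joinable_def)
  have "piecewise_C1_curve A (\<gamma>1 +++ \<gamma>2)"
    using 1 2 by (intro piecewise_C1_curve_joinpaths) auto
  moreover have "curve_length A g (\<gamma>1 +++ \<gamma>2) \<le> L + L'"
    using curve_length_joinpaths[OF 1(1) 2(1)] 1(4) 2(4) by linarith
  ultimately show ?thesis
    unfolding joinable_def using 1 2 by (intro exI[of _ "\<gamma>1 +++ \<gamma>2"]) (auto simp: joinpaths_def)
qed

lemma joinable_imp_riemannian_dist_le:
  assumes "joinable p q L"
  shows "riemannian_dist A g p q \<le> L"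
proof -
  obtain \<gamma> where \<gamma>: "piecewise_C1_curve A \<gamma>" "\<gamma> 0 = p" "\<gamma> 1 = q" "curve_length A g \<gamma> \<le> L"
    using assms by (auto simp: joinable_def)
  show ?thesis
    unfolding riemannian_dist_def
  proof (rule cInf_lower2[OF _ \<gamma>(4)])
    show "curve_length A g \<gamma> \<in> {curve_length A g \<gamma> |\<gamma>. piecewise_C1_curve A \<gamma> \<and> \<gamma> 0 = p \<and> \<gamma> 1 = q}"
      using \<gamma> by blast
    show "bdd_below {curve_length A g \<gamma> |\<gamma>. piecewise_C1_curve A \<gamma> \<and> \<gamma> 0 = p \<and> \<gamma> 1 = q}"
      by (rule bdd_belowI[of _ 0]) (auto simp: curve_length_nonneg)
  qed
qed

text \<open>In the chart c the path has constant velocity w, so its speed at a parameter is the norm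
  of w in the metric at that point of the segment, hence at most L.\<close>

lemma joinable_segment:
  assumes c: "c \<in> A" "p \<in> fst c" "q \<in> fst c"
    and seg: "closed_segment (snd c p) (snd c q) \<subseteq> snd c ` fst c"
    and le: "\<And>x. x \<in> closed_segment (snd c p) (snd c q) \<Longrightarrow>
      sqrt (metric_coord c x (snd c q - snd c p) (snd c q - snd c p)) \<le> L"
  shows "joinable p q L"
proof -
  define w where "w = snd c q - snd c p"
  define h where "h u = snd c p + u *\<^sub>R w" for u :: real
  define \<gamma> where "\<gamma> u = chart_inv c (h u)" for u
  have h_seg: "h u \<in> closed_segment (snd c p) (snd c q)" if "u \<in> {0..1}" for u
    using that by (auto simp: in_segment h_def w_def algebra_simps intro!: exI[of _ u])
  have h: "h u \<in> snd c ` fst c" if "u \<in> {0..1}" for u using h_seg[OF that] seg by blast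
  have \<gamma>c: "\<gamma> u \<in> fst c" "snd c (\<gamma> u) = h u" if "u \<in> {0..1}" for u
    using h[OF that] c(1) by (auto simp: \<gamma>_def chart_inv_mem chart_chart_inv)
  have h_smooth: "cont_diff_on k h S" for k S
    unfolding h_def
    by (intro cont_diff_on_add cont_diff_on_const
        cont_diff_on_bounded_linear[OF bounded_linear_scaleR_left] cont_diff_on_ident)
  have C1: "C1_curve_on A I \<gamma>" if I: "I \<subseteq> {0..1}" for I
    unfolding C1_curve_on_def
  proof (intro conjI ballI)
    show "continuous_on I \<gamma>"
      unfolding \<gamma>_def using h I
      by (intro continuous_on_compose2[OF continuous_on_chart_inv[OF c(1)] cont_diff_on_imp_continuous_on[OF h_smooth]])
        auto
    fix c' assume c': "c' \<in> A"
    have "cont_diff_on 1 (\<lambda>u. (snd c' \<circ> chart_inv c) (h u)) (I \<inter> \<gamma> -` fst c')"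
    proof (rule cont_diff_on_compose[OF _ h_smooth])
      show "cont_diff_on 1 (snd c' \<circ> chart_inv c) (snd c ` (fst c \<inter> fst c'))"
        using smooth_transition[OF c(1) c'] unfolding smooth_on_def by blast
      show "h ` (I \<inter> \<gamma> -` fst c') \<subseteq> snd c ` (fst c \<inter> fst c')"
      proof
        fix x assume "x \<in> h ` (I \<inter> \<gamma> -` fst c')"
        then obtain u where u: "u \<in> I" "\<gamma> u \<in> fst c'" "x = h u" by auto
        then have "x = snd c (\<gamma> u)" "\<gamma> u \<in> fst c" using \<gamma>c[of u] I by auto
        then show "x \<in> snd c ` (fst c \<inter> fst c')" using u(2) by blast
      qed
    qed
    then show "cont_diff_on 1 (snd c' \<circ> \<gamma>) (I \<inter> \<gamma> -` fst c')"
      by (simp only: o_def \<gamma>_def)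
  qed
  have "piecewise_C1_curve A \<gamma>"
    unfolding piecewise_C1_curve_def
  proof (intro conjI exI[of _ "{}"] allI impI)
    show "continuous_on {0..1} \<gamma>" using C1[of "{0..1}"] by (simp add: C1_curve_on_def)
    show "C1_curve_on A {a..b} \<gamma>" if "0 \<le> a \<and> a < b \<and> b \<le> 1 \<and> {} \<inter> {a<..<b} = {}" for a b
      using that by (intro C1) auto
  qed simp
  moreover have "\<gamma> 0 = p" "\<gamma> 1 = q"
    using c by (auto simp: \<gamma>_def h_def w_def chart_inv_chart)
  moreover have "curve_length A g \<gamma> \<le> L"
  proof (cases "speed \<gamma> integrable_on {0..1}")
    case False
    \<comment> \<open>The integral of a non-integrable function is 0 by convention, so the claim
      becomes 0 \<le> L; this holds since L bounds a norm.\<close>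
    have "0 \<le> sqrt (metric_coord c (snd c p) w w)"
      using inner_form_nonneg[OF inner_form_metric_coord[OF c(1)]] c(2) by simp
    also have "\<dots> \<le> L" using le[of "snd c p"] by (simp add: w_def)
    finally show ?thesis using False by (simp add: curve_length_eq not_integrable_integral)
  next
    case True
    have speed: "speed \<gamma> u \<le> L" if u: "u \<in> {0..1} - {0, 1}" for u
    proof -
      let ?c = "chart_at A (\<gamma> u)"
      have u1: "u \<in> {0..1}" using u by auto
      have "(h has_vector_derivative w) (at u)"
        unfolding h_def by (auto intro!: derivative_eq_intros)
      then have "(h has_derivative (\<lambda>s. s *\<^sub>R w)) (at u)" by (simp add: has_vector_derivative_def)
      moreover have "(snd ?c \<circ> chart_inv c has_derivative coord_change c ?c (\<gamma> u)) (at (h u))"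
        using transition_has_derivative[OF c(1) chart_at_mem \<gamma>c(1)[OF u1] mem_chart_at] \<gamma>c(2)[OF u1] by simp
      ultimately have "((snd ?c \<circ> chart_inv c) \<circ> h has_derivative coord_change c ?c (\<gamma> u) \<circ> (\<lambda>s. s *\<^sub>R w)) (at u)"
        by (rule diff_chain_at)
      moreover have "coord_change c ?c (\<gamma> u) \<circ> (\<lambda>s. s *\<^sub>R w) = (\<lambda>s. s *\<^sub>R of_coord c (\<gamma> u) w)"
        using linear_scale[OF linear_coord_change[OF c(1) chart_at_mem \<gamma>c(1)[OF u1] mem_chart_at]]
        by (auto simp: tangent_of_coord_eq)
      ultimately have "((\<lambda>s. snd ?c (\<gamma> s)) has_vector_derivative of_coord c (\<gamma> u) w) (at u)"
        by (simp add: has_vector_derivative_def o_def \<gamma>_def)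
      then have "speed \<gamma> u = gnorm g (\<gamma> u) (of_coord c (\<gamma> u) w)"
        by (simp add: speed_def vector_derivative_at)
      also have "\<dots> = sqrt (metric_coord c (h u) w w)"
        using gnorm_of_coord[OF c(1) \<gamma>c(1)[OF u1]] \<gamma>c(2)[OF u1] by simp
      also have "\<dots> \<le> L" using le[OF h_seg[OF u1]] by (simp add: w_def)
      finally show ?thesis .
    qed
    have "((\<lambda>u. if u \<in> {0, 1} then L else speed \<gamma> u) has_integral integral {0..1} (speed \<gamma>)) {0..1}"
      by (rule has_integral_spike_finite[OF _ _ integrable_integral[OF True], of "{0, 1}"]) auto
    then have "integral {0..1} (speed \<gamma>) \<le> integral {0..1} (\<lambda>u::real. L)"
      by (intro has_integral_le[OF _ integrable_integral]) (use speed in auto)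
    then show ?thesis by (simp add: curve_length_eq)
  qed
  ultimately show ?thesis unfolding joinable_def by blast
qed

end

section \<open>The distance estimate\<close>

context riemannian_manifold
begin

text \<open>Near p the coordinate metric exceeds its value at p by a factor of at most 1 +
  \<epsilon>, uniformly in the direction, so a segment inside a coordinate ball is at most that much
  longer than \<open>local_dist\<close>. Both orders of the end points are recorded because the
  final estimates use both.\<close>

lemma eventually_joinable:
  assumes "\<epsilon> > 0"
  shows "\<forall>\<^sub>F q in nhds p. joinable p q ((1 + \<epsilon>) * local_dist p q) \<and>
    joinable q p ((1 + \<epsilon>) * local_dist p q)"
proof -
  define c where "c = chart_at A p"
  have c: "c \<in> A" "p \<in> fst c" by (simp_all add: c_def chart_at_mem mem_chart_at)
  let ?S = "snd c ` fst c" and ?x0 = "snd c p"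
  let ?N = "\<lambda>x w. sqrt (metric_coord c x w w)"
  have form: "inner_form (metric_coord c x)" if "x \<in> ?S" for x
    using c(1) that by (rule inner_form_metric_coord)
  have form0: "inner_form (metric_coord c ?x0)" using c(2) by (intro form) simp
  obtain k where k: "0 < k" "\<And>w. k * norm w \<le> ?N ?x0 w"
    by (rule inner_form_norm_comparison[of "{0::real}" "\<lambda>_. metric_coord c ?x0"]) (use form0 in auto)
  have "continuous_on (?S \<times> sphere 0 1) (\<lambda>a. ?N (fst a) (snd a))"
    by (intro continuous_on_metric_coord_compose[OF c(1)] continuous_intros) auto
  moreover have "?x0 \<in> ?S" using c(2) by blast
  \<comment> \<open>On the Euclidean unit sphere the norm at p is at least k, so an additive
    tolerance \<epsilon> * k is a relative tolerance \<epsilon>.\<close>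
  moreover have "\<epsilon> * k > 0" using assms k(1) by simp
  ultimately obtain X0 where X0: "?x0 \<in> X0" "open X0"
    "\<forall>x\<in>X0 \<inter> ?S. \<forall>w\<in>sphere 0 1. dist (?N (fst (x, w)) (snd (x, w))) (?N (fst (?x0, w)) (snd (?x0, w))) \<le> \<epsilon> * k"
    by (rule continuous_on_prod_compactE[OF _ compact_sphere])
  have N_le: "?N x w \<le> (1 + \<epsilon>) * ?N ?x0 w" if x: "x \<in> X0" "x \<in> ?S" for x w
  proof (cases "w = 0")
    case True
    then show ?thesis using form[OF x(2)] form0 by (auto simp: inner_form_def bilinear_lzero)
  next
    case False
    let ?u = "(1 / norm w) *\<^sub>R w"
    have u: "?u \<in> sphere 0 1" using False by simp
    have "dist (?N x ?u) (?N ?x0 ?u) \<le> \<epsilon> * k"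
      using X0(3)[rule_format, of x ?u] x u by (simp only: fst_conv snd_conv IntI)
    then have "?N x ?u \<le> ?N ?x0 ?u + \<epsilon> * k" unfolding dist_real_def by linarith
    also have "\<epsilon> * k \<le> \<epsilon> * ?N ?x0 ?u"
      using k(2)[of ?u] u assms by simp
    finally have "?N x ?u \<le> (1 + \<epsilon>) * ?N ?x0 ?u" by (simp add: algebra_simps)
    moreover have "?N x ?u = ?N x w / norm w" "?N ?x0 ?u = ?N ?x0 w / norm w"
      by (simp_all only: inner_form_scaleR[OF form[OF x(2)]] inner_form_scaleR[OF form0]) simp_all
    ultimately have "?N x w / norm w \<le> (1 + \<epsilon>) * ?N ?x0 w / norm w" by simp
    then show ?thesis using False by (simp add: divide_le_cancel)
  qed
  have "open (X0 \<inter> ?S)" using X0(2) chart_image_open[OF c(1)] by blast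
  then obtain r where r: "r > 0" "ball ?x0 r \<subseteq> X0 \<inter> ?S"
    using X0(1) \<open>?x0 \<in> ?S\<close> open_contains_ball by blast
  have "open (fst c \<inter> snd c -` ball ?x0 r)" using c(1) by (rule open_chart_preimage) simp
  moreover have "p \<in> fst c \<inter> snd c -` ball ?x0 r" using c(2) r(1) by simp
  ultimately have "\<forall>\<^sub>F q in nhds p. q \<in> fst c \<inter> snd c -` ball ?x0 r"
    by (rule eventually_nhds_in_open)
  then show ?thesis
  proof eventually_elim
    case (elim q)
    let ?w = "snd c q - ?x0"
    have q: "q \<in> fst c" "snd c q \<in> ball ?x0 r" using elim by auto
    have seg: "closed_segment ?x0 (snd c q) \<subseteq> ball ?x0 r"
      using q(2) r(1) by (intro closed_segment_subset convex_ball) auto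
    have dist: "local_dist p q = ?N ?x0 ?w"
      by (simp add: c_def chart_dist_def flip: chart_dist_chart_at)
    have neg: "?N x (?x0 - snd c q) = ?N x ?w" if "x \<in> ?S" for x
      using inner_form_scaleR[OF form[OF that], of "- 1" ?w] by simp
    have le: "?N x ?w \<le> (1 + \<epsilon>) * local_dist p q" if "x \<in> closed_segment ?x0 (snd c q)" for x
      using N_le[of x ?w] that seg r(2) unfolding dist by blast
    have le': "?N x (?x0 - snd c q) \<le> (1 + \<epsilon>) * local_dist p q"
      if "x \<in> closed_segment (snd c q) ?x0" for x
    proof -
      have x: "x \<in> closed_segment ?x0 (snd c q)" using that by (simp add: closed_segment_commute)
      then have "x \<in> ?S" using seg r(2) by blast
      then show ?thesis using le[OF x] neg by simp
    qed
    have "joinable p q ((1 + \<epsilon>) * local_dist p q)"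
      by (rule joinable_segment[OF c q(1) _ le]) (use seg r(2) in auto)
    moreover have "joinable q p ((1 + \<epsilon>) * local_dist p q)"
      by (rule joinable_segment[OF c(1) q(1) c(2) _ le'])
        (use seg r(2) in \<open>auto simp: closed_segment_commute[of "snd c q"]\<close>)
    ultimately show ?case ..
  qed
qed

end

section \<open>Joining the end points of the family by short paths\<close>

context solution_family
begin

definition distance_integrand :: "real \<Rightarrow> real \<Rightarrow> real" where
  "distance_integrand t s = exp (growth_exponent t s) *
     relative_speed s"

lemma continuous_on_distance_integrand:
  assumes "0 \<le> t" and "t \<le> T"
  shows "continuous_on {0..t} (distance_integrand t)"
  unfolding distance_integrand_def[abs_def]
  using continuous_on_nabla_norm_integral[OF assms] continuous_on_speed_bound[OF assms(2)]
  by (intro continuous_intros)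

text \<open>Three estimates are multiplied: the initial displacement from
  \<open>initial_rate\<close>, its growth from time s to t from \<open>flow_comparison\<close>, and
  the passage from \<open>local_dist\<close> to a path from
  \<open>eventually_joinable\<close>.\<close>

lemma joinable_rate:
  assumes t: "t \<le> T" and s: "s \<in> {0..t}" and "\<delta> > 0"
  shows "\<forall>\<^sub>F s' in at s within {0..t}.
    joinable (F t s) (F t s') ((distance_integrand t s + \<delta>) * \<bar>s' - s\<bar>) \<and>
    joinable (F t s') (F t s) ((distance_integrand t s + \<delta>) * \<bar>s' - s\<bar>)"
proof -
  have sT: "s \<in> {0..T}" using s t by auto
  let ?I = "growth_exponent t s" and ?v = "relative_speed s"
  \<comment> \<open>All errors are given the same size e. As e tends to 0 the combined rate tends to
    \<open>distance_integrand t s\<close>, so some e > 0 keeps it below that value plus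
    \<delta>.\<close>
  have "((\<lambda>e. (1 + e) * (exp (?I + e) * (?v + e))) \<longlongrightarrow> distance_integrand t s) (at_right 0)"
    unfolding distance_integrand_def by (auto intro!: tendsto_eq_intros)
  then have "\<forall>\<^sub>F e in at_right 0. (1 + e) * (exp (?I + e) * (?v + e)) < distance_integrand t s + \<delta>"
    using \<open>\<delta> > 0\<close> by (intro order_tendstoD(2)) auto
  then have "\<forall>\<^sub>F e in at_right (0::real). e > 0 \<and>
      (1 + e) * (exp (?I + e) * (?v + e)) < distance_integrand t s + \<delta>"
    using eventually_at_right_less[of 0] by eventually_elim simp
  from eventually_happens'[OF trivial_limit_at_right_real this]
  obtain e where e: "e > 0" "(1 + e) * (exp (?I + e) * (?v + e)) < distance_integrand t s + \<delta>"
    by blast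
  obtain V where V: "open V" "F t s \<in> V"
    "\<And>q. q \<in> V \<Longrightarrow> joinable (F t s) q ((1 + e) * local_dist (F t s) q) \<and>
      joinable q (F t s) ((1 + e) * local_dist (F t s) q)"
    using eventually_joinable[OF e(1), of "F t s"] unfolding eventually_nhds by blast
  have st: "0 \<le> s" "s \<le> t" using s by auto
  obtain U where U: "open U" "F s s \<in> U"
    "\<And>y. solution_curve T X y \<Longrightarrow> y s \<in> U \<Longrightarrow> y t \<in> V \<and>
      local_dist (F t s) (y t) \<le> exp (?I + e) * local_dist (F s s) (y s)"
    by (fact flow_comparison[OF X_smooth F_solution[OF sT] st t e(1) V(1,2)])
  have within: "at s within {0..t} \<le> at s within {0..T}" by (rule at_le) (use t in auto)
  have "((\<lambda>s'. F s s') \<longlongrightarrow> F s s) (at s within {0..T})"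
    by (rule family_tendsto[where h = "\<lambda>_. s" and f = "\<lambda>s'. s'"])
      (use sT in \<open>auto simp: eventually_at_topological intro: exI[of _ UNIV]\<close>)
  then have "\<forall>\<^sub>F s' in at s within {0..T}. F s s' \<in> U"
    using U(1,2) by (rule topological_tendstoD)
  then have 1: "\<forall>\<^sub>F s' in at s within {0..t}. F s s' \<in> U"
    using within by (rule filter_leD[rotated])
  have 2: "\<forall>\<^sub>F s' in at s within {0..t}. local_dist (z s) (F s s') \<le> (?v + e) * \<bar>s' - s\<bar>"
    using initial_rate[OF sT e(1)] within by (rule filter_leD[rotated])
  have 3: "\<forall>\<^sub>F s' in at s within {0..t}. s' \<in> {0..t}"
    by (auto simp: eventually_at_topological)
  show ?thesis
    using 1 2 3
  proof eventually_elim
    case (elim s')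
    have "solution_curve T X (\<lambda>\<sigma>. F \<sigma> s')" using elim(3) t by (intro F_solution) auto
    from U(3)[OF this elim(1)]
    have V': "F t s' \<in> V" and d: "local_dist (F t s) (F t s') \<le> exp (?I + e) * local_dist (z s) (F s s')"
      using F_diagonal[OF sT] by auto
    have "(1 + e) * local_dist (F t s) (F t s') \<le> (1 + e) * (exp (?I + e) * ((?v + e) * \<bar>s' - s\<bar>))"
      using e(1) elim(2) by (intro mult_left_mono order_trans[OF d]) auto
    also have "\<dots> = (1 + e) * (exp (?I + e) * (?v + e)) * \<bar>s' - s\<bar>" by simp
    also have "\<dots> \<le> (distance_integrand t s + \<delta>) * \<bar>s' - s\<bar>"
      using e(2) by (intro mult_right_mono) auto
    finally show ?case using V(3)[OF V'] joinable_mono by blast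
  qed
qed

text \<open>In the local step F t a and F t b are joined through F t s. Where the integrand varies
  by less than \<delta> / 2, its value at s plus \<delta> / 2 is at most its mean plus \<delta>. The
  resulting bound is additive over adjacent intervals, as Bolzano's principle requires.\<close>

lemma joinable_family:
  assumes t: "0 \<le> t" "t \<le> T" and "\<delta> > 0"
  shows "joinable (F t 0) (F t t) (integral {0..t} (distance_integrand t) + \<delta> * t) \<and>
    joinable (F t t) (F t 0) (integral {0..t} (distance_integrand t) + \<delta> * t)"
proof -
  let ?\<phi> = "distance_integrand t"
  have \<phi>_int: "?\<phi> integrable_on {a..b}" if "0 \<le> a" "b \<le> t" for a b
    using that by (intro integrable_continuous_real
        continuous_on_subset[OF continuous_on_distance_integrand[OF t]]) auto
  define J where "J a b L \<longleftrightarrow> joinable (F t a) (F t b) L \<and> joinable (F t b) (F t a) L" for a b L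
  define P where "P a b \<longleftrightarrow> (0 \<le> a \<and> b \<le> t \<longrightarrow> J a b (integral {a..b} ?\<phi> + \<delta> * (b - a)))" for a b
  have J_trans: "J a c (L + L')" if "J a b L" "J b c L'" for a b c L L'
    using that joinable_trans[of "F t a" "F t b" L "F t c" L'] joinable_trans[of "F t c" "F t b" L' "F t a" L]
    by (simp add: J_def add.commute)
  have combine: "integral {a..b} ?\<phi> + integral {b..c} ?\<phi> = integral {a..c} ?\<phi>"
    if "0 \<le> a" "a \<le> b" "b \<le> c" "c \<le> t" for a b c
    using that by (intro Henstock_Kurzweil_Integration.integral_combine \<phi>_int) auto
  have "P 0 t"
    using t(1)
  proof (induction rule: Bolzano)
    case (trans a b c)
    show ?case
      unfolding P_def
    proof
      assume ac: "0 \<le> a \<and> c \<le> t"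
      then have "J a b (integral {a..b} ?\<phi> + \<delta> * (b - a))" and "J b c (integral {b..c} ?\<phi> + \<delta> * (c - b))"
        using trans by (auto simp: P_def)
      then have "J a c ((integral {a..b} ?\<phi> + \<delta> * (b - a)) + (integral {b..c} ?\<phi> + \<delta> * (c - b)))"
        by (rule J_trans)
      moreover have "(integral {a..b} ?\<phi> + \<delta> * (b - a)) + (integral {b..c} ?\<phi> + \<delta> * (c - b)) =
          integral {a..c} ?\<phi> + \<delta> * (c - a)"
        using combine[of a b c] trans(3,4) ac by (simp add: algebra_simps)
      ultimately show "J a c (integral {a..c} ?\<phi> + \<delta> * (c - a))" by simp
    qed
  next
    case (local s)
    have s: "s \<in> {0..t}" using local by auto
    have \<delta>2: "\<delta> / 2 > 0" using \<open>\<delta> > 0\<close> by simp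
    have "(?\<phi> \<longlongrightarrow> ?\<phi> s) (at s within {0..t})"
      using continuous_on_distance_integrand[OF t] s by (auto simp: continuous_on_def)
    then have "\<forall>\<^sub>F s' in at s within {0..t}. dist (?\<phi> s') (?\<phi> s) < \<delta> / 2"
      using \<delta>2 by (rule tendstoD)
    with joinable_rate[OF t(2) s \<delta>2]
    have "\<forall>\<^sub>F s' in at s within {0..t}. J s s' ((?\<phi> s + \<delta> / 2) * \<bar>s' - s\<bar>) \<and> \<bar>?\<phi> s' - ?\<phi> s\<bar> < \<delta> / 2"
      by eventually_elim (simp add: J_def dist_real_def)
    then obtain d where d: "d > 0" "\<And>s'. s' \<in> {0..t} \<Longrightarrow> s' \<noteq> s \<Longrightarrow> dist s' s < d \<Longrightarrow>
        J s s' ((?\<phi> s + \<delta> / 2) * \<bar>s' - s\<bar>) \<and> \<bar>?\<phi> s' - ?\<phi> s\<bar> < \<delta> / 2"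
      by (auto simp: eventually_at)
    have \<phi>_le: "(?\<phi> s + \<delta> / 2) * (b - a) \<le> integral {a..b} ?\<phi> + \<delta> * (b - a)"
      if ab: "0 \<le> a" "a \<le> b" "b \<le> t" and near: "\<And>u. u \<in> {a..b} \<Longrightarrow> \<bar>u - s\<bar> < d" for a b
    proof -
      have "(?\<phi> s - \<delta> / 2) * (b - a) = integral {a..b} (\<lambda>_. ?\<phi> s - \<delta> / 2)" using ab by simp
      also have "\<dots> \<le> integral {a..b} ?\<phi>"
      proof (rule integral_le)
        fix u assume u: "u \<in> {a..b}"
        show "?\<phi> s - \<delta> / 2 \<le> ?\<phi> u"
        proof (cases "u = s")
          case False
          then have "\<bar>?\<phi> u - ?\<phi> s\<bar> < \<delta> / 2"
            using d(2)[of u] u ab near[OF u] by (auto simp: dist_real_def)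
          then show ?thesis by linarith
        qed (use \<delta>2 in simp)
      qed (use ab \<phi>_int in auto)
      finally have "(?\<phi> s - \<delta> / 2) * (b - a) \<le> integral {a..b} ?\<phi>" .
      moreover have "(?\<phi> s + \<delta> / 2) * (b - a) = (?\<phi> s - \<delta> / 2) * (b - a) + \<delta> * (b - a)"
        by (simp add: field_simps)
      ultimately show ?thesis by simp
    qed
    have half: "J s s' ((?\<phi> s + \<delta> / 2) * \<bar>s' - s\<bar>)" if "s' \<in> {0..t}" "\<bar>s' - s\<bar> < d" for s'
    proof (cases "s' = s")
      \<comment> \<open>The limit at s says nothing about s' = s. There a path of length 0 from F t
        s to itself is called for; \<open>eventually_joinable\<close> provides it, the local
        distance being 0.\<close>
      case True
      have "\<forall>\<^sub>F q in nhds (F t s). joinable (F t s) q ((1 + 1) * local_dist (F t s) q)"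
        using eventually_joinable[OF zero_less_one, of "F t s"] by (rule eventually_mono) blast
      from eventually_nhds_x_imp_x[OF this]
      show ?thesis using True by (simp add: J_def local_dist_def gnorm_zero)
    qed (use d(2)[of s'] that in \<open>auto simp: dist_real_def\<close>)
    have "P a b" if ab: "a \<le> s" "s \<le> b" "b - a < d" for a b
      unfolding P_def
    proof
      assume ab': "0 \<le> a \<and> b \<le> t"
      have "J s a ((?\<phi> s + \<delta> / 2) * \<bar>a - s\<bar>)" by (rule half) (use ab ab' in auto)
      moreover have "J s b ((?\<phi> s + \<delta> / 2) * \<bar>b - s\<bar>)" by (rule half) (use ab ab' in auto)
      ultimately have "J a s ((?\<phi> s + \<delta> / 2) * (s - a))" and "J s b ((?\<phi> s + \<delta> / 2) * (b - s))"
        using ab by (auto simp: J_def)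
      then have "J a b ((?\<phi> s + \<delta> / 2) * (s - a) + (?\<phi> s + \<delta> / 2) * (b - s))" by (rule J_trans)
      then have "J a b ((?\<phi> s + \<delta> / 2) * (b - a))" by (simp flip: distrib_left)
      moreover have "(?\<phi> s + \<delta> / 2) * (b - a) \<le> integral {a..b} ?\<phi> + \<delta> * (b - a)"
        using ab ab' by (intro \<phi>_le) auto
      ultimately show "J a b (integral {a..b} ?\<phi> + \<delta> * (b - a))"
        using joinable_mono unfolding J_def by blast
    qed
    then show ?case using d(1) by blast
  qed
  then show ?thesis using t(1) by (simp add: P_def J_def)
qed

lemma riemannian_dist_family_le:
  assumes t: "0 < t" "t \<le> T"
  shows "riemannian_dist A g (F t 0) (F t t) \<le> integral {0..t} (distance_integrand t)"
    and "riemannian_dist A g (F t t) (F t 0) \<le> integral {0..t} (distance_integrand t)"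
proof -
  \<comment> \<open>The error \<delta> * t becomes an arbitrary e through \<delta> = e / t, which
    uses t > 0.\<close>
  have "joinable (F t 0) (F t t) (integral {0..t} (distance_integrand t) + e) \<and>
      joinable (F t t) (F t 0) (integral {0..t} (distance_integrand t) + e)" if "e > 0" for e
    using joinable_family[of t "e / t"] t that by simp
  then show "riemannian_dist A g (F t 0) (F t t) \<le> integral {0..t} (distance_integrand t)"
    and "riemannian_dist A g (F t t) (F t 0) \<le> integral {0..t} (distance_integrand t)"
    by (blast intro: field_le_epsilon joinable_imp_riemannian_dist_le)+
qed

end

section \<open>Upper bounds in the extended reals\<close>

lemma nn_integral_Icc_continuous:
  fixes f :: "real \<Rightarrow> real"
  assumes "continuous_on {a..b} f" and "\<And>s. s \<in> {a..b} \<Longrightarrow> 0 \<le> f s"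
  shows "(\<integral>\<^sup>+ s\<in>{a..b}. ennreal (f s) \<partial>lborel) = ennreal (integral {a..b} f)"
proof -
  have "integral\<^sup>N lborel (\<lambda>s. indicator {a..b} s * f s) = ennreal (integral {a..b} f)"
    using assms by (intro nn_integral_has_integral_lebesgue integrable_integral integrable_continuous_real) auto
  moreover have "ennreal (indicator {a..b} s * f s) = ennreal (f s) * indicator {a..b} s" for s
    by (auto simp: indicator_def)
  ultimately show ?thesis by simp
qed

lemma ennreal_integral_le_star_norm:
  assumes "continuous_on {a..b} (\<lambda>s. \<rho> (q s) s)" and "\<And>s. s \<in> {a..b} \<Longrightarrow> 0 \<le> \<rho> (q s) s"
    and "{a..b} \<subseteq> {0..t}"
  shows "ennreal (integral {a..b} (\<lambda>s. \<rho> (q s) s)) \<le> star_norm \<rho> t"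
proof -
  have "ennreal (integral {a..b} (\<lambda>s. \<rho> (q s) s)) = (\<integral>\<^sup>+ s\<in>{a..b}. ennreal (\<rho> (q s) s) \<partial>lborel)"
    using assms(1,2) by (rule nn_integral_Icc_continuous[symmetric])
  also have "\<dots> \<le> star_norm \<rho> t"
    unfolding star_norm_def
    using assms(3) by (intro nn_integral_mono) (auto simp: indicator_def intro!: SUP_upper)
  finally show ?thesis .
qed

lemma ennreal_exp_le_exp_ennreal:
  assumes "0 \<le> r" and "ennreal r \<le> S"
  shows "ennreal (exp r) \<le> exp_ennreal S"
proof (cases "S = \<infinity>")
  case False
  then have "r \<le> enn2real S"
    using enn2real_mono[OF assms(2)] assms(1) by (simp add: less_top)
  then show ?thesis using False by (simp add: exp_ennreal_def)
qed (simp add: exp_ennreal_def)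

lemma ennreal_integral_mult_le:
  fixes f h :: "real \<Rightarrow> real"
  assumes "continuous_on {a..b} f" and h: "continuous_on {a..b} h"
    and "\<And>s. s \<in> {a..b} \<Longrightarrow> 0 \<le> f s" and h0: "\<And>s. s \<in> {a..b} \<Longrightarrow> 0 \<le> h s"
    and "\<And>s. s \<in> {a..b} \<Longrightarrow> ennreal (f s) \<le> C"
  shows "ennreal (integral {a..b} (\<lambda>s. f s * h s)) \<le> C * ennreal (integral {a..b} h)"
proof -
  have "(\<lambda>s. indicator {a..b} s *\<^sub>R h s) \<in> borel_measurable borel"
    using h by (intro borel_measurable_continuous_on_indicator) auto
  then have "(\<lambda>s. ennreal (indicator {a..b} s *\<^sub>R h s)) \<in> borel_measurable lborel" by simp
  moreover have eq: "ennreal (indicator {a..b} s *\<^sub>R h s) = ennreal (h s) * indicator {a..b} s" for s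
    by (auto simp: indicator_def)
  ultimately have meas: "(\<lambda>s. ennreal (h s) * indicator {a..b} s) \<in> borel_measurable lborel" by simp
  have "ennreal (integral {a..b} (\<lambda>s. f s * h s)) = (\<integral>\<^sup>+ s\<in>{a..b}. ennreal (f s * h s) \<partial>lborel)"
    using assms by (intro nn_integral_Icc_continuous[symmetric] continuous_intros) auto
  also have "\<dots> \<le> (\<integral>\<^sup>+ s. C * (ennreal (h s) * indicator {a..b} s) \<partial>lborel)"
    using assms by (intro nn_integral_mono) (auto simp: indicator_def ennreal_mult intro!: mult_right_mono)
  also have "\<dots> = C * (\<integral>\<^sup>+ s\<in>{a..b}. ennreal (h s) \<partial>lborel)"
    using meas by (rule nn_integral_cmult)
  also have "\<dots> = C * ennreal (integral {a..b} h)"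
    using nn_integral_Icc_continuous[OF h h0] by simp
  finally show ?thesis .
qed

context solution_family
begin

text \<open>The growth exponent over {s..t} is at most the star norm over {0..t}. This bound is
  uniform in s, so the exponential can be taken out of the integral.\<close>

lemma distance_integral_le_star_norm:
  assumes t: "0 \<le> t" "t \<le> T"
  shows "ennreal (integral {0..t} (distance_integrand t)) \<le>
    exp_ennreal (star_norm (\<lambda>p s. nabla_norm g nabla (X s) p) t) *
    ennreal (integral {0..t} relative_speed)"
  unfolding distance_integrand_def[abs_def]
proof (rule ennreal_integral_mult_le)
  show "continuous_on {0..t} (\<lambda>s. exp (growth_exponent t s))"
    using continuous_on_nabla_norm_integral[OF t] by (intro continuous_intros)
  show "continuous_on {0..t} relative_speed"
    using t(2) by (rule continuous_on_speed_bound)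
  fix s assume s: "s \<in> {0..t}"
  have sub: "{s..t} \<subseteq> {0..T}" and sT: "s \<in> {0..T}" using s t by auto
  have nonneg: "0 \<le> nabla_norm g nabla (X \<sigma>) (F \<sigma> s)" if "\<sigma> \<in> {s..t}" for \<sigma>
    using nabla_norm_time_nonneg[OF X_smooth] that sub by blast
  have cont: "continuous_on {s..t} (\<lambda>\<sigma>. nabla_norm g nabla (X \<sigma>) (F \<sigma> s))"
    by (rule continuous_on_nabla_norm_curve[OF X_smooth
          continuous_on_subset[OF solution_curve_continuous_on[OF F_solution[OF sT]] sub] sub])
  have "ennreal (growth_exponent t s) \<le>
      star_norm (\<lambda>p s. nabla_norm g nabla (X s) p) t"
    by (rule ennreal_integral_le_star_norm[where \<rho> = "\<lambda>p s. nabla_norm g nabla (X s) p" and q = "\<lambda>\<sigma>. F \<sigma> s"])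
      (use cont nonneg s in auto)
  moreover have "0 \<le> growth_exponent t s"
    using cont nonneg by (intro integral_nonneg integrable_continuous_real) auto
  ultimately show "ennreal (exp (growth_exponent t s)) \<le>
      exp_ennreal (star_norm (\<lambda>p s. nabla_norm g nabla (X s) p) t)"
    by (intro ennreal_exp_le_exp_ennreal)
qed (auto simp: gnorm_nonneg)

lemma speed_integral_le_star_norm:
  assumes t: "0 \<le> t" "t \<le> T"
  shows "ennreal (integral {0..t} relative_speed) \<le>
    star_norm (\<lambda>p s. gnorm g p (Z s p - X s p)) t"
  by (rule ennreal_integral_le_star_norm[where \<rho> = "\<lambda>p s. gnorm g p (Z s p - X s p)" and q = z])
    (auto simp: gnorm_nonneg intro: continuous_on_speed_bound[OF t(2)])

end

section \<open>The zero field, the flows and the three instances of the estimate\<close>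

context levi_civita_manifold
begin

text \<open>The supremum over unit vectors is rewritten over the Euclidean sphere, which is visibly
  nonempty; the supremum of the constant 0 is then 0.\<close>

lemma nabla_norm_zero: "nabla_norm g nabla (\<lambda>q. 0) p = 0"
proof -
  have "linear (\<lambda>v::'e. 0::'e)" by (simp add: linear_iff)
  from inner_form_operator_norm(1)[OF inner_form_metric this, of p]
  have "nabla_norm g nabla (\<lambda>q. 0) p = (SUP v\<in>sphere (0::'e) 1. 0)"
    using gnorm_zero[of p] by (simp add: nabla_norm_def nabla_zero gnorm_def)
  also have "\<dots> = 0" by (rule cSUP_const) simp
  finally show ?thesis .
qed

lemma smooth_zero_time_dependent_field: "smooth_time_dependent_field A T (\<lambda>s q. 0)"
  unfolding smooth_time_dependent_field_def
proof
  fix c assume "c \<in> A"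
  then show "smooth_on (\<lambda>(t, x). to_coord c (chart_inv c x) 0) ({0..T} \<times> snd c ` fst c)"
    by (intro smooth_on_cong[OF smooth_on_const[of 0]])
      (auto simp: chart_inv_chart linear_0[OF linear_tangent_coord])
qed

lemma solution_curve_const: "solution_curve T (\<lambda>s q. 0) (\<lambda>s. p)"
  by (simp add: solution_curve_def has_velocity_def)

lemma flow_solution:
  assumes "complete_field A T X" and "s \<in> {0..T}"
  shows "solution_curve T X (\<lambda>t. flow A T X t s p)" and "flow A T X s s p = p"
proof -
  have "\<exists>\<sigma>. integral_curve A T X s p \<sigma>" using assms by (auto simp: complete_field_def)
  then have "integral_curve A T X s p (SOME \<sigma>. integral_curve A T X s p \<sigma>)" by (rule someI_ex)
  then show "solution_curve T X (\<lambda>t. flow A T X t s p)" and "flow A T X s s p = p"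
    by (simp_all add: flow_def integral_curve_def solution_curve_def)
qed

end

theorem theorem1p7:
  fixes A :: "('m::{t2_space, second_countable_topology}, 'e::euclidean_space) chart set"
    and g :: "'m \<Rightarrow> 'e \<Rightarrow> 'e \<Rightarrow> real"
    and nabla :: "'m \<Rightarrow> 'e \<Rightarrow> ('m \<Rightarrow> 'e) \<Rightarrow> 'e"
    and X Y :: "real \<Rightarrow> 'm \<Rightarrow> 'e"
    and T t :: real
    and m :: 'm
  assumes "smooth_atlas A"
    and "connected (UNIV :: 'm set)"
    and "riemannian_metric A g"
    and "levi_civita A g nabla"
    and "T > 0"
    and "smooth_time_dependent_field A T X" and "complete_field A T X"
    and "smooth_time_dependent_field A T Y" and "complete_field A T Y"
    and "0 < t" and "t \<le> T"
  shows
    "riemannian_dist A g (flow A T X t 0 m) (flow A T Y t 0 m) \<le>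
       integral {0..t} (\<lambda>s.
         exp (integral {s..t} (\<lambda>\<sigma>.
               nabla_norm g nabla (X \<sigma>) (flow A T X \<sigma> s (flow A T Y s 0 m)))) *
         gnorm g (flow A T Y s 0 m) (Y s (flow A T Y s 0 m) - X s (flow A T Y s 0 m)))
     \<and>
     ennreal (integral {0..t} (\<lambda>s.
         exp (integral {s..t} (\<lambda>\<sigma>.
               nabla_norm g nabla (X \<sigma>) (flow A T X \<sigma> s (flow A T Y s 0 m)))) *
         gnorm g (flow A T Y s 0 m) (Y s (flow A T Y s 0 m) - X s (flow A T Y s 0 m)))) \<le>
       exp_ennreal (star_norm (\<lambda>p s. nabla_norm g nabla (X s) p) t) *
       star_norm (\<lambda>p s. gnorm g p (Y s p - X s p)) t
     \<and>
     riemannian_dist A g (flow A T Y t 0 m) m \<le>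
       integral {0..t} (\<lambda>s. gnorm g (flow A T Y s 0 m) (Y s (flow A T Y s 0 m)))
     \<and>
     ennreal (integral {0..t} (\<lambda>s. gnorm g (flow A T Y s 0 m) (Y s (flow A T Y s 0 m)))) \<le>
       star_norm (\<lambda>p s. gnorm g p (Y s p)) t
     \<and>
     riemannian_dist A g (flow A T Y t 0 m) m \<le>
       integral {0..t} (\<lambda>s.
         exp (integral {s..t} (\<lambda>\<sigma>. nabla_norm g nabla (Y \<sigma>) (flow A T Y \<sigma> s m))) *
         gnorm g m (Y s m))
     \<and>
     ennreal (integral {0..t} (\<lambda>s.
         exp (integral {s..t} (\<lambda>\<sigma>. nabla_norm g nabla (Y \<sigma>) (flow A T Y \<sigma> s m))) *
         gnorm g m (Y s m))) \<le>
       exp_ennreal (star_norm (\<lambda>p s. nabla_norm g nabla (Y s) p) t) *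
       ennreal (integral {0..t} (\<lambda>s. gnorm g m (Y s m)))"
proof -
  interpret levi_civita_manifold A g nabla
    by unfold_locales (fact assms)+
  let ?z = "\<lambda>s. flow A T Y s 0 m"
  have T0: "0 \<in> {0..T}" and t: "0 < t" "t \<le> T" "0 \<le> t" and tT: "t \<in> {0..T}"
    using assms(5,10,11) by auto
  note Yz = flow_solution[OF assms(9) T0, of m]
  \<comment> \<open>F \<sigma> s follows X from the point that the flow of Y has reached at time s.
    Hence F t 0 is the flow of X and F t t the flow of Y, both started at m.\<close>
  interpret XY: solution_family A g nabla T X Y ?z "\<lambda>\<sigma> s. flow A T X \<sigma> s (?z s)"
    by unfold_locales (fact assms Yz | rule flow_solution[OF assms(7)]; assumption)+
  \<comment> \<open>The constant curves solve the zero field, so F \<sigma> s = z s runs from m to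
    the flow of Y as s increases; the growth exponent vanishes and the relative speed is
    |Y|.\<close>
  interpret OY: solution_family A g nabla T "\<lambda>s q. 0" Y ?z "\<lambda>\<sigma> s. ?z s"
    by unfold_locales (fact assms Yz smooth_zero_time_dependent_field | rule solution_curve_const refl)+
  \<comment> \<open>The roles are exchanged: z rests at m while F follows Y, so F t t = m and F t 0
    is the flow of Y. The relative speed is |0 - Y| at m, whence \<open>minus\<close>.\<close>
  interpret YO: solution_family A g nabla T Y "\<lambda>s q. 0" "\<lambda>s. m" "\<lambda>\<sigma> s. flow A T Y \<sigma> s m"
    by unfold_locales (fact assms smooth_zero_time_dependent_field solution_curve_const
        | rule flow_solution[OF assms(9)]; assumption)+
  have minus: "gnorm g p (0 - v) = gnorm g p v" for p v
    using gnorm_minus_commute[of p 0 v] by simp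
  have OY_eq: "OY.distance_integrand t = (\<lambda>s. gnorm g (?z s) (Y s (?z s)))"
    by (simp add: OY.distance_integrand_def[abs_def] nabla_norm_zero)
  note XY_def = XY.distance_integrand_def[abs_def]
  note YO_def = YO.distance_integrand_def[abs_def, unfolded minus]
  have z0: "?z 0 = m" by (rule Yz)
  have tt: "flow A T X t t p = p" "flow A T Y t t p = p" for p
    using flow_solution(2)[OF _ tT] assms(7,9) by auto
  have "riemannian_dist A g (flow A T X t 0 m) (?z t) \<le> integral {0..t} (XY.distance_integrand t)"
    using XY.riemannian_dist_family_le(1)[OF t(1,2)] by (simp add: z0 tt)
  moreover have "ennreal (integral {0..t} (XY.distance_integrand t)) \<le>
      exp_ennreal (star_norm (\<lambda>p s. nabla_norm g nabla (X s) p) t) *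
      star_norm (\<lambda>p s. gnorm g p (Y s p - X s p)) t"
    using XY.distance_integral_le_star_norm[OF t(3,2)] XY.speed_integral_le_star_norm[OF t(3,2)]
    by (meson mult_left_mono order_trans zero_le)
  moreover have "riemannian_dist A g (?z t) m \<le> integral {0..t} (\<lambda>s. gnorm g (?z s) (Y s (?z s)))"
    using OY.riemannian_dist_family_le(2)[OF t(1,2)] by (simp add: z0 OY_eq)
  moreover have "ennreal (integral {0..t} (\<lambda>s. gnorm g (?z s) (Y s (?z s)))) \<le>
      star_norm (\<lambda>p s. gnorm g p (Y s p)) t"
    using OY.speed_integral_le_star_norm[OF t(3,2)] by simp
  moreover have "riemannian_dist A g (?z t) m \<le> integral {0..t} (YO.distance_integrand t)"
    using YO.riemannian_dist_family_le(1)[OF t(1,2)] by (simp add: tt)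
  moreover have "ennreal (integral {0..t} (YO.distance_integrand t)) \<le>
      exp_ennreal (star_norm (\<lambda>p s. nabla_norm g nabla (Y s) p) t) *
      ennreal (integral {0..t} (\<lambda>s. gnorm g m (Y s m)))"
    using YO.distance_integral_le_star_norm[OF t(3,2)] by (simp only: minus)
  ultimately show ?thesis unfolding XY_def YO_def by blast
qed

end
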